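(* Let $G$ be a discrete group, $H$ a Hilbert space, $A\subseteq\mathcal{B}(H)$ a non-degenerate $C^*$-algebra, and $\alpha:G\to\mathrm{Aut}(A)$ a homomorphism. Let $F : G\to CB(A)$ be a bounded function. The following are equivalent: (i) $F$ is a completely positive Herz-Schur $(A,G,\alpha)$-multiplier; (ii) the function $\mathcal{N}(F)$ is of positive type; (iii) $\mathcal{N}(F)$ is a Schur $A$-multiplier and $S_{\mathcal{N}(F)}$ is completely positive. Moreover, if (i) holds then $\|S_F\|_{\mathrm{cb}} = \|S_{\mathcal{N}(F)}\|_{\mathrm{cb}} = \|F(e)\|_{\mathrm{cb}}$.
   Context: $CB(A)=CB(A,A)$ is the space of completely bounded linear maps on $A$; $\otimes$ between $C^*$-algebras is the minimal tensor product; $e$ is the unit of $G$. Reduced crossed product: on $\mathcal{H}=\ell^2(G)\otimes H=\ell^2(G,H)$ let $(\lambda_t\xi)(s)=\xi(t^{-1}s)$ and $(\pi(a)\xi)(s)=\alpha_{s^{-1}}(a)(\xi(s))$ for $s,t\in G$, $a\in A$. For $f\in\ell^1(G,A)$ let $\tilde\pi(f)=\sum_{s\in G}\pi(f(s))\lambda_s$. Then $A\rtimes_{\alpha,r}G$ is the operator norm closure of $\tilde\pi(\ell^1(G,A))$ in $\mathcal{B}(\mathcal{H})$. Herz-Schur multipliers: a bounded map $F:G\to CB(A)$ is a Herz-Schur $(A,G,\alpha)$-multiplier if the map $S_F$ given by $S_F(\tilde\pi(f))=\tilde\pi(F\cdot f)$, where $(F\cdot f)(t)=F(t)(f(t))$,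 $f\in\ell^1(G,A)$, is completely bounded; then $S_F$ also denotes its unique completely bounded extension to $A\rtimes_{\alpha,r}G$. It is called completely positive if $S_F:A\rtimes_{\alpha,r}G\to A\rtimes_{\alpha,r}G$ is completely positive. For bounded $F:G\to CB(A)$ the function $\mathcal{N}(F):G\times G\to CB(A)$ is $\mathcal{N}(F)(s,t)(a)=\alpha_{s^{-1}}(F(st^{-1})(\alpha_s(a)))$, $s,t\in G$, $a\in A$. We view $CB(A)\subseteq CB(A,\mathcal{B}(H))$. Schur $A$-multipliers: for a set $X$ and $k\in\ell^2(X\times X,A)$ (i.e. $\sum_{x,y}\|k(x,y)\|^2<\infty$) let $T_k$ be the bounded operator on $\ell^2(X,H)$ given by $(T_k\xi)(x)=\sum_{y\in X}k(x,y)(\xi(y))$; let $\mathcal{S}_2(X\times X,A)=\{T_k\}$, a dense subspace of $\mathcal{K}(\ell^2(X))\otimes A$. For bounded $\varphi: X\times X\to CB(A,\mathcal{B}(H))$ put $(\varphi\cdot k)(x,y)=\varphi(x,y)(k(x,y))$ and $S_\varphi(T_k)=T_{\varphi\cdot k}$. $\varphi$ is a Schur $A$-multiplier if $S_\varphi$ is completely bounded on $\mathcal{S}_2(X\times X,A)$ with the operator space structure inherited from $\mathcal{K}(\ell^2(X))\otimes A$; then $S_\varphi$ also denotes its unique completely bounded extension $\mathcal{K}(\ell^2(X))\otimes A\to\mathcal{K}(\ell^2(X))\otimes\mathcal{B}(H)$. Here $X=G$. Positive type: a bounded $\varphi: X\times X\to CB(A,\mathcal{B}(H))$ is of positive type if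 for any $x_1,\ldots,x_m\in X$ (not necessarily distinct) and any $(a_{p,q})_{p,q}\in M_m(A)^+$ one has $(\varphi(x_p,x_q)(a_{p,q}))_{p,q}\in M_m(\mathcal{B}(H))^+$. *)

theory Defs
  imports "HOL-Analysis.Analysis"
begin

section \<open>Complex Hilbert spaces\<close>

class complex_normed_vector = real_normed_vector +
  fixes scaleC :: "complex \<Rightarrow> 'a \<Rightarrow> 'a"  (infixr \<open>*\<^sub>C\<close> 75)
  assumes scaleC_add_right: "c *\<^sub>C (x + y) = c *\<^sub>C x + c *\<^sub>C y"
    and scaleC_add_left: "(c + d) *\<^sub>C x = c *\<^sub>C x + d *\<^sub>C x"
    and scaleC_scaleC: "c *\<^sub>C d *\<^sub>C x = (c * d) *\<^sub>C x"
    and scaleR_scaleC: "r *\<^sub>R x = complex_of_real r *\<^sub>C x"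
    and norm_scaleC: "norm (c *\<^sub>C x) = cmod c * norm x"

abbreviation cspan :: "'a::complex_normed_vector set \<Rightarrow> 'a set"
  where "cspan \<equiv> module.span scaleC"

text \<open>The inner product is linear in its first argument.\<close>

class chilbert_space = complex_normed_vector + complete_space +
  fixes cinner :: "'a \<Rightarrow> 'a \<Rightarrow> complex"
  assumes cinner_add_left: "cinner (x + y) z = cinner x z + cinner y z"
    and cinner_scaleC_left: "cinner (c *\<^sub>C x) y = c * cinner x y"
    and cinner_commute: "cinner x y = cnj (cinner y x)"
    and cinner_norm: "cinner x x = complex_of_real ((norm x)\<^sup>2)"

lemma scaleC_one: "1 *\<^sub>C x = (x::'a::complex_normed_vector)"
  using scaleR_scaleC[of 1 x] by simp

lemma bounded_linear_scaleC: "bounded_linear (\<lambda>x::'a::complex_normed_vector. c *\<^sub>C x)"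
  by (rule bounded_linear_intro[where K = "cmod c"])
    (simp_all add: scaleC_add_right scaleR_scaleC scaleC_scaleC norm_scaleC mult.commute)

lemma cinner_add_right:
  "cinner x (y + z) = cinner x y + cinner x (z::'a::chilbert_space)"
  using cinner_commute[of x] cinner_add_left[of y z x] by (metis complex_cnj_add)

lemma norm_cinner_le: "cmod (cinner x y) \<le> (norm x)\<^sup>2 + (norm (y::'a::chilbert_space))\<^sup>2"
proof -
  have re: "\<bar>Re (cinner u v)\<bar> \<le> norm u * norm v" for u v :: 'a
  proof -
    have *: "Re (cinner a b) \<le> norm a * norm b" for a b :: 'a
    proof -
      have "cinner (a + b) (a + b) = cinner a a + cinner a b + cnj (cinner a b) + cinner b b"
        by (simp add: cinner_add_left cinner_add_right cinner_commute[of b a])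
      then have "Re (cinner (a + b) (a + b)) = (norm a)\<^sup>2 + 2 * Re (cinner a b) + (norm b)\<^sup>2"
        by (simp add: cinner_norm)
      moreover have "Re (cinner (a + b) (a + b)) = (norm (a + b))\<^sup>2"
        by (simp only: cinner_norm Re_complex_of_real)
      moreover have "(norm (a + b))\<^sup>2 \<le> (norm a + norm b)\<^sup>2"
        by (rule power_mono[OF norm_triangle_ineq]) simp
      ultimately show ?thesis by (simp add: power2_sum)
    qed
    have "cinner ((-1) *\<^sub>C u) v = - cinner u v" by (simp only: cinner_scaleC_left) simp
    moreover have "norm ((-1) *\<^sub>C u) = norm u" by (simp add: norm_scaleC)
    ultimately show ?thesis using *[of u v] *[of "(-1) *\<^sub>C u" v] by (simp add: abs_le_iff)
  qed
  have "\<bar>Im (cinner x y)\<bar> \<le> norm x * norm y"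
    using re[of "\<i> *\<^sub>C x" y] by (simp add: cinner_scaleC_left norm_scaleC)
  then have "cmod (cinner x y) \<le> 2 * (norm x * norm y)"
    using re[of x y] cmod_le[of "cinner x y"] by linarith
  also have "\<dots> \<le> (norm x)\<^sup>2 + (norm y)\<^sup>2"
    using sum_squares_bound[of "norm x" "norm y"] by simp
  finally show ?thesis .
qed

instantiation complex :: chilbert_space
begin
definition scaleC_complex :: "complex \<Rightarrow> complex \<Rightarrow> complex" where "scaleC_complex c x = c * x"
definition cinner_complex :: "complex \<Rightarrow> complex \<Rightarrow> complex" where "cinner_complex x y = x * cnj y"
instance
  by standard
    (simp_all add: scaleC_complex_def cinner_complex_def algebra_simps norm_mult
      scaleR_conv_of_real complex_norm_square[symmetric] del: of_real_power)
end

instantiation blinfun :: (real_normed_vector, complex_normed_vector) complex_normed_vector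
begin
lift_definition scaleC_blinfun :: "complex \<Rightarrow> 'a \<Rightarrow>\<^sub>L 'b \<Rightarrow> 'a \<Rightarrow>\<^sub>L 'b" is "\<lambda>c T x. c *\<^sub>C T x"
  by (rule bounded_linear_compose[OF bounded_linear_scaleC])
instance
proof
  fix c d :: complex and S T :: "'a \<Rightarrow>\<^sub>L 'b" and r :: real
  show "c *\<^sub>C (S + T) = c *\<^sub>C S + c *\<^sub>C T"
    by transfer (simp add: scaleC_add_right)
  show "(c + d) *\<^sub>C S = c *\<^sub>C S + d *\<^sub>C S"
    by transfer (simp add: scaleC_add_left)
  show "c *\<^sub>C d *\<^sub>C S = (c * d) *\<^sub>C S"
    by transfer (simp add: scaleC_scaleC)
  show "r *\<^sub>R S = complex_of_real r *\<^sub>C S"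
    by transfer (simp add: scaleR_scaleC)
  have le: "norm (e *\<^sub>C R) \<le> cmod e * norm R" for e and R :: "'a \<Rightarrow>\<^sub>L 'b"
    by (rule norm_blinfun_bound)
      (simp_all add: scaleC_blinfun.rep_eq norm_scaleC mult.assoc mult_left_mono norm_blinfun)
  show "norm (c *\<^sub>C S) = cmod c * norm S"
  proof (cases "c = 0")
    case True
    then show ?thesis using le[of 0 S] by simp
  next
    case False
    have "inverse c *\<^sub>C c *\<^sub>C S = S"
      using False by transfer (simp add: scaleC_scaleC scaleC_one)
    then have "norm S \<le> inverse (cmod c) * norm (c *\<^sub>C S)"
      using le[of "inverse c" "c *\<^sub>C S"] by (simp add: norm_inverse)
    then have "cmod c * norm S \<le> norm (c *\<^sub>C S)"
      using False by (simp add: field_simps)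
    then show ?thesis using le[of c S] by linarith
  qed
qed
end

section \<open>The Hilbert space of square summable families\<close>

typedef (overloaded) ('x, 'h) ell2 =
  "{\<xi> :: 'x \<Rightarrow> 'h::chilbert_space. (\<lambda>x. (norm (\<xi> x))\<^sup>2) summable_on UNIV}"
  by (rule exI[of _ "\<lambda>_. 0"]) simp

setup_lifting type_definition_ell2

lemma ell2_summable: "(\<lambda>x. (norm (Rep_ell2 \<xi> x))\<^sup>2) summable_on UNIV"
  using Rep_ell2[of \<xi>] by simp

lemma ell2_add_summable:
  fixes f g :: "'x \<Rightarrow> 'h::real_normed_vector"
  assumes "(\<lambda>x. (norm (f x))\<^sup>2) summable_on UNIV" "(\<lambda>x. (norm (g x))\<^sup>2) summable_on UNIV"
  shows "(\<lambda>x. (norm (f x + g x))\<^sup>2) summable_on UNIV"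
proof (rule summable_on_comparison_test)
  show "(\<lambda>x. 2 * ((norm (f x))\<^sup>2 + (norm (g x))\<^sup>2)) summable_on UNIV"
    by (intro summable_on_cmult_right summable_on_add assms)
  fix x
  have "(norm (f x + g x))\<^sup>2 \<le> (norm (f x) + norm (g x))\<^sup>2"
    by (rule power_mono[OF norm_triangle_ineq]) simp
  also have "\<dots> \<le> 2 * ((norm (f x))\<^sup>2 + (norm (g x))\<^sup>2)"
    using sum_squares_bound[of "norm (f x)" "norm (g x)"] by (simp add: power2_sum)
  finally show "(norm (f x + g x))\<^sup>2 \<le> 2 * ((norm (f x))\<^sup>2 + (norm (g x))\<^sup>2)" .
qed simp

lemma ell2_scaleC_summable:
  fixes f :: "'x \<Rightarrow> 'h::complex_normed_vector"
  assumes "(\<lambda>x. (norm (f x))\<^sup>2) summable_on UNIV"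
  shows "(\<lambda>x. (norm (c *\<^sub>C f x))\<^sup>2) summable_on UNIV"
  by (simp add: norm_scaleC power_mult_distrib) (intro summable_on_cmult_right assms)

lemma ell2_scaleR_summable:
  fixes f :: "'x \<Rightarrow> 'h::real_normed_vector"
  assumes "(\<lambda>x. (norm (f x))\<^sup>2) summable_on UNIV"
  shows "(\<lambda>x. (norm (r *\<^sub>R f x))\<^sup>2) summable_on UNIV"
  by (simp add: power_mult_distrib) (intro summable_on_cmult_right assms)

lemma ell2_cinner_summable:
  fixes f g :: "'x \<Rightarrow> 'h::chilbert_space"
  assumes "(\<lambda>x. (norm (f x))\<^sup>2) summable_on UNIV" "(\<lambda>x. (norm (g x))\<^sup>2) summable_on UNIV"
  shows "(\<lambda>x. cinner (f x) (g x)) summable_on UNIV"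
  by (rule Infinite_Sum.abs_summable_summable, rule Infinite_Sum.abs_summable_on_comparison_test'[OF summable_on_add[OF assms]])
    (rule norm_cinner_le)

lemma ell2_norm_nonneg: "0 \<le> sqrt (\<Sum>\<^sub>\<infinity>x. (norm (Rep_ell2 \<xi> x))\<^sup>2)"
  by (simp add: infsum_nonneg)

lemma ell2_norm_finite:
  assumes "finite F"
  shows "L2_set (\<lambda>x. norm (Rep_ell2 \<xi> x)) F \<le> sqrt (\<Sum>\<^sub>\<infinity>x. (norm (Rep_ell2 \<xi> x))\<^sup>2)"
  unfolding L2_set_def
  by (intro real_sqrt_le_mono finite_sum_le_infsum ell2_summable) (use assms in auto)

lemma ell2_norm_bound:
  assumes "\<And>F. finite F \<Longrightarrow> L2_set (\<lambda>x. norm (Rep_ell2 \<xi> x)) F \<le> b" "0 \<le> b"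
  shows "sqrt (\<Sum>\<^sub>\<infinity>x. (norm (Rep_ell2 \<xi> x))\<^sup>2) \<le> b"
proof -
  have "(\<Sum>\<^sub>\<infinity>x. (norm (Rep_ell2 \<xi> x))\<^sup>2) \<le> b\<^sup>2"
    by (rule infsum_le_finite_sums[OF ell2_summable])
      (use assms in \<open>auto simp: L2_set_def sqrt_le_D\<close>)
  then show ?thesis using assms(2) by (simp add: real_le_lsqrt infsum_nonneg)
qed

instantiation ell2 :: (type, chilbert_space) complex_normed_vector
begin

lift_definition zero_ell2 :: "('a, 'b) ell2" is "\<lambda>_. 0" by simp
lift_definition plus_ell2 :: "('a, 'b) ell2 \<Rightarrow> ('a, 'b) ell2 \<Rightarrow> ('a, 'b) ell2"
  is "\<lambda>f g x. f x + g x" by (rule ell2_add_summable)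
lift_definition uminus_ell2 :: "('a, 'b) ell2 \<Rightarrow> ('a, 'b) ell2"
  is "\<lambda>f x. - f x" by simp
lift_definition minus_ell2 :: "('a, 'b) ell2 \<Rightarrow> ('a, 'b) ell2 \<Rightarrow> ('a, 'b) ell2"
  is "\<lambda>f g x. f x - g x"
  by (rule ell2_add_summable[where g = "\<lambda>x. - g x" for g, simplified])
lift_definition scaleR_ell2 :: "real \<Rightarrow> ('a, 'b) ell2 \<Rightarrow> ('a, 'b) ell2"
  is "\<lambda>r f x. r *\<^sub>R f x" by (rule ell2_scaleR_summable)
lift_definition scaleC_ell2 :: "complex \<Rightarrow> ('a, 'b) ell2 \<Rightarrow> ('a, 'b) ell2"
  is "\<lambda>c f x. c *\<^sub>C f x" by (rule ell2_scaleC_summable)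
definition norm_ell2 :: "('a, 'b) ell2 \<Rightarrow> real"
  where "norm_ell2 \<xi> = sqrt (\<Sum>\<^sub>\<infinity>x. (norm (Rep_ell2 \<xi> x))\<^sup>2)"
definition sgn_ell2 :: "('a, 'b) ell2 \<Rightarrow> ('a, 'b) ell2"
  where "sgn_ell2 \<xi> = inverse (norm \<xi>) *\<^sub>R \<xi>"
definition dist_ell2 :: "('a, 'b) ell2 \<Rightarrow> ('a, 'b) ell2 \<Rightarrow> real"
  where "dist_ell2 \<xi> \<eta> = norm (\<xi> - \<eta>)"
definition uniformity_ell2 :: "(('a, 'b) ell2 \<times> ('a, 'b) ell2) filter"
  where "uniformity_ell2 = (INF e\<in>{0<..}. principal {(\<xi>, \<eta>). dist \<xi> \<eta> < e})"
definition open_ell2 :: "('a, 'b) ell2 set \<Rightarrow> bool"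
  where "open_ell2 U = (\<forall>\<xi>\<in>U. \<forall>\<^sub>F (\<xi>', \<eta>) in uniformity. \<xi>' = \<xi> \<longrightarrow> \<eta> \<in> U)"

instance
proof
  fix \<xi> \<eta> \<zeta> :: "('a, 'b) ell2" and r s :: real and c d :: complex
    and U :: "('a, 'b) ell2 set"
  note simps = zero_ell2.rep_eq plus_ell2.rep_eq uminus_ell2.rep_eq minus_ell2.rep_eq
    scaleR_ell2.rep_eq scaleC_ell2.rep_eq
  have n0: "0 \<le> norm \<theta>" for \<theta> :: "('a, 'b) ell2"
    unfolding norm_ell2_def by (rule ell2_norm_nonneg)
  have fin: "L2_set (\<lambda>x. norm (Rep_ell2 \<theta> x)) F \<le> norm \<theta>"
    if "finite F" for \<theta> :: "('a, 'b) ell2" and F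
    unfolding norm_ell2_def using that by (rule ell2_norm_finite)
  have bd: "norm \<theta> \<le> b"
    if "\<And>F. finite F \<Longrightarrow> L2_set (\<lambda>x. norm (Rep_ell2 \<theta> x)) F \<le> b" "0 \<le> b"
    for \<theta> :: "('a, 'b) ell2" and b
    unfolding norm_ell2_def using that by (rule ell2_norm_bound)
  have pt: "norm (Rep_ell2 \<theta> x) \<le> norm \<theta>" for \<theta> :: "('a, 'b) ell2" and x
    using fin[of "{x}" \<theta>] by simp
  show "\<xi> + \<eta> + \<zeta> = \<xi> + (\<eta> + \<zeta>)" by transfer (simp add: add.assoc)
  show "\<xi> + \<eta> = \<eta> + \<xi>" by transfer (simp add: add.commute)
  show "0 + \<xi> = \<xi>" by transfer simp
  show "- \<xi> + \<xi> = 0" by transfer simp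
  show "\<xi> - \<eta> = \<xi> + - \<eta>" by transfer simp
  show "r *\<^sub>R (\<xi> + \<eta>) = r *\<^sub>R \<xi> + r *\<^sub>R \<eta>" by transfer (simp add: scaleR_add_right)
  show "(r + s) *\<^sub>R \<xi> = r *\<^sub>R \<xi> + s *\<^sub>R \<xi>" by transfer (simp add: scaleR_add_left)
  show "r *\<^sub>R s *\<^sub>R \<xi> = (r * s) *\<^sub>R \<xi>" by transfer simp
  show "1 *\<^sub>R \<xi> = \<xi>" by transfer simp
  show "dist \<xi> \<eta> = norm (\<xi> - \<eta>)" by (rule dist_ell2_def)
  show "sgn \<xi> = inverse (norm \<xi>) *\<^sub>R \<xi>" by (rule sgn_ell2_def)
  show "uniformity = (INF e\<in>{0<..}. principal {(\<xi>::('a, 'b) ell2, \<eta>). dist \<xi> \<eta> < e})"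
    by (rule uniformity_ell2_def)
  show "open U = (\<forall>\<xi>\<in>U. \<forall>\<^sub>F (\<xi>', \<eta>) in uniformity. \<xi>' = \<xi> \<longrightarrow> \<eta> \<in> U)"
    by (rule open_ell2_def)
  show "(norm \<xi> = 0) = (\<xi> = 0)"
  proof
    assume "norm \<xi> = 0"
    then have "Rep_ell2 \<xi> x = 0" for x using pt[of \<xi> x] by simp
    then show "\<xi> = 0" by transfer auto
  qed (simp add: norm_ell2_def zero_ell2.rep_eq)
  show tri: "norm (\<xi> + \<eta>) \<le> norm \<xi> + norm \<eta>"
  proof (rule bd)
    fix F :: "'a set" assume F: "finite F"
    have "L2_set (\<lambda>x. norm (Rep_ell2 (\<xi> + \<eta>) x)) F
        \<le> L2_set (\<lambda>x. norm (Rep_ell2 \<xi> x) + norm (Rep_ell2 \<eta> x)) F"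
      by (rule L2_set_mono) (simp_all add: simps norm_triangle_ineq)
    also have "\<dots> \<le> L2_set (\<lambda>x. norm (Rep_ell2 \<xi> x)) F + L2_set (\<lambda>x. norm (Rep_ell2 \<eta> x)) F"
      by (rule L2_set_triangle_ineq)
    also have "\<dots> \<le> norm \<xi> + norm \<eta>" using fin[OF F] by (intro add_mono)
    finally show "L2_set (\<lambda>x. norm (Rep_ell2 (\<xi> + \<eta>) x)) F \<le> norm \<xi> + norm \<eta>" .
  qed (simp add: n0)
  show "norm (r *\<^sub>R \<xi>) = \<bar>r\<bar> * norm \<xi>"
    by (simp add: norm_ell2_def simps power_mult_distrib infsum_cmult_right' real_sqrt_mult)
  show "c *\<^sub>C (\<xi> + \<eta>) = c *\<^sub>C \<xi> + c *\<^sub>C \<eta>" by transfer (simp add: scaleC_add_right)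
  show "(c + d) *\<^sub>C \<xi> = c *\<^sub>C \<xi> + d *\<^sub>C \<xi>" by transfer (simp add: scaleC_add_left)
  show "c *\<^sub>C d *\<^sub>C \<xi> = (c * d) *\<^sub>C \<xi>" by transfer (simp add: scaleC_scaleC)
  show "r *\<^sub>R \<xi> = complex_of_real r *\<^sub>C \<xi>" by transfer (simp add: scaleR_scaleC)
  show "norm (c *\<^sub>C \<xi>) = cmod c * norm \<xi>"
    by (simp add: norm_ell2_def simps norm_scaleC power_mult_distrib infsum_cmult_right' real_sqrt_mult)
qed

end

instantiation ell2 :: (type, chilbert_space) chilbert_space
begin

definition cinner_ell2 :: "('a, 'b) ell2 \<Rightarrow> ('a, 'b) ell2 \<Rightarrow> complex"
  where "cinner_ell2 \<xi> \<eta> = (\<Sum>\<^sub>\<infinity>x. cinner (Rep_ell2 \<xi> x) (Rep_ell2 \<eta> x))"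

instance
proof
  fix \<xi> \<eta> \<zeta> :: "('a, 'b) ell2" and c :: complex and X :: "nat \<Rightarrow> ('a, 'b) ell2"
  note simps = zero_ell2.rep_eq plus_ell2.rep_eq uminus_ell2.rep_eq minus_ell2.rep_eq
    scaleR_ell2.rep_eq scaleC_ell2.rep_eq
  have fin: "L2_set (\<lambda>x. norm (Rep_ell2 \<theta> x)) F \<le> norm \<theta>"
    if "finite F" for \<theta> :: "('a, 'b) ell2" and F
    unfolding norm_ell2_def using that by (rule ell2_norm_finite)
  have bd: "norm \<theta> \<le> b"
    if "\<And>F. finite F \<Longrightarrow> L2_set (\<lambda>x. norm (Rep_ell2 \<theta> x)) F \<le> b" "0 \<le> b"
    for \<theta> :: "('a, 'b) ell2" and b
    unfolding norm_ell2_def using that by (rule ell2_norm_bound)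
  have pt: "norm (Rep_ell2 \<theta> x) \<le> norm \<theta>" for \<theta> :: "('a, 'b) ell2" and x
    using fin[of "{x}" \<theta>] by simp
  have nsq: "(norm \<theta>)\<^sup>2 = (\<Sum>\<^sub>\<infinity>x. (norm (Rep_ell2 \<theta> x))\<^sup>2)" for \<theta> :: "('a, 'b) ell2"
    by (simp add: norm_ell2_def infsum_nonneg)
  show "cinner (\<xi> + \<eta>) \<zeta> = cinner \<xi> \<zeta> + cinner \<eta> \<zeta>"
    unfolding cinner_ell2_def simps cinner_add_left
    by (intro infsum_add ell2_cinner_summable ell2_summable)
  show "cinner (c *\<^sub>C \<xi>) \<eta> = c * cinner \<xi> \<eta>"
    by (simp add: cinner_ell2_def simps cinner_scaleC_left infsum_cmult_right')
  show "cinner \<xi> \<eta> = cnj (cinner \<eta> \<xi>)"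
    unfolding cinner_ell2_def infsum_cnj[symmetric] by (subst cinner_commute) (rule refl)
  show "cinner \<xi> \<xi> = complex_of_real ((norm \<xi>)\<^sup>2)"
    unfolding nsq cinner_ell2_def cinner_norm 
    by (intro infsumI has_sum_bounded_linear[OF bounded_linear_of_real] has_sum_infsum ell2_summable)
  show "convergent X" if "Cauchy X"
  proof -
    have n_diff: "\<exists>M. \<forall>m\<ge>M. \<forall>n\<ge>M. norm (X m - X n) < e" if "e > 0" for e
      using metric_CauchyD[OF \<open>Cauchy X\<close> that] by (simp add: dist_ell2_def)
    have "convergent (\<lambda>n. Rep_ell2 (X n) x)" for x
    proof (rule Cauchy_convergent, rule metric_CauchyI)
      fix e :: real assume "e > 0"
      then obtain M where M: "\<And>m n. m \<ge> M \<Longrightarrow> n \<ge> M \<Longrightarrow> norm (X m - X n) < e"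
        using n_diff by blast
      show "\<exists>M. \<forall>m\<ge>M. \<forall>n\<ge>M. dist (Rep_ell2 (X m) x) (Rep_ell2 (X n) x) < e"
      proof (intro exI allI impI)
        fix m n assume "m \<ge> M" "n \<ge> M"
        then show "dist (Rep_ell2 (X m) x) (Rep_ell2 (X n) x) < e"
          using M[of m n] pt[of "X m - X n" x] by (simp add: dist_norm simps)
      qed
    qed
    then obtain L where L: "\<And>x. (\<lambda>n. Rep_ell2 (X n) x) \<longlonglongrightarrow> L x"
      unfolding convergent_def by metis
    have tail: "L2_set (\<lambda>x. norm (Rep_ell2 (X n) x - L x)) F \<le> e"
      if M: "\<And>m n. m \<ge> M \<Longrightarrow> n \<ge> M \<Longrightarrow> norm (X m - X n) < e" and "n \<ge> M" "finite F" for M n e F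
    proof (rule LIMSEQ_le_const2)
      show "(\<lambda>m. L2_set (\<lambda>x. norm (Rep_ell2 (X n) x - Rep_ell2 (X m) x)) F)
          \<longlonglongrightarrow> L2_set (\<lambda>x. norm (Rep_ell2 (X n) x - L x)) F"
        unfolding L2_set_def by (intro tendsto_intros L)
      show "\<exists>N. \<forall>m\<ge>N. L2_set (\<lambda>x. norm (Rep_ell2 (X n) x - Rep_ell2 (X m) x)) F \<le> e"
      proof (intro exI allI impI)
        fix m assume "m \<ge> M"
        then show "L2_set (\<lambda>x. norm (Rep_ell2 (X n) x - Rep_ell2 (X m) x)) F \<le> e"
          using fin[OF \<open>finite F\<close>, of "X n - X m"] M[of n m] \<open>n \<ge> M\<close> by (simp add: simps)
      qed
    qed
    have diff: "(\<lambda>x. (norm (Rep_ell2 (X n) x - L x))\<^sup>2) summable_on UNIV"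
      if M: "\<And>m n. m \<ge> M \<Longrightarrow> n \<ge> M \<Longrightarrow> norm (X m - X n) < e" and "n \<ge> M" for M n e
    proof (rule nonneg_bdd_above_summable_on)
      show "bdd_above (sum (\<lambda>x. (norm (Rep_ell2 (X n) x - L x))\<^sup>2) ` {F. F \<subseteq> UNIV \<and> finite F})"
        using tail[OF M \<open>n \<ge> M\<close>]
        by (intro bdd_aboveI2[where M = "e\<^sup>2"]) (auto simp: L2_set_def intro: sqrt_le_D)
    qed simp
    obtain M1 where M1: "\<And>m n. m \<ge> M1 \<Longrightarrow> n \<ge> M1 \<Longrightarrow> norm (X m - X n) < 1"
      using n_diff[of 1] by auto
    have "(\<lambda>x. (norm (Rep_ell2 (X M1) x + - (Rep_ell2 (X M1) x - L x)))\<^sup>2) summable_on UNIV"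
      by (rule ell2_add_summable[OF ell2_summable])
        (use diff[OF M1 order_refl] in \<open>simp only: norm_minus_cancel\<close>)
    then have Ls: "(\<lambda>x. (norm (L x))\<^sup>2) summable_on UNIV" by simp
    define Y where "Y = Abs_ell2 L"
    have Y: "Rep_ell2 Y = L" unfolding Y_def using Ls by (simp add: Abs_ell2_inverse)
    show "convergent X"
    proof (rule convergentI)
      show "X \<longlonglongrightarrow> Y"
      proof (rule metric_LIMSEQ_I)
        fix e :: real assume e: "e > 0"
        then obtain M where M: "\<And>m n. m \<ge> M \<Longrightarrow> n \<ge> M \<Longrightarrow> norm (X m - X n) < e / 2"
          using n_diff[of "e / 2"] by auto
        have "norm (X n - Y) \<le> e / 2" if "n \<ge> M" for n
          by (rule bd) (use tail[OF M that] e in \<open>simp_all add: simps Y\<close>)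
        then show "\<exists>N. \<forall>n\<ge>N. dist (X n) Y < e"
          using e by (intro exI[of _ M]) (fastforce simp: dist_ell2_def)
      qed
    qed
  qed
qed

end

section \<open>Bounded operators and concrete C*-algebras\<close>

text \<open>The library type of bounded operators only asks for real linearity.\<close>

definition BH :: "('h::chilbert_space \<Rightarrow>\<^sub>L 'h) set" where
  "BH = {T :: 'h \<Rightarrow>\<^sub>L 'h. \<forall>c x. T (c *\<^sub>C x) = c *\<^sub>C T x}"

definition adj :: "('h::chilbert_space \<Rightarrow>\<^sub>L 'h) \<Rightarrow> 'h \<Rightarrow>\<^sub>L 'h" where
  "adj T = (THE S :: 'h \<Rightarrow>\<^sub>L 'h. \<forall>x y. cinner (T x) y = cinner x (S y))"

definition cstar_algebra :: "('h::chilbert_space \<Rightarrow>\<^sub>L 'h) set \<Rightarrow> bool" where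
  "cstar_algebra A \<longleftrightarrow> A \<subseteq> BH \<and> 0 \<in> A \<and>
     (\<forall>a\<in>A. \<forall>b\<in>A. a + b \<in> A \<and> a o\<^sub>L b \<in> A) \<and>
     (\<forall>c. \<forall>a\<in>A. c *\<^sub>C a \<in> A) \<and> (\<forall>a\<in>A. adj a \<in> A) \<and> closed A"

definition nondegenerate :: "('h::chilbert_space \<Rightarrow>\<^sub>L 'h) set \<Rightarrow> bool" where
  "nondegenerate A \<longleftrightarrow> closure (cspan {blinfun_apply a x | a x. a \<in> A}) = UNIV"

definition clinear_on ::
  "'a::complex_normed_vector set \<Rightarrow> ('a \<Rightarrow> 'b::complex_normed_vector) \<Rightarrow> bool" where
  "clinear_on V \<phi> \<longleftrightarrow>
     (\<forall>a\<in>V. \<forall>b\<in>V. \<phi> (a + b) = \<phi> a + \<phi> b) \<and> (\<forall>c. \<forall>a\<in>V. \<phi> (c *\<^sub>C a) = c *\<^sub>C \<phi> a)"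

definition is_automorphism ::
  "('h::chilbert_space \<Rightarrow>\<^sub>L 'h) set \<Rightarrow> (('h \<Rightarrow>\<^sub>L 'h) \<Rightarrow> 'h \<Rightarrow>\<^sub>L 'h) \<Rightarrow> bool" where
  "is_automorphism A \<theta> \<longleftrightarrow> bij_betw \<theta> A A \<and> clinear_on A \<theta> \<and>
     (\<forall>a\<in>A. \<forall>b\<in>A. \<theta> (a o\<^sub>L b) = \<theta> a o\<^sub>L \<theta> b) \<and> (\<forall>a\<in>A. \<theta> (adj a) = adj (\<theta> a))"

text \<open>
  Groups are written additively, as the type class \<^class>\<open>group_add\<close> (which is not assumed
  commutative) provides them: \<open>s + t\<close>, \<open>- s\<close> and \<open>0\<close> stand for \<open>s t\<close>, the inverse of \<open>s\<close> and
  the unit, and \<open>s - t = s + - t\<close> for the product of \<open>s\<close> with the inverse of \<open>t\<close>.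
\<close>

definition group_action ::
  "('h::chilbert_space \<Rightarrow>\<^sub>L 'h) set \<Rightarrow> ('g::group_add \<Rightarrow> ('h \<Rightarrow>\<^sub>L 'h) \<Rightarrow> 'h \<Rightarrow>\<^sub>L 'h) \<Rightarrow> bool" where
  "group_action A \<alpha> \<longleftrightarrow> (\<forall>s. is_automorphism A (\<alpha> s)) \<and>
     (\<forall>s t. \<forall>a\<in>A. \<alpha> (s + t) a = \<alpha> s (\<alpha> t a))"

section \<open>Completely bounded and completely positive maps\<close>

text \<open>
  An \<open>n \<times> n\<close> matrix over \<open>B(H)\<close> is a function of two indices below \<open>n\<close>; \<open>mat_norm n T\<close> is
  its norm as an operator on the \<open>n\<close>-fold direct sum of \<open>H\<close>, and \<open>mat_positive n T\<close> its
  positivity as such. For a matrix over a C*-algebra on \<open>H\<close> this is positivity in the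
  C*-algebra of matrices.
\<close>

definition mats :: "nat \<Rightarrow> 'a set \<Rightarrow> (nat \<Rightarrow> nat \<Rightarrow> 'a) set" where
  "mats n V = {T. \<forall>i<n. \<forall>j<n. T i j \<in> V}"

definition mat_norm :: "nat \<Rightarrow> (nat \<Rightarrow> nat \<Rightarrow> 'h::chilbert_space \<Rightarrow>\<^sub>L 'h) \<Rightarrow> real" where
  "mat_norm n T = Sup {sqrt (\<Sum>i<n. (norm (\<Sum>j<n. T i j (\<xi> j)))\<^sup>2) | \<xi> :: nat \<Rightarrow> 'h.
     (\<Sum>j<n. (norm (\<xi> j))\<^sup>2) \<le> 1}"

definition mat_positive :: "nat \<Rightarrow> (nat \<Rightarrow> nat \<Rightarrow> 'h::chilbert_space \<Rightarrow>\<^sub>L 'h) \<Rightarrow> bool" where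
  "mat_positive n T \<longleftrightarrow>
     (\<forall>\<xi> :: nat \<Rightarrow> 'h. (\<Sum>i<n. \<Sum>j<n. cinner (T i j (\<xi> j)) (\<xi> i)) \<in> \<real>\<^sub>\<ge>\<^sub>0)"

definition completely_bounded ::
  "('h::chilbert_space \<Rightarrow>\<^sub>L 'h) set \<Rightarrow> (('h \<Rightarrow>\<^sub>L 'h) \<Rightarrow> 'k::chilbert_space \<Rightarrow>\<^sub>L 'k) \<Rightarrow> bool" where
  "completely_bounded V \<phi> \<longleftrightarrow>
     (\<exists>C. \<forall>n. \<forall>T\<in>mats n V. mat_norm n (\<lambda>i j. \<phi> (T i j)) \<le> C * mat_norm n T)"

definition cb_norm ::
  "('h::chilbert_space \<Rightarrow>\<^sub>L 'h) set \<Rightarrow> (('h \<Rightarrow>\<^sub>L 'h) \<Rightarrow> 'k::chilbert_space \<Rightarrow>\<^sub>L 'k) \<Rightarrow> real" where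
  "cb_norm V \<phi> = Sup {mat_norm n (\<lambda>i j. \<phi> (T i j)) | n T. T \<in> mats n V \<and> mat_norm n T \<le> 1}"

text \<open>
  \<open>CB V W\<close> consists of the completely bounded linear maps from \<open>V\<close> to \<open>W\<close>. Only the values
  on \<open>V\<close> are relevant.
\<close>

definition CB ::
  "('h::chilbert_space \<Rightarrow>\<^sub>L 'h) set \<Rightarrow> ('k::chilbert_space \<Rightarrow>\<^sub>L 'k) set
    \<Rightarrow> (('h \<Rightarrow>\<^sub>L 'h) \<Rightarrow> 'k \<Rightarrow>\<^sub>L 'k) set" where
  "CB V W = {\<phi>. clinear_on V \<phi> \<and> \<phi> ` V \<subseteq> W \<and> completely_bounded V \<phi>}"

definition completely_positive ::
  "('h::chilbert_space \<Rightarrow>\<^sub>L 'h) set \<Rightarrow> (('h \<Rightarrow>\<^sub>L 'h) \<Rightarrow> 'k::chilbert_space \<Rightarrow>\<^sub>L 'k) \<Rightarrow> bool" where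
  "completely_positive V \<phi> \<longleftrightarrow> clinear_on V \<phi> \<and>
     (\<forall>n. \<forall>T\<in>mats n V. mat_positive n T \<longrightarrow> mat_positive n (\<lambda>i j. \<phi> (T i j)))"

definition bounded_CB_family ::
  "('h::chilbert_space \<Rightarrow>\<^sub>L 'h) set \<Rightarrow> ('k::chilbert_space \<Rightarrow>\<^sub>L 'k) set
    \<Rightarrow> ('i \<Rightarrow> ('h \<Rightarrow>\<^sub>L 'h) \<Rightarrow> 'k \<Rightarrow>\<^sub>L 'k) \<Rightarrow> bool" where
  "bounded_CB_family V W F \<longleftrightarrow> range F \<subseteq> CB V W \<and> bdd_above (range (\<lambda>t. cb_norm V (F t)))"

text \<open>
  The completely bounded extension of a map from a dense subspace \<open>D\<close> of \<open>V\<close> to all of \<open>V\<close>.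
  It is unique on \<open>V\<close>; the choice only concerns arguments outside \<open>V\<close>.
\<close>

definition cb_extension ::
  "('h::chilbert_space \<Rightarrow>\<^sub>L 'h) set \<Rightarrow> ('h \<Rightarrow>\<^sub>L 'h) set \<Rightarrow> ('k::chilbert_space \<Rightarrow>\<^sub>L 'k) set
    \<Rightarrow> (('h \<Rightarrow>\<^sub>L 'h) \<Rightarrow> 'k \<Rightarrow>\<^sub>L 'k) \<Rightarrow> ('h \<Rightarrow>\<^sub>L 'h) \<Rightarrow> 'k \<Rightarrow>\<^sub>L 'k" where
  "cb_extension D V W \<phi> = (SOME \<psi>. \<psi> \<in> CB V W \<and> (\<forall>T\<in>D. \<psi> T = \<phi> T))"

section \<open>Reduced crossed products and Herz-Schur multipliers\<close>

text \<open>
  \<open>Blinfun\<close> and \<open>Abs_ell2\<close> are meaningful only on bounded operators and on square summable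
  families. For \<open>pi_op\<close> this relies on automorphisms of C*-algebras being isometric, and for
  \<open>kernel_op\<close> below on the Cauchy-Schwarz inequality. The sum in \<open>pi_tilde\<close> converges
  absolutely in the operator norm.
\<close>

definition shift_op :: "'g::group_add \<Rightarrow> ('g, 'h::chilbert_space) ell2 \<Rightarrow>\<^sub>L ('g, 'h) ell2" where
  "shift_op t = Blinfun (\<lambda>\<xi>. Abs_ell2 (\<lambda>s. Rep_ell2 \<xi> (- t + s)))"

definition pi_op ::
  "('g::group_add \<Rightarrow> ('h::chilbert_space \<Rightarrow>\<^sub>L 'h) \<Rightarrow> 'h \<Rightarrow>\<^sub>L 'h)
    \<Rightarrow> ('h \<Rightarrow>\<^sub>L 'h) \<Rightarrow> ('g, 'h) ell2 \<Rightarrow>\<^sub>L ('g, 'h) ell2" where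
  "pi_op \<alpha> a = Blinfun (\<lambda>\<xi>. Abs_ell2 (\<lambda>s. \<alpha> (- s) a (Rep_ell2 \<xi> s)))"

definition ell1 :: "('h::chilbert_space \<Rightarrow>\<^sub>L 'h) set \<Rightarrow> ('g \<Rightarrow> 'h \<Rightarrow>\<^sub>L 'h) set" where
  "ell1 A = {f. range f \<subseteq> A \<and> (\<lambda>s. norm (f s)) summable_on UNIV}"

definition pi_tilde ::
  "('g::group_add \<Rightarrow> ('h::chilbert_space \<Rightarrow>\<^sub>L 'h) \<Rightarrow> 'h \<Rightarrow>\<^sub>L 'h)
    \<Rightarrow> ('g \<Rightarrow> 'h \<Rightarrow>\<^sub>L 'h) \<Rightarrow> ('g, 'h) ell2 \<Rightarrow>\<^sub>L ('g, 'h) ell2" where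
  "pi_tilde \<alpha> f = (\<Sum>\<^sub>\<infinity>s. pi_op \<alpha> (f s) o\<^sub>L shift_op s)"

definition crossed_product ::
  "('h::chilbert_space \<Rightarrow>\<^sub>L 'h) set \<Rightarrow> ('g::group_add \<Rightarrow> ('h \<Rightarrow>\<^sub>L 'h) \<Rightarrow> 'h \<Rightarrow>\<^sub>L 'h)
    \<Rightarrow> (('g, 'h) ell2 \<Rightarrow>\<^sub>L ('g, 'h) ell2) set" where
  "crossed_product A \<alpha> = closure (pi_tilde \<alpha> ` ell1 A)"

text \<open>\<open>hs_map0\<close> is the map \<open>S_F\<close> on the image of \<open>ell1 A\<close>; \<open>pi_tilde \<alpha>\<close> is injective there.\<close>

definition hs_map0 ::
  "('h::chilbert_space \<Rightarrow>\<^sub>L 'h) set \<Rightarrow> ('g::group_add \<Rightarrow> ('h \<Rightarrow>\<^sub>L 'h) \<Rightarrow> 'h \<Rightarrow>\<^sub>L 'h)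
    \<Rightarrow> ('g \<Rightarrow> ('h \<Rightarrow>\<^sub>L 'h) \<Rightarrow> 'h \<Rightarrow>\<^sub>L 'h)
    \<Rightarrow> (('g, 'h) ell2 \<Rightarrow>\<^sub>L ('g, 'h) ell2) \<Rightarrow> ('g, 'h) ell2 \<Rightarrow>\<^sub>L ('g, 'h) ell2" where
  "hs_map0 A \<alpha> F T =
     (let f = (THE f. f \<in> ell1 A \<and> pi_tilde \<alpha> f = T) in pi_tilde \<alpha> (\<lambda>t. F t (f t)))"

definition herz_schur_multiplier ::
  "('h::chilbert_space \<Rightarrow>\<^sub>L 'h) set \<Rightarrow> ('g::group_add \<Rightarrow> ('h \<Rightarrow>\<^sub>L 'h) \<Rightarrow> 'h \<Rightarrow>\<^sub>L 'h)
    \<Rightarrow> ('g \<Rightarrow> ('h \<Rightarrow>\<^sub>L 'h) \<Rightarrow> 'h \<Rightarrow>\<^sub>L 'h) \<Rightarrow> bool" where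
  "herz_schur_multiplier A \<alpha> F \<longleftrightarrow> bounded_CB_family A A F \<and>
     hs_map0 A \<alpha> F \<in> CB (pi_tilde \<alpha> ` ell1 A) (crossed_product A \<alpha>)"

definition hs_map ::
  "('h::chilbert_space \<Rightarrow>\<^sub>L 'h) set \<Rightarrow> ('g::group_add \<Rightarrow> ('h \<Rightarrow>\<^sub>L 'h) \<Rightarrow> 'h \<Rightarrow>\<^sub>L 'h)
    \<Rightarrow> ('g \<Rightarrow> ('h \<Rightarrow>\<^sub>L 'h) \<Rightarrow> 'h \<Rightarrow>\<^sub>L 'h)
    \<Rightarrow> (('g, 'h) ell2 \<Rightarrow>\<^sub>L ('g, 'h) ell2) \<Rightarrow> ('g, 'h) ell2 \<Rightarrow>\<^sub>L ('g, 'h) ell2" where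
  "hs_map A \<alpha> F = cb_extension (pi_tilde \<alpha> ` ell1 A) (crossed_product A \<alpha>) (crossed_product A \<alpha>)
     (hs_map0 A \<alpha> F)"

definition cp_herz_schur_multiplier ::
  "('h::chilbert_space \<Rightarrow>\<^sub>L 'h) set \<Rightarrow> ('g::group_add \<Rightarrow> ('h \<Rightarrow>\<^sub>L 'h) \<Rightarrow> 'h \<Rightarrow>\<^sub>L 'h)
    \<Rightarrow> ('g \<Rightarrow> ('h \<Rightarrow>\<^sub>L 'h) \<Rightarrow> 'h \<Rightarrow>\<^sub>L 'h) \<Rightarrow> bool" where
  "cp_herz_schur_multiplier A \<alpha> F \<longleftrightarrow> herz_schur_multiplier A \<alpha> F \<and>
     completely_positive (crossed_product A \<alpha>) (hs_map A \<alpha> F)"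

definition N_map ::
  "('g::group_add \<Rightarrow> ('h::chilbert_space \<Rightarrow>\<^sub>L 'h) \<Rightarrow> 'h \<Rightarrow>\<^sub>L 'h)
    \<Rightarrow> ('g \<Rightarrow> ('h \<Rightarrow>\<^sub>L 'h) \<Rightarrow> 'h \<Rightarrow>\<^sub>L 'h) \<Rightarrow> 'g \<Rightarrow> 'g \<Rightarrow> ('h \<Rightarrow>\<^sub>L 'h) \<Rightarrow> 'h \<Rightarrow>\<^sub>L 'h" where
  "N_map \<alpha> F s t a = \<alpha> (- s) (F (s - t) (\<alpha> s a))"

section \<open>Schur multipliers\<close>

lift_definition tensor_vec ::
  "('x, complex) ell2 \<Rightarrow> 'h::chilbert_space \<Rightarrow> ('x, 'h) ell2" is "\<lambda>(\<xi> :: 'x \<Rightarrow> complex) \<eta> x. \<xi> x *\<^sub>C \<eta>"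
  by (simp add: norm_scaleC power_mult_distrib summable_on_cmult_left)

definition compact_ops :: "('h::chilbert_space \<Rightarrow>\<^sub>L 'h) set" where
  "compact_ops = {T \<in> BH. compact (closure (blinfun_apply T ` cball 0 1))}"

text \<open>
  The minimal tensor product of the compact operators on \<open>\<ell>\<^sup>2(X)\<close> with a C*-algebra \<open>B\<close>
  acting on \<open>H\<close>, realised on \<open>\<ell>\<^sup>2(X, H)\<close>: the closed linear span of the operators
  \<open>k \<otimes> b\<close>.
\<close>

definition compact_tensor ::
  "('h::chilbert_space \<Rightarrow>\<^sub>L 'h) set \<Rightarrow> (('x, 'h) ell2 \<Rightarrow>\<^sub>L ('x, 'h) ell2) set" where
  "compact_tensor B = closure (cspan {T \<in> BH. \<exists>k \<in> compact_ops. \<exists>b \<in> B.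
     \<forall>\<xi> \<eta>. blinfun_apply T (tensor_vec \<xi> \<eta>) = tensor_vec (blinfun_apply k \<xi>) (blinfun_apply b \<eta>)})"

definition ell2_kernels :: "('h::chilbert_space \<Rightarrow>\<^sub>L 'h) set \<Rightarrow> ('x \<Rightarrow> 'x \<Rightarrow> 'h \<Rightarrow>\<^sub>L 'h) set" where
  "ell2_kernels A = {k. (\<forall>x y. k x y \<in> A) \<and> (\<lambda>(x, y). (norm (k x y))\<^sup>2) summable_on UNIV}"

definition kernel_op ::
  "('x \<Rightarrow> 'x \<Rightarrow> 'h::chilbert_space \<Rightarrow>\<^sub>L 'h) \<Rightarrow> ('x, 'h) ell2 \<Rightarrow>\<^sub>L ('x, 'h) ell2" where
  "kernel_op k = Blinfun (\<lambda>\<xi>. Abs_ell2 (\<lambda>x. \<Sum>\<^sub>\<infinity>y. k x y (Rep_ell2 \<xi> y)))"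

text \<open>
  \<open>schur_map0\<close> is \<open>S_\<phi>\<close> on the operators with kernel in \<open>ell2_kernels A\<close>; such an operator
  determines its kernel.
\<close>

definition schur_map0 ::
  "('h::chilbert_space \<Rightarrow>\<^sub>L 'h) set \<Rightarrow> ('x \<Rightarrow> 'x \<Rightarrow> ('h \<Rightarrow>\<^sub>L 'h) \<Rightarrow> 'h \<Rightarrow>\<^sub>L 'h)
    \<Rightarrow> (('x, 'h) ell2 \<Rightarrow>\<^sub>L ('x, 'h) ell2) \<Rightarrow> ('x, 'h) ell2 \<Rightarrow>\<^sub>L ('x, 'h) ell2" where
  "schur_map0 A \<phi> T =
     (let k = (THE k. k \<in> ell2_kernels A \<and> kernel_op k = T) in kernel_op (\<lambda>x y. \<phi> x y (k x y)))"

definition schur_multiplier ::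
  "('h::chilbert_space \<Rightarrow>\<^sub>L 'h) set \<Rightarrow> ('x \<Rightarrow> 'x \<Rightarrow> ('h \<Rightarrow>\<^sub>L 'h) \<Rightarrow> 'h \<Rightarrow>\<^sub>L 'h) \<Rightarrow> bool" where
  "schur_multiplier A \<phi> \<longleftrightarrow> bounded_CB_family A BH (case_prod \<phi>) \<and>
     schur_map0 A \<phi> \<in> CB (kernel_op ` ell2_kernels A) (compact_tensor BH)"

definition schur_map ::
  "('h::chilbert_space \<Rightarrow>\<^sub>L 'h) set \<Rightarrow> ('x \<Rightarrow> 'x \<Rightarrow> ('h \<Rightarrow>\<^sub>L 'h) \<Rightarrow> 'h \<Rightarrow>\<^sub>L 'h)
    \<Rightarrow> (('x, 'h) ell2 \<Rightarrow>\<^sub>L ('x, 'h) ell2) \<Rightarrow> ('x, 'h) ell2 \<Rightarrow>\<^sub>L ('x, 'h) ell2" where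
  "schur_map A \<phi> =
     cb_extension (kernel_op ` ell2_kernels A) (compact_tensor A) (compact_tensor BH) (schur_map0 A \<phi>)"

definition positive_type ::
  "('h::chilbert_space \<Rightarrow>\<^sub>L 'h) set \<Rightarrow> ('x \<Rightarrow> 'x \<Rightarrow> ('h \<Rightarrow>\<^sub>L 'h) \<Rightarrow> 'h \<Rightarrow>\<^sub>L 'h) \<Rightarrow> bool" where
  "positive_type A \<phi> \<longleftrightarrow> bounded_CB_family A BH (case_prod \<phi>) \<and>
     (\<forall>m. \<forall>x :: nat \<Rightarrow> 'x. \<forall>a\<in>mats m A. mat_positive m a \<longrightarrow>
        mat_positive m (\<lambda>p q. \<phi> (x p) (x q) (a p q)))"

end

theory Submission
  imports Defs
begin

text \<open>
  Both \<open>S_F\<close> and the Schur map of \<open>\<phi> = N_map \<alpha> F\<close> act on operators on \<open>\<ell>\<^sup>2(G, H)\<close> through their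
  matrix entries: the entry of \<open>pi_tilde \<alpha> f\<close> at \<open>(s, t)\<close> is \<open>\<alpha>\<^bsub>-s\<^esub>(f(s - t))\<close>, and multiplying \<open>f\<close>
  by \<open>F\<close> turns it into its image under \<open>\<phi> s t\<close>. By continuity this persists for the extensions to
  the crossed product and to \<open>K(\<ell>\<^sup>2(G)) \<otimes> A\<close>. All implications are therefore about one
  property, \<open>acts_entrywise A \<phi> V \<psi>\<close>, of a map \<open>\<psi>\<close> on a space \<open>V\<close> of operators with entries in
  \<open>A\<close>.

  Let \<open>\<phi>\<close> be of positive type. A matrix of operators is positive if and only if its finite
  submatrices over \<open>B(H)\<close> are, and to these the definition of positive type applies; so \<open>\<psi>\<close> is
  completely positive (\<open>acts_entrywise_positive\<close>). For the norm, let \<open>a\<close> be a finite matrix over \<open>A\<close>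
  of norm at most one and \<open>e \<in> A\<close> a hermitian contraction. The matrix with rows \<open>(e\<^sup>2, eae)\<close> and
  \<open>(ea\<^sup>*e, e\<^sup>2)\<close>, where \<open>e\<close> also stands for the diagonal matrix with entries \<open>e\<close>, is positive,
  hence so is its image under \<open>\<phi>\<close>, and the image of \<open>eae\<close> is bounded by the norms of the
  \<open>\<phi> x x (e\<^sup>2)\<close>. With \<open>e\<close> running through an approximate unit this bounds the image of \<open>a\<close>
  (\<open>schur_finite_norm\<close>). On the diagonal \<open>\<phi> s s = \<alpha>\<^bsub>-s\<^esub> \<circ> F 0 \<circ> \<alpha>\<^bsub>s\<^esub>\<close>, so the completely bounded norm
  of \<open>\<psi>\<close> is at most that of \<open>F 0\<close>. In particular both maps are completely bounded.

  Conversely, let \<open>\<psi>\<close> be completely positive, and let \<open>a\<close> be a positive matrix over \<open>A\<close> and \<open>x\<^sub>p\<close>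
  points of \<open>G\<close>. It suffices to find a positive matrix of operators \<open>T\<^sub>p\<^sub>q \<in> V\<close> whose entry at
  \<open>(x\<^sub>p, x\<^sub>q)\<close> is \<open>a\<^sub>p\<^sub>q\<close> (\<open>positive_typeI_entrywise\<close>). In \<open>K(\<ell>\<^sup>2(G)) \<otimes> A\<close> one takes the operators
  with that single nonzero entry, in the crossed product \<open>\<lambda>\<^bsub>x p\<^esub> \<pi>(a\<^sub>p\<^sub>q) \<lambda>\<^bsub>-x q\<^esub>\<close>, where \<open>\<lambda>\<close> and \<open>\<pi>\<close> are
  \<open>shift_op\<close> and \<open>pi_op \<alpha>\<close>; these form a positive matrix because \<open>\<pi>\<close> is a homomorphism. The same operators with \<open>x\<^sub>p = 0\<close> do not increase norms
  and so show that the completely bounded norm of \<open>F 0\<close> is at most that of \<open>\<psi>\<close>.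

  The facts on C*-algebras that enter are obtained from polynomials without constant term, which
  stay in an algebra without unit, instead of from a functional calculus: approximate units are
  built from \<open>1 - (1 - h)\<^sup>n\<close>, homomorphisms are contractive because \<open>1 - a\<^sup>2\<close> has a square root
  \<open>1 - b\<close>, and positive because the powers of \<open>1 - \<theta>(a)\<close> remain bounded. Since the matrices over a
  C*-algebra again form one, both hold completely. Finally, \<open>K(\<ell>\<^sup>2(X)) \<otimes> A\<close> is the closure of the
  operators with square summable kernel because compact operators are approximated by finite
  matrices and \<open>\<parallel>k \<otimes> b\<parallel> \<le> \<parallel>k\<parallel> \<parallel>b\<parallel>\<close>.
\<close>

instance chilbert_space \<subseteq> banach ..

section \<open>Inner products and adjoints\<close>

lemma scaleC_zero_left [simp]: "0 *\<^sub>C (x::'a::complex_normed_vector) = 0"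
  using scaleR_scaleC[of 0 x] by simp

lemma scaleC_zero_right [simp]: "c *\<^sub>C (0::'a::complex_normed_vector) = 0"
  using norm_scaleC[of c 0] by simp

lemma scaleC_minus1_left: "(-1) *\<^sub>C (x::'a::complex_normed_vector) = - x"
  using scaleR_scaleC[of "-1" x] by simp

lemma scaleC_sum_right: "c *\<^sub>C sum f I = (\<Sum>i\<in>I. c *\<^sub>C (f i :: 'a::complex_normed_vector))"
  by (induction I rule: infinite_finite_induct) (simp_all add: scaleC_add_right)

lemma cinner_zero_left [simp]: "cinner 0 (y::'a::chilbert_space) = 0"
  using cinner_scaleC_left[of 0 0 y] by simp

lemma cinner_zero_right [simp]: "cinner (y::'a::chilbert_space) 0 = 0"
  using cinner_commute[of y 0] by simp

lemma cinner_scaleC_right: "cinner x (c *\<^sub>C y) = cnj c * cinner x (y::'a::chilbert_space)"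
  using cinner_commute[of x "c *\<^sub>C y"] cinner_commute[of x y] cinner_scaleC_left[of c y x] by simp

lemma cinner_minus_left: "cinner (- x) (y::'a::chilbert_space) = - cinner x y"
  using cinner_scaleC_left[of "-1" x y] by (simp add: scaleC_minus1_left)

lemma cinner_minus_right: "cinner x (- (y::'a::chilbert_space)) = - cinner x y"
  using cinner_scaleC_right[of x "-1" y] by (simp add: scaleC_minus1_left)

lemma cinner_diff_left: "cinner (x - z) (y::'a::chilbert_space) = cinner x y - cinner z y"
  using cinner_add_left[of x "- z" y] by (simp add: cinner_minus_left)

lemma cinner_diff_right: "cinner y (x - (z::'a::chilbert_space)) = cinner y x - cinner y z"
  using cinner_add_right[of y x "- z"] by (simp add: cinner_minus_right)

lemma cinner_scaleR_left: "cinner (r *\<^sub>R x) (y::'a::chilbert_space) = r * cinner x y"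
  by (simp add: scaleR_scaleC cinner_scaleC_left)

lemma cinner_scaleR_right: "cinner x (r *\<^sub>R (y::'a::chilbert_space)) = r * cinner x y"
  by (simp add: scaleR_scaleC cinner_scaleC_right)

lemma cinner_sum_left: "cinner (sum f I) (y::'a::chilbert_space) = (\<Sum>i\<in>I. cinner (f i) y)"
  by (induction I rule: infinite_finite_induct) (simp_all add: cinner_add_left)

lemma cinner_sum_right: "cinner (y::'a::chilbert_space) (sum f I) = (\<Sum>i\<in>I. cinner y (f i))"
  by (induction I rule: infinite_finite_induct) (simp_all add: cinner_add_right)

lemmas cinner_algebra = cinner_add_left cinner_add_right cinner_diff_left cinner_diff_right
  cinner_minus_left cinner_minus_right cinner_scaleC_left cinner_scaleC_right

lemma Re_cinner_self: "Re (cinner x x) = (norm (x::'a::chilbert_space))\<^sup>2"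
  by (simp only: cinner_norm Re_complex_of_real)

lemma Re_cinner_commute: "Re (cinner x y) = Re (cinner y (x::'h::chilbert_space))"
  using cinner_commute[of x y] by simp

lemma norm_add_sq: "(norm (x + y))\<^sup>2 = (norm x)\<^sup>2 + 2 * Re (cinner x y) + (norm (y::'a::chilbert_space))\<^sup>2"
proof -
  have "cinner (x + y) (x + y) = cinner x x + cinner x y + cnj (cinner x y) + cinner y y"
    by (simp add: cinner_add_left cinner_add_right cinner_commute[of y x])
  then have "Re (cinner (x + y) (x + y)) = Re (cinner x x) + 2 * Re (cinner x y) + Re (cinner y y)"
    by simp
  then show ?thesis by (simp only: Re_cinner_self)
qed

lemma norm_diff_sq: "(norm (x - y))\<^sup>2 = (norm x)\<^sup>2 - 2 * Re (cinner x y) + (norm (y::'a::chilbert_space))\<^sup>2"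
  using norm_add_sq[of x "- y"] by (simp add: cinner_minus_right)

lemma exists_phase: "\<exists>c. cmod c = 1 \<and> c * z = complex_of_real (cmod z)"
proof (cases "z = 0")
  case True then show ?thesis by (intro exI[of _ 1]) simp
next
  case False
  have "cnj z / cmod z * z = complex_of_real (cmod z)"
    using False complex_norm_square[of z] by (simp add: field_simps power2_eq_square)
  then show ?thesis using False by (intro exI[of _ "cnj z / cmod z"]) (simp add: norm_divide)
qed

lemma Re_cinner_le: "Re (cinner x y) \<le> norm x * norm (y::'a::chilbert_space)"
proof -
  have "(norm (x + y))\<^sup>2 \<le> (norm x + norm y)\<^sup>2"
    by (rule power_mono[OF norm_triangle_ineq]) simp
  then show ?thesis by (simp add: norm_add_sq power2_sum)
qed

lemma cinner_Cauchy_Schwarz: "cmod (cinner x y) \<le> norm x * norm (y::'a::chilbert_space)"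
proof -
  obtain c where c: "cmod c = 1" "c * cinner x y = complex_of_real (cmod (cinner x y))"
    using exists_phase by blast
  have "cmod (cinner x y) = Re (cinner (c *\<^sub>C x) y)" by (simp add: cinner_scaleC_left c(2))
  also have "\<dots> \<le> norm x * norm y" using Re_cinner_le[of "c *\<^sub>C x" y] c(1) by (simp add: norm_scaleC)
  finally show ?thesis .
qed

lemma cinner_eqI:
  assumes "\<And>y. cinner x y = cinner x' (y::'a::chilbert_space)" shows "x = x'"
proof -
  have "cinner (x - x') (x - x') = 0" using assms[of "x - x'"] by (simp add: cinner_diff_left)
  then show ?thesis using Re_cinner_self[of "x - x'"] by simp
qed

lemma cinner_eqI_right:
  assumes "\<And>x. cinner x y = cinner x (y'::'a::chilbert_space)" shows "y = y'"
  by (rule cinner_eqI) (metis assms cinner_commute)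

lemma norm_le_cinnerI:
  assumes "0 \<le> C" "\<And>y. cmod (cinner x y) \<le> C * norm (y::'a::chilbert_space)" shows "norm x \<le> C"
proof (cases "x = 0")
  case False
  have "norm x * norm x \<le> C * norm x"
    using assms(2)[of x] abs_Re_le_cmod[of "cinner x x"] by (simp add: Re_cinner_self power2_eq_square)
  then show ?thesis using False by simp
qed (use assms in simp)

lemma bounded_bilinear_cinner: "bounded_bilinear (cinner :: 'a::chilbert_space \<Rightarrow> 'a \<Rightarrow> complex)"
proof
  show "\<exists>K. \<forall>a b::'a. norm (cinner a b) \<le> norm a * norm b * K"
    by (rule exI[of _ 1]) (simp add: cinner_Cauchy_Schwarz)
qed (simp_all add: cinner_add_left cinner_add_right cinner_scaleR_left cinner_scaleR_right scaleR_conv_of_real)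

lemmas tendsto_cinner = bounded_bilinear.tendsto[OF bounded_bilinear_cinner]
lemmas bounded_linear_cinner_left = bounded_bilinear.bounded_linear_left[OF bounded_bilinear_cinner]

lemma parallelogram_law:
  "(norm (x + y))\<^sup>2 + (norm (x - y))\<^sup>2 = 2 * (norm x)\<^sup>2 + 2 * (norm (y::'a::chilbert_space))\<^sup>2"
  by (simp add: norm_add_sq norm_diff_sq)

text \<open>
  A norming sequence of unit vectors for the functional is a Cauchy sequence by the
  parallelogram law; the functional is a multiple of the inner product with its limit.
\<close>

lemma Riesz_representation:
  fixes f :: "'a::chilbert_space \<Rightarrow> complex"
  assumes bl: "bounded_linear f" and cl: "\<And>c x. f (c *\<^sub>C x) = c * f x"
  shows "\<exists>w. \<forall>x. f x = cinner x w"
proof (cases "\<forall>x. f x = 0")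
  case True
  then show ?thesis by (intro exI[of _ 0]) simp
next
  case False
  define M where "M = onorm f"
  have f_le: "cmod (f x) \<le> M * norm x" for x unfolding M_def by (rule onorm[OF bl])
  obtain x0 where x0: "f x0 \<noteq> 0" using False by blast
  have "0 < M * norm x0" using f_le[of x0] x0 by (simp add: less_le_trans[OF _ f_le])
  then have Mpos: "0 < M" by (simp add: zero_less_mult_iff)
  have fadd: "f (x + y) = f x + f y" for x y by (rule linear_add[OF bounded_linear.linear[OF bl]])
  have fscale: "f (r *\<^sub>R x) = r * f x" for r x by (simp add: scaleR_scaleC cl)
  have "\<exists>u. norm u = 1 \<and> f u = complex_of_real (cmod (f u)) \<and> M - 1 / Suc n < cmod (f u)" for n
  proof (rule ccontr)
    assume neg: "\<not> ?thesis"
    define B where "B = max 0 (M - 1 / Suc n)"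
    have "cmod (f x) \<le> B * norm x" for x
    proof (cases "x = 0")
      case True then show ?thesis using f_le[of x] by simp
    next
      case nz: False
      obtain c where c: "cmod c = 1" "c * f x = complex_of_real (cmod (f x))" using exists_phase by blast
      define u where "u = (1 / norm x) *\<^sub>R c *\<^sub>C x"
      have "norm u = 1" using nz c(1) by (simp add: u_def norm_scaleC)
      moreover have fu: "f u = complex_of_real (cmod (f x) / norm x)"
        by (simp add: u_def fscale cl c(2))
      ultimately have "cmod (f u) \<le> M - 1 / Suc n" using neg by (simp add: not_less) (metis fu abs_of_nonneg cmod_eq_Re complex.sel norm_of_real divide_nonneg_nonneg norm_ge_zero)
      then have "cmod (f x) / norm x \<le> B" unfolding B_def using fu nz by (simp add: norm_divide le_max_iff_disj)
      then show ?thesis using nz by (simp add: field_simps)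
    qed
    then have "M \<le> B" unfolding M_def by (rule onorm_bound[rotated]) (simp add: B_def)
    then show False using Mpos by (auto simp: B_def max_def split: if_splits)
  qed
  then obtain u where u1: "\<And>n. norm (u n) = 1" and ur: "\<And>n. f (u n) = complex_of_real (cmod (f (u n)))"
    and uM: "\<And>n. M - 1 / Suc n < cmod (f (u n))" by metis
  have dist: "(norm (u m - u n))\<^sup>2 \<le> 4 * (1 / Suc m + 1 / Suc n) / M" for m n
  proof -
    define d where "d = 1 / real (Suc m) + 1 / real (Suc n)"
    have "cmod (f (u m) + f (u n)) = cmod (f (u m)) + cmod (f (u n))"
      by (subst ur, subst (2) ur) (simp add: of_real_add[symmetric] del: of_real_add)
    then have "2 * M - d \<le> M * norm (u m + u n)"
      using uM[of m] uM[of n] f_le[of "u m + u n"] by (simp add: fadd d_def)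
    then have ge: "2 - d / M \<le> norm (u m + u n)" using Mpos by (simp add: field_simps)
    have "4 - 4 * (d / M) \<le> (norm (u m + u n))\<^sup>2"
    proof (cases "2 - d / M \<ge> 0")
      case True
      have "4 - 4 * (d / M) \<le> (2 - d / M)\<^sup>2" by (simp add: power2_diff)
      also have "\<dots> \<le> (norm (u m + u n))\<^sup>2" by (rule power_mono[OF ge True])
      finally show ?thesis .
    next
      case False
      then have "4 - 4 * (d / M) \<le> 0" by argo
      then show ?thesis by (meson order_trans zero_le_power2)
    qed
    then show ?thesis using parallelogram_law[of "u m" "u n"] by (simp add: u1 d_def)
  qed
  have "Cauchy u"
  proof (rule metric_CauchyI)
    fix e :: real assume e: "0 < e"
    obtain N where N: "1 / real (Suc N) < e\<^sup>2 * M / 8"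
      using reals_Archimedean[of "e\<^sup>2 * M / 8"] e Mpos by (auto simp: inverse_eq_divide)
    have "dist (u m) (u n) < e" if "N \<le> m" "N \<le> n" for m n
    proof -
      have "1 / real (Suc m) \<le> 1 / real (Suc N)" "1 / real (Suc n) \<le> 1 / real (Suc N)"
        using that by (simp_all add: frac_le)
      then have "4 * (1 / Suc m + 1 / Suc n) < e\<^sup>2 * M" using N by simp
      then have "4 * (1 / Suc m + 1 / Suc n) / M < e\<^sup>2" using pos_divide_less_eq[OF Mpos] by blast
      then have "(norm (u m - u n))\<^sup>2 < e\<^sup>2" using dist[of m n] by linarith
      then show ?thesis using e by (simp add: dist_norm power2_less_imp_less)
    qed
    then show "\<exists>N. \<forall>m\<ge>N. \<forall>n\<ge>N. dist (u m) (u n) < e" by blast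
  qed
  then obtain w where w: "u \<longlonglongrightarrow> w" using Cauchy_convergent convergent_def by blast
  have w1: "norm w = 1" using tendsto_norm[OF w] by (simp add: u1 LIMSEQ_const_iff)
  have lim: "(\<lambda>n. f (u n)) \<longlonglongrightarrow> f w" using bounded_linear.tendsto[OF bl w] .
  have "M - 0 \<le> cmod (f w)"
  proof (rule LIMSEQ_le)
    show "(\<lambda>n. M - 1 / real (Suc n)) \<longlonglongrightarrow> M - 0"
      by (intro tendsto_intros LIMSEQ_inverse_real_of_nat[unfolded inverse_eq_divide])
    show "(\<lambda>n. cmod (f (u n))) \<longlonglongrightarrow> cmod (f w)" by (intro tendsto_intros lim)
  qed (use uM less_imp_le in blast)
  moreover have "cmod (f w) \<le> M" using f_le[of w] w1 by simp
  moreover have "(\<lambda>n. complex_of_real (cmod (f (u n)))) \<longlonglongrightarrow> complex_of_real (cmod (f w))"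
    by (intro tendsto_intros lim)
  then have "f w = complex_of_real (cmod (f w))"
    using lim ur LIMSEQ_unique by (metis (no_types, lifting) ext)
  ultimately have fw: "f w = complex_of_real M" by simp
  \<comment> \<open>if \<open>z\<close> is orthogonal to \<open>w\<close>, then \<open>|f (w + t z)| \<le> M |w + t z|\<close> for all \<open>t\<close> forces \<open>f z = 0\<close>\<close>
  have orth: "f z = 0" if z: "cinner z w = 0" for z
  proof (rule ccontr)
    assume nz: "f z \<noteq> 0"
    obtain c where c: "cmod c = 1" "c * f z = complex_of_real (cmod (f z))" using exists_phase by blast
    have *: "(M + t * cmod (f z))\<^sup>2 \<le> M\<^sup>2 * (1 + t\<^sup>2 * (norm z)\<^sup>2)" if "0 < t" for t
    proof -
      have "f (w + (of_real t * c) *\<^sub>C z) = complex_of_real (M + t * cmod (f z))"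
        by (simp add: fadd cl fw c(2) mult.assoc)
      then have "M + t * cmod (f z) = cmod (f (w + (of_real t * c) *\<^sub>C z))"
        using Mpos \<open>0 < t\<close> by (simp only: norm_of_real) (simp add: abs_of_nonneg)
      also have "\<dots> \<le> M * norm (w + (of_real t * c) *\<^sub>C z)" by (rule f_le)
      finally have "(M + t * cmod (f z))\<^sup>2 \<le> (M * norm (w + (of_real t * c) *\<^sub>C z))\<^sup>2"
        using Mpos \<open>0 < t\<close> by (intro power_mono) auto
      moreover have "cinner w z = 0" using z cinner_commute[of w z] by simp
      then have "(norm (w + (of_real t * c) *\<^sub>C z))\<^sup>2 = 1 + t\<^sup>2 * (norm z)\<^sup>2"
        using w1 c(1) \<open>0 < t\<close>
        by (simp add: norm_add_sq cinner_scaleC_right norm_scaleC norm_mult power_mult_distrib)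
      ultimately show ?thesis by (simp add: power_mult_distrib)
    qed
    define t where "t = cmod (f z) / (M * ((norm z)\<^sup>2 + 1))"
    have tpos: "0 < t" using Mpos nz by (auto simp: t_def intro!: divide_pos_pos mult_pos_pos add_nonneg_pos)
    have "2 * M * t * cmod (f z) \<le> M\<^sup>2 * t\<^sup>2 * (norm z)\<^sup>2"
    proof -
      have "(M + t * cmod (f z))\<^sup>2 = M\<^sup>2 + 2 * M * t * cmod (f z) + t\<^sup>2 * (cmod (f z))\<^sup>2"
        by (simp add: power2_sum power_mult_distrib)
      moreover have "M\<^sup>2 * (1 + t\<^sup>2 * (norm z)\<^sup>2) = M\<^sup>2 + M\<^sup>2 * t\<^sup>2 * (norm z)\<^sup>2" by (simp add: algebra_simps)
      moreover have "0 \<le> t\<^sup>2 * (cmod (f z))\<^sup>2" by simp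
      ultimately show ?thesis using *[OF tpos] by linarith
    qed
    then have "2 * cmod (f z) \<le> M * t * (norm z)\<^sup>2"
      using Mpos tpos by (simp add: power2_eq_square mult.assoc)
    also have "\<dots> = cmod (f z) * ((norm z)\<^sup>2 / ((norm z)\<^sup>2 + 1))" using Mpos by (simp add: t_def)
    also have "\<dots> \<le> cmod (f z) * 1" by (rule mult_left_mono) (simp_all add: divide_le_eq_1_pos add_nonneg_pos)
    finally show False using nz by simp
  qed
  have ww: "cinner w w = 1" by (simp add: cinner_norm w1)
  show ?thesis
  proof (intro exI allI)
    fix x
    have "cinner (x + (- cinner x w) *\<^sub>C w) w = 0" by (simp add: cinner_add_left cinner_scaleC_left ww)
    then have "f (x + (- cinner x w) *\<^sub>C w) = 0" by (rule orth)
    then have "f x = cinner x w * f w" by (simp add: fadd cl)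
    then show "f x = cinner x (complex_of_real M *\<^sub>C w)" by (simp add: fw cinner_scaleC_right)
  qed
qed

lemma BH_scaleC: "T \<in> BH \<Longrightarrow> blinfun_apply T (c *\<^sub>C x) = c *\<^sub>C blinfun_apply T x"
  by (simp add: BH_def)

lemma adj_eqI:
  assumes "\<And>x y. cinner (blinfun_apply T x) y = cinner x (blinfun_apply S y)"
  shows "adj T = S"
  unfolding adj_def
proof (rule the_equality)
  fix S' assume *: "\<forall>x y. cinner (blinfun_apply T x) y = cinner x (blinfun_apply S' y)"
  show "S' = S"
    by (rule blinfun_eqI, rule cinner_eqI_right) (metis assms *)
qed (use assms in blast)

lemma cinner_adj_right:
  assumes T: "T \<in> BH"
  shows "cinner x (blinfun_apply (adj T) y) = cinner (blinfun_apply T x) y"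
proof -
  have "\<exists>w. \<forall>x. cinner (blinfun_apply T x) y = cinner x w" for y
    by (rule Riesz_representation)
      (auto intro!: bounded_linear_compose[OF bounded_linear_cinner_left] blinfun.bounded_linear_right
        simp: BH_scaleC[OF T] cinner_scaleC_left)
  then obtain S where S: "\<And>x y. cinner (blinfun_apply T x) y = cinner x (S y)" by metis
  have "bounded_linear S"
  proof (rule bounded_linear_intro)
    show "S (y + z) = S y + S z" for y z
      by (rule cinner_eqI_right) (simp add: S[symmetric] cinner_add_right)
    show "S (r *\<^sub>R y) = r *\<^sub>R S y" for r y
      by (rule cinner_eqI_right) (simp add: S[symmetric] cinner_scaleR_right)
    show "norm (S y) \<le> norm y * norm T" for y
    proof (rule norm_le_cinnerI)
      fix z
      have "cmod (cinner (S y) z) = cmod (cinner (blinfun_apply T z) y)"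
        unfolding S by (subst cinner_commute) simp
      also have "\<dots> \<le> norm (blinfun_apply T z) * norm y" by (rule cinner_Cauchy_Schwarz)
      also have "\<dots> \<le> (norm T * norm z) * norm y" by (intro mult_right_mono norm_blinfun) simp
      finally show "cmod (cinner (S y) z) \<le> norm y * norm T * norm z" by (simp add: mult_ac)
    qed simp
  qed
  then have "adj T = Blinfun S" by (intro adj_eqI) (simp add: bounded_linear_Blinfun_apply S)
  then show ?thesis using \<open>bounded_linear S\<close> by (simp add: bounded_linear_Blinfun_apply S)
qed

lemma cinner_adj_left: "T \<in> BH \<Longrightarrow> cinner (blinfun_apply (adj T) x) y = cinner x (blinfun_apply T y)"
  by (metis cinner_adj_right cinner_commute)

lemma adj_in_BH:
  assumes T: "T \<in> BH" shows "adj T \<in> BH"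
proof -
  have "blinfun_apply (adj T) (c *\<^sub>C x) = c *\<^sub>C blinfun_apply (adj T) x" for c x
    by (rule cinner_eqI) (simp add: cinner_scaleC_left cinner_adj_left[OF T])
  then show ?thesis by (simp add: BH_def)
qed

lemma adj_adj: "T \<in> BH \<Longrightarrow> adj (adj T) = T"
  by (rule adj_eqI) (rule cinner_adj_left)

lemma norm_adj_le: "T \<in> BH \<Longrightarrow> norm (adj T) \<le> norm T"
proof (rule norm_blinfun_bound)
  fix x assume T: "T \<in> BH"
  show "norm (blinfun_apply (adj T) x) \<le> norm T * norm x"
  proof (rule norm_le_cinnerI)
    fix y
    have "cmod (cinner (blinfun_apply (adj T) x) y) \<le> norm x * norm (blinfun_apply T y)"
      by (simp add: cinner_adj_left[OF T] cinner_Cauchy_Schwarz)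
    also have "\<dots> \<le> norm x * (norm T * norm y)" by (intro mult_left_mono norm_blinfun) simp
    finally show "cmod (cinner (blinfun_apply (adj T) x) y) \<le> norm T * norm x * norm y" by (simp add: mult_ac)
  qed simp
qed simp

lemma BH_add: "S \<in> BH \<Longrightarrow> T \<in> BH \<Longrightarrow> S + T \<in> BH"
  by (simp add: BH_def blinfun.add_left scaleC_add_right)

lemma BH_compose: "S \<in> BH \<Longrightarrow> T \<in> BH \<Longrightarrow> S o\<^sub>L T \<in> BH"
  by (simp add: BH_def)

lemma BH_scale: "T \<in> BH \<Longrightarrow> c *\<^sub>C T \<in> BH"
  by (simp add: BH_def scaleC_blinfun.rep_eq scaleC_scaleC mult.commute)

lemma BH_zero: "0 \<in> BH" by (simp add: BH_def)

lemma closed_BH: "closed BH"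
proof -
  have "closed {T :: 'a \<Rightarrow>\<^sub>L 'a. blinfun_apply T (c *\<^sub>C x) = c *\<^sub>C blinfun_apply T x}" for c x
    by (intro closed_Collect_eq continuous_intros bounded_linear.continuous_on[OF bounded_linear_scaleC])
  then have "closed (\<Inter>c. \<Inter>x. {T :: 'a \<Rightarrow>\<^sub>L 'a. blinfun_apply T (c *\<^sub>C x) = c *\<^sub>C blinfun_apply T x})"
    by (intro closed_INT ballI)
  moreover have "BH = (\<Inter>c. \<Inter>x. {T :: 'a \<Rightarrow>\<^sub>L 'a. blinfun_apply T (c *\<^sub>C x) = c *\<^sub>C blinfun_apply T x})"
    by (auto simp: BH_def)
  ultimately show ?thesis by simp
qed

lemma cstar_algebra_BH: "cstar_algebra BH"
  unfolding cstar_algebra_def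
  by (auto intro: BH_add BH_compose BH_scale BH_zero adj_in_BH closed_BH)

section \<open>Approximate units\<close>

definition hermitian :: "('h::chilbert_space \<Rightarrow>\<^sub>L 'h) \<Rightarrow> bool" where
  "hermitian T \<longleftrightarrow> (\<forall>x y. cinner (blinfun_apply T x) y = cinner x (blinfun_apply T y))"

lemma hermitianD: "hermitian T \<Longrightarrow> cinner (blinfun_apply T x) y = cinner x (blinfun_apply T y)"
  by (simp add: hermitian_def)

lemma hermitian_adj: "hermitian T \<Longrightarrow> adj T = T"
  by (rule adj_eqI) (simp add: hermitian_def)

lemma hermitianI_adj: "T \<in> BH \<Longrightarrow> adj T = T \<Longrightarrow> hermitian T"
  unfolding hermitian_def by (metis cinner_adj_right)

lemma closed_hermitian: "closed {T :: 'h::chilbert_space \<Rightarrow>\<^sub>L 'h. hermitian T}"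
proof -
  have "closed {T :: 'h \<Rightarrow>\<^sub>L 'h. cinner (blinfun_apply T x) y = cinner x (blinfun_apply T y)}" for x y
    by (intro closed_Collect_eq bounded_bilinear.continuous_on[OF bounded_bilinear_cinner] continuous_intros)
  then have "closed (\<Inter>x. \<Inter>y. {T :: 'h \<Rightarrow>\<^sub>L 'h. cinner (blinfun_apply T x) y = cinner x (blinfun_apply T y)})"
    by (intro closed_INT ballI)
  moreover have "{T :: 'h \<Rightarrow>\<^sub>L 'h. hermitian T}
      = (\<Inter>x. \<Inter>y. {T. cinner (blinfun_apply T x) y = cinner x (blinfun_apply T y)})"
    by (auto simp: hermitian_def)
  ultimately show ?thesis by simp
qed

text \<open>Polarisation with \<open>x + y\<close> and \<open>x + \<i> y\<close>.\<close>

lemma hermitian_if_real_form: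
  assumes T: "T \<in> BH" and re: "\<And>v. Im (cinner (blinfun_apply T v) v) = 0"
  shows "hermitian T"
  unfolding hermitian_def
proof (intro allI complex_eqI)
  fix x y
  have c: "cinner x (blinfun_apply T y) = cnj (cinner (blinfun_apply T y) x)" by (rule cinner_commute)
  show "Im (cinner (blinfun_apply T x) y) = Im (cinner x (blinfun_apply T y))"
    using re[of "x + y"] re[of x] re[of y] c
    by (simp add: blinfun.add_right cinner_add_left cinner_add_right)
  show "Re (cinner (blinfun_apply T x) y) = Re (cinner x (blinfun_apply T y))"
    using re[of "x + \<i> *\<^sub>C y"] re[of x] re[of y] c
    by (simp add: blinfun.add_right BH_scaleC[OF T] cinner_algebra)
qed

lemma of_real_nonneg_Reals: "0 \<le> r \<Longrightarrow> complex_of_real r \<in> \<real>\<^sub>\<ge>\<^sub>0"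
  by (simp add: complex_nonneg_Reals_iff)

definition positive_op :: "('h::chilbert_space \<Rightarrow>\<^sub>L 'h) \<Rightarrow> bool" where
  "positive_op T \<longleftrightarrow> (\<forall>v. cinner (blinfun_apply T v) v \<in> \<real>\<^sub>\<ge>\<^sub>0)"

lemma positive_opD: "positive_op T \<Longrightarrow> 0 \<le> Re (cinner (blinfun_apply T v) v)"
  unfolding positive_op_def using complex_nonneg_Reals_iff by blast

lemma positive_op_scaleR:
  assumes "0 \<le> c" "positive_op T" shows "positive_op (c *\<^sub>R T)"
proof -
  have "cinner (blinfun_apply (c *\<^sub>R T) v) v = complex_of_real c * cinner (blinfun_apply T v) v" for v
    by (simp add: blinfun.scaleR_left cinner_scaleR_left)
  then show ?thesis using assms by (simp add: positive_op_def complex_nonneg_Reals_iff)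
qed

lemma positive_op_hermitian: "T \<in> BH \<Longrightarrow> positive_op T \<Longrightarrow> hermitian T"
  by (rule hermitian_if_real_form) (auto simp: positive_op_def complex_nonneg_Reals_iff)

lemma hermitian_form_real: "hermitian T \<Longrightarrow> Im (cinner (blinfun_apply T v) v) = 0"
  using hermitianD[of T v v] cinner_commute[of v "blinfun_apply T v"]
  by (metis complex_cnj_cancel_iff Reals_cnj_iff complex_is_Real_iff)

lemma positive_opI: "hermitian T \<Longrightarrow> (\<And>v. 0 \<le> Re (cinner (blinfun_apply T v) v)) \<Longrightarrow> positive_op T"
  by (simp add: positive_op_def complex_nonneg_Reals_iff hermitian_form_real)

text \<open>This is \<open>h\<^sup>2 \<le> h\<close>, from \<open>h - h\<^sup>2 = (1 - h) h (1 - h) + h (1 - h) h\<close>.\<close>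

lemma norm_sq_le_form:
  assumes h: "hermitian h" "positive_op h" and le1: "norm h \<le> 1"
  shows "(norm (blinfun_apply h v))\<^sup>2 \<le> Re (cinner (blinfun_apply h v) v)"
proof -
  let ?h = "blinfun_apply h"
  have "0 \<le> Re (cinner (?h (v - ?h v)) (v - ?h v))" by (rule positive_opD[OF h(2)])
  also have "\<dots> = Re (cinner (?h v) v) - 2 * (norm (?h v))\<^sup>2 + Re (cinner (?h (?h v)) (?h v))"
    using hermitianD[OF h(1), of "?h v" v] Re_cinner_self[of "?h v"]
    by (simp add: blinfun.diff_right cinner_diff_left cinner_diff_right)
  also have "Re (cinner (?h (?h v)) (?h v)) \<le> norm (?h (?h v)) * norm (?h v)" by (rule Re_cinner_le)
  also have "\<dots> \<le> (1 * norm (?h v)) * norm (?h v)"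
    by (intro mult_right_mono order_trans[OF norm_blinfun] le1) simp_all
  finally show ?thesis by (simp add: power2_eq_square)
qed

text \<open>The operator \<open>1 - (1 - h)\<^sup>n\<close>, a polynomial in \<open>h\<close> without constant term.\<close>

primrec one_minus_pow :: "('h::chilbert_space \<Rightarrow>\<^sub>L 'h) \<Rightarrow> nat \<Rightarrow> ('h \<Rightarrow>\<^sub>L 'h)" where
  "one_minus_pow h 0 = 0"
| "one_minus_pow h (Suc n) = one_minus_pow h n + h - (one_minus_pow h n o\<^sub>L h)"

lemma one_minus_pow_apply:
  "v - blinfun_apply (one_minus_pow h n) v = ((\<lambda>v. v - blinfun_apply h v) ^^ n) v"
proof (induction n arbitrary: v)
  case (Suc n)
  have "v - blinfun_apply (one_minus_pow h (Suc n)) v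
      = (v - blinfun_apply h v) - blinfun_apply (one_minus_pow h n) (v - blinfun_apply h v)"
    by (simp add: blinfun.add_left blinfun.diff_left blinfun.diff_right)
  also have "\<dots> = ((\<lambda>v. v - blinfun_apply h v) ^^ Suc n) v"
    by (simp only: Suc.IH funpow_Suc_right o_apply)
  finally show ?case .
qed simp

lemma hermitian_funpow:
  assumes "hermitian h"
  shows "cinner (((\<lambda>v. v - blinfun_apply h v) ^^ n) x) y = cinner x (((\<lambda>v. v - blinfun_apply h v) ^^ n) y)"
proof (induction n arbitrary: x)
  case (Suc n)
  let ?f = "\<lambda>v. v - blinfun_apply h v"
  have "cinner ((?f ^^ Suc n) x) y = cinner (x - blinfun_apply h x) ((?f ^^ n) y)"
    by (simp only: funpow_Suc_right o_apply Suc.IH)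
  then show ?case
    by (simp add: cinner_diff_left cinner_diff_right hermitianD[OF assms])
qed simp

lemma hermitian_one_minus_pow: "hermitian h \<Longrightarrow> hermitian (one_minus_pow h n)"
  unfolding hermitian_def
  using hermitian_funpow[of h n, folded one_minus_pow_apply]
  by (simp add: cinner_diff_left cinner_diff_right hermitian_def)

lemma norm_one_minus_pow_apply_le:
  assumes h: "hermitian h" "positive_op h" and le1: "norm h \<le> 1"
  shows "norm (((\<lambda>v. v - blinfun_apply h v) ^^ n) v) \<le> norm v"
proof (induction n)
  case (Suc n)
  define w where "w = ((\<lambda>v. v - blinfun_apply h v) ^^ n) v"
  have "(norm (w - blinfun_apply h w))\<^sup>2 \<le> (norm w)\<^sup>2"
    using norm_sq_le_form[OF assms, of w] positive_opD[OF h(2), of w] cinner_commute[of w "blinfun_apply h w"]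
    by (simp add: norm_diff_sq)
  then have "norm (w - blinfun_apply h w) \<le> norm w" by (rule power2_le_imp_le) simp
  with Suc show ?case by (simp add: w_def)
qed simp

text \<open>
  With \<open>x = 1 - h\<close>, the forms \<open>\<langle>h x\<^sup>k v, x\<^sup>k v\<rangle>\<close> decrease in \<open>k\<close> and are dominated by the
  differences of \<open>\<parallel>x\<^sup>k v\<parallel>\<^sup>2\<close>, which telescope.
\<close>

lemma one_minus_pow_decay:
  assumes h: "hermitian h" "positive_op h" and le1: "norm h \<le> 1"
  defines "x \<equiv> \<lambda>v. v - blinfun_apply h v"
  shows "real n * Re (cinner (blinfun_apply h ((x ^^ n) v)) ((x ^^ n) v)) \<le> (norm v)\<^sup>2"
proof -
  let ?h = "blinfun_apply h"
  define g where "g k = Re (cinner (?h ((x ^^ k) v)) ((x ^^ k) v))" for k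
  note sq = norm_sq_le_form[OF h le1]
  have step: "g k \<le> (norm ((x ^^ k) v))\<^sup>2 - (norm ((x ^^ Suc k) v))\<^sup>2" for k
    using sq[of "(x ^^ k) v"] cinner_commute[of "(x ^^ k) v" "?h ((x ^^ k) v)"]
    by (simp add: g_def x_def norm_diff_sq)
  have "g (Suc k) \<le> g k" for k
  proof -
    define w where "w = (x ^^ k) v"
    have "Re (cinner (?h (?h w)) (?h w)) \<le> norm (?h (?h w)) * norm (?h w)" by (rule Re_cinner_le)
    also have "\<dots> \<le> (1 * norm (?h w)) * norm (?h w)"
      by (intro mult_right_mono order_trans[OF norm_blinfun] le1) simp_all
    finally have "Re (cinner (?h (?h w)) (?h w)) \<le> (norm (?h w))\<^sup>2" by (simp add: power2_eq_square)
    moreover have "Re (cinner (?h (w - ?h w)) (w - ?h w))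
        = Re (cinner (?h w) w) - 2 * (norm (?h w))\<^sup>2 + Re (cinner (?h (?h w)) (?h w))"
      using hermitianD[OF h(1), of "?h w" w] Re_cinner_self[of "?h w"]
      by (simp add: blinfun.diff_right cinner_diff_left cinner_diff_right)
    moreover have "g (Suc k) = Re (cinner (?h (w - ?h w)) (w - ?h w))" "g k = Re (cinner (?h w) w)"
      by (simp_all add: g_def x_def w_def)
    ultimately show ?thesis using zero_le_power2[of "norm (?h w)"] by linarith
  qed
  then have "g n \<le> g k" if "k \<le> n" for k using that by (rule lift_Suc_antimono_le)
  then have "real n * g n \<le> (\<Sum>k<n. g k)" using sum_bounded_below[of "{..<n}" "g n" g] by simp
  also have "\<dots> \<le> (\<Sum>k<n. (norm ((x ^^ k) v))\<^sup>2 - (norm ((x ^^ Suc k) v))\<^sup>2)"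
    by (rule sum_mono) (rule step)
  also have "\<dots> = (norm v)\<^sup>2 - (norm ((x ^^ n) v))\<^sup>2" by (subst sum_lessThan_telescope') simp
  also have "\<dots> \<le> (norm v)\<^sup>2" by simp
  finally show ?thesis by (simp add: g_def)
qed

lemma norm_one_minus_pow_even:
  assumes h: "hermitian h" "positive_op h" and le1: "norm h \<le> 1"
  shows "norm (one_minus_pow h (n + n)) \<le> 1"
proof (rule norm_blinfun_bound)
  fix v
  define e where "e = one_minus_pow h (n + n)"
  define y where "y = (\<lambda>v. v - blinfun_apply h v) ^^ n"
  have he: "hermitian e" unfolding e_def by (rule hermitian_one_minus_pow[OF h(1)])
  have ev: "v - blinfun_apply e v = y (y v)" for v
    unfolding e_def y_def one_minus_pow_apply funpow_add by simp
  have yy: "Re (cinner (y (y v)) v) = (norm (y v))\<^sup>2" for v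
    using hermitian_funpow[OF h(1), of n "y v" v] Re_cinner_self[of "y v"] by (simp add: y_def)
  have y_le: "norm (y v) \<le> norm v" for v
    unfolding y_def by (rule norm_one_minus_pow_apply_le[OF assms])
  have "(norm (blinfun_apply e v))\<^sup>2 = (norm (v - y (y v)))\<^sup>2" by (simp add: ev[symmetric])
  also have "\<dots> = (norm v)\<^sup>2 - 2 * (norm (y v))\<^sup>2 + (norm (y (y v)))\<^sup>2"
    using yy[of v] cinner_commute[of v "y (y v)"] by (simp add: norm_diff_sq)
  also have "\<dots> \<le> (norm v)\<^sup>2"
    using power_mono[OF y_le[of "y v"] norm_ge_zero, of 2] zero_le_power2[of "norm (y v)"] by linarith
  finally show "norm (blinfun_apply e v) \<le> 1 * norm v" using power2_le_imp_le[OF _ norm_ge_zero] by (metis mult_1)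
qed simp

lemma cstar_BH: "cstar_algebra A \<Longrightarrow> a \<in> A \<Longrightarrow> a \<in> BH" by (auto simp: cstar_algebra_def)
lemma cstar_zero: "cstar_algebra A \<Longrightarrow> 0 \<in> A" by (auto simp: cstar_algebra_def)
lemma cstar_add: "cstar_algebra A \<Longrightarrow> a \<in> A \<Longrightarrow> b \<in> A \<Longrightarrow> a + b \<in> A" by (auto simp: cstar_algebra_def)
lemma cstar_compose: "cstar_algebra A \<Longrightarrow> a \<in> A \<Longrightarrow> b \<in> A \<Longrightarrow> a o\<^sub>L b \<in> A" by (auto simp: cstar_algebra_def)
lemma cstar_scaleC: "cstar_algebra A \<Longrightarrow> a \<in> A \<Longrightarrow> c *\<^sub>C a \<in> A" by (auto simp: cstar_algebra_def)
lemma cstar_scaleR: "cstar_algebra A \<Longrightarrow> a \<in> A \<Longrightarrow> c *\<^sub>R a \<in> A" by (simp add: scaleR_scaleC cstar_scaleC)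
lemma cstar_adj: "cstar_algebra A \<Longrightarrow> a \<in> A \<Longrightarrow> adj a \<in> A" by (auto simp: cstar_algebra_def)
lemma cstar_closed: "cstar_algebra A \<Longrightarrow> closed A" by (auto simp: cstar_algebra_def)
lemma cstar_minus: "cstar_algebra A \<Longrightarrow> a \<in> A \<Longrightarrow> - a \<in> A"
  using cstar_scaleC[of A a "-1"] by (simp add: scaleC_minus1_left)
lemma cstar_diff: "cstar_algebra A \<Longrightarrow> a \<in> A \<Longrightarrow> b \<in> A \<Longrightarrow> a - b \<in> A"
  using cstar_add[of A a "- b"] cstar_minus[of A b] by simp
lemma cstar_sum: "cstar_algebra A \<Longrightarrow> (\<And>i. i \<in> I \<Longrightarrow> f i \<in> A) \<Longrightarrow> sum f I \<in> A"
  by (induction I rule: infinite_finite_induct) (auto intro: cstar_zero cstar_add)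

lemma cstar_one_minus_pow: "cstar_algebra A \<Longrightarrow> h \<in> A \<Longrightarrow> one_minus_pow h n \<in> A"
  by (induction n) (auto intro: cstar_zero cstar_add cstar_diff cstar_compose)

text \<open>
  For \<open>h\<close> a small multiple of \<open>\<Sum>a\<in>S. a\<^sup>*a + aa\<^sup>*\<close>, every \<open>a \<in> S\<close> satisfies \<open>a\<^sup>*a \<le> C h\<close>, so
  that \<open>a (1 - h)\<^sup>n\<close> tends to zero.
\<close>

lemma approximate_unit:
  fixes A :: "('h::chilbert_space \<Rightarrow>\<^sub>L 'h) set"
  assumes A: "cstar_algebra A" and S: "finite S" "S \<subseteq> A"
  obtains e :: "nat \<Rightarrow> 'h \<Rightarrow>\<^sub>L 'h"
    where "\<And>k. e k \<in> A" "\<And>k. hermitian (e k)" "\<And>k. norm (e k) \<le> 1"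
      and "\<And>a. a \<in> S \<Longrightarrow> (\<lambda>k. e k o\<^sub>L a o\<^sub>L e k) \<longlonglongrightarrow> a"
proof -
  have SB: "a \<in> BH" if "a \<in> S" for a using that S cstar_BH[OF A] by blast
  define g where "g = (\<Sum>a\<in>S. (adj a o\<^sub>L a) + (a o\<^sub>L adj a))"
  define c where "c = 1 / (norm g + 1)"
  define h where "h = c *\<^sub>R g"
  have c: "0 < c" unfolding c_def by (simp add: add_nonneg_pos)
  have gA: "g \<in> A" unfolding g_def
    by (intro cstar_sum[OF A] cstar_add[OF A] cstar_compose[OF A] cstar_adj[OF A]) (use S in auto)
  then have hA: "h \<in> A" unfolding h_def by (rule cstar_scaleR[OF A])
  have hform: "cinner (blinfun_apply h v) v = complex_of_real
      (c * (\<Sum>a\<in>S. (norm (blinfun_apply a v))\<^sup>2 + (norm (blinfun_apply (adj a) v))\<^sup>2))" for v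
    unfolding h_def g_def
    by (simp add: blinfun.scaleR_left cinner_scaleR_left blinfun.sum_left cinner_sum_left blinfun.add_left
        cinner_add_left cinner_adj_left[OF SB] cinner_adj_right[OF SB, symmetric] adj_adj[OF SB] cinner_norm
        cong: sum.cong)
  have hpos: "positive_op h"
    unfolding positive_op_def hform
    by (intro allI of_real_nonneg_Reals mult_nonneg_nonneg sum_nonneg add_nonneg_nonneg) (use c in auto)
  have hherm: "hermitian h" by (rule positive_op_hermitian[OF cstar_BH[OF A hA] hpos])
  have "norm h = norm g / (norm g + 1)" by (simp add: h_def c_def)
  also have "\<dots> \<le> 1" by (simp add: divide_le_eq_1_pos add_nonneg_pos)
  finally have h1: "norm h \<le> 1" .
  \<comment> \<open>an even exponent makes \<open>1 - e\<close> a square, so that \<open>e\<close> is a contraction\<close>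
  define e where "e k = one_minus_pow h (Suc k + Suc k)" for k
  define \<delta> where "\<delta> k = sqrt (1 / (c * real (Suc k)))" for k
  have eA: "e k \<in> A" for k unfolding e_def by (rule cstar_one_minus_pow[OF A hA])
  have eh: "hermitian (e k)" for k unfolding e_def by (rule hermitian_one_minus_pow[OF hherm])
  have e1: "norm (e k) \<le> 1" for k unfolding e_def by (rule norm_one_minus_pow_even[OF hherm hpos h1])
  have decay: "(norm (blinfun_apply b (v - blinfun_apply (e k) v)))\<^sup>2 \<le> (\<delta> k * norm v)\<^sup>2"
    if ab: "\<exists>a\<in>S. b = a \<or> b = adj a" for b k v
  proof -
    let ?w = "v - blinfun_apply (e k) v"
    obtain a where a: "a \<in> S" "b = a \<or> b = adj a" using ab by blast
    have "(norm (blinfun_apply b ?w))\<^sup>2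
        \<le> (norm (blinfun_apply a ?w))\<^sup>2 + (norm (blinfun_apply (adj a) ?w))\<^sup>2" using a(2) by auto
    also have "\<dots> \<le> (\<Sum>a\<in>S. (norm (blinfun_apply a ?w))\<^sup>2 + (norm (blinfun_apply (adj a) ?w))\<^sup>2)"
      by (rule member_le_sum[OF a(1)]) (use S in auto)
    finally have "c * (norm (blinfun_apply b ?w))\<^sup>2 \<le> Re (cinner (blinfun_apply h ?w) ?w)"
      using c unfolding hform by simp
    then have "real (Suc k) * (c * (norm (blinfun_apply b ?w))\<^sup>2)
        \<le> real (Suc k + Suc k) * Re (cinner (blinfun_apply h ?w) ?w)"
      using c by (intro mult_mono) auto
    also have "\<dots> \<le> (norm v)\<^sup>2"
      unfolding e_def one_minus_pow_apply by (rule one_minus_pow_decay[OF hherm hpos h1])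
    finally have "(norm (blinfun_apply b ?w))\<^sup>2 \<le> (norm v)\<^sup>2 / (c * real (Suc k))"
      using c by (subst pos_le_divide_eq) (simp_all add: mult_ac)
    moreover have "(\<delta> k)\<^sup>2 = 1 / (c * real (Suc k))" unfolding \<delta>_def using c by (intro real_sqrt_pow2) simp
    ultimately show ?thesis by (simp add: power_mult_distrib)
  qed
  \<comment> \<open>so \<open>a (1 - e)\<close> is small, and by taking adjoints so is \<open>(1 - e) a\<close>\<close>
  have right: "norm (blinfun_apply b (v - blinfun_apply (e k) v)) \<le> \<delta> k * norm v"
    if "\<exists>a\<in>S. b = a \<or> b = adj a" for b k v
    by (rule power2_le_imp_le[OF decay[OF that]]) (use c in \<open>simp add: \<delta>_def\<close>)
  have left: "norm (a - (e k o\<^sub>L a)) \<le> \<delta> k" if a: "a \<in> S" for a k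
  proof (rule norm_blinfun_bound)
    fix v
    show "norm (blinfun_apply (a - (e k o\<^sub>L a)) v) \<le> \<delta> k * norm v"
    proof (rule norm_le_cinnerI)
      fix y
      have "cinner (blinfun_apply (a - (e k o\<^sub>L a)) v) y
          = cinner v (blinfun_apply (adj a) (y - blinfun_apply (e k) y))"
        by (simp add: blinfun.diff_left blinfun.diff_right cinner_diff_left cinner_diff_right
            hermitianD[OF eh] cinner_adj_right[OF SB[OF a]])
      also have "cmod \<dots> \<le> norm v * norm (blinfun_apply (adj a) (y - blinfun_apply (e k) y))"
        by (rule cinner_Cauchy_Schwarz)
      also have "\<dots> \<le> norm v * (\<delta> k * norm y)" using a by (intro mult_left_mono right) auto
      finally show "cmod (cinner (blinfun_apply (a - (e k o\<^sub>L a)) v) y) \<le> \<delta> k * norm v * norm y"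
        by (simp add: mult_ac)
    qed (use c in \<open>simp add: \<delta>_def\<close>)
  qed (use c in \<open>simp add: \<delta>_def\<close>)
  have \<delta>0: "\<delta> \<longlonglongrightarrow> 0"
  proof -
    have "(\<lambda>k. sqrt (1 / c * (1 / real (Suc k)))) \<longlonglongrightarrow> sqrt (1 / c * 0)"
      by (intro tendsto_intros LIMSEQ_inverse_real_of_nat[unfolded inverse_eq_divide])
    moreover have "\<delta> = (\<lambda>k. sqrt (1 / c * (1 / real (Suc k))))" by (rule ext) (simp add: \<delta>_def)
    ultimately show ?thesis by simp
  qed
  have lim: "(\<lambda>k. e k o\<^sub>L a o\<^sub>L e k) \<longlonglongrightarrow> a" if a: "a \<in> S" for a
  proof -
    have le: "norm ((e k o\<^sub>L a o\<^sub>L e k) - a) \<le> 2 * \<delta> k" for k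
    proof (rule norm_blinfun_bound)
      fix v
      have eq: "blinfun_apply ((e k o\<^sub>L a o\<^sub>L e k) - a) v = - blinfun_apply (a - (e k o\<^sub>L a)) v
          - blinfun_apply (e k) (blinfun_apply a (v - blinfun_apply (e k) v))"
        by (simp add: blinfun.diff_left blinfun.diff_right)
      have "norm (blinfun_apply ((e k o\<^sub>L a o\<^sub>L e k) - a) v)
          \<le> norm (blinfun_apply (a - (e k o\<^sub>L a)) v)
            + norm (blinfun_apply (e k) (blinfun_apply a (v - blinfun_apply (e k) v)))"
        unfolding eq by (rule order_trans[OF norm_triangle_ineq4]) (simp only: norm_minus_cancel)
      also have "\<dots> \<le> \<delta> k * norm v + 1 * (\<delta> k * norm v)"
        using a by (intro add_mono order_trans[OF norm_blinfun] mult_right_mono left mult_mono right e1) auto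
      finally show "norm (blinfun_apply ((e k o\<^sub>L a o\<^sub>L e k) - a) v) \<le> 2 * \<delta> k * norm v" by (simp add: mult_ac)
    qed (use c in \<open>simp add: \<delta>_def\<close>)
    have "(\<lambda>k. 2 * \<delta> k) \<longlonglongrightarrow> 0" using tendsto_mult[OF tendsto_const \<delta>0, of 2] by simp
    from Lim_null_comparison[OF always_eventually[OF allI[OF le]] this]
    show ?thesis by (rule LIM_zero_cancel)
  qed
  show thesis by (rule that[of e]) (fact eA eh e1 lim)+
qed

section \<open>Homomorphisms of C*-algebras\<close>

definition star_hom ::
  "('h::chilbert_space \<Rightarrow>\<^sub>L 'h) set \<Rightarrow> (('h \<Rightarrow>\<^sub>L 'h) \<Rightarrow> 'k::chilbert_space \<Rightarrow>\<^sub>L 'k) \<Rightarrow> bool" where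
  "star_hom A \<theta> \<longleftrightarrow> \<theta> ` A \<subseteq> BH \<and> clinear_on A \<theta> \<and>
     (\<forall>a\<in>A. \<forall>b\<in>A. \<theta> (a o\<^sub>L b) = \<theta> a o\<^sub>L \<theta> b) \<and> (\<forall>a\<in>A. \<theta> (adj a) = adj (\<theta> a))"

lemma star_homD:
  assumes "star_hom A \<theta>" "a \<in> A"
  shows "\<theta> a \<in> BH" "b \<in> A \<Longrightarrow> \<theta> (a + b) = \<theta> a + \<theta> b" "\<theta> (c *\<^sub>C a) = c *\<^sub>C \<theta> a"
    "\<theta> (r *\<^sub>R a) = r *\<^sub>R \<theta> a" "b \<in> A \<Longrightarrow> \<theta> (a o\<^sub>L b) = \<theta> a o\<^sub>L \<theta> b" "\<theta> (adj a) = adj (\<theta> a)"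
  using assms by (auto simp: star_hom_def clinear_on_def scaleR_scaleC)

lemma clinear_on_zero: "clinear_on A \<theta> \<Longrightarrow> 0 \<in> A \<Longrightarrow> \<theta> 0 = 0"
  unfolding clinear_on_def by (metis scaleC_zero_left)

lemma clinear_on_diff:
  assumes "clinear_on A \<theta>" "a \<in> A" "b \<in> A" "- b \<in> A"
  shows "\<theta> (a - b) = \<theta> a - \<theta> b"
proof -
  have "\<theta> (- b) = - \<theta> b" using assms unfolding clinear_on_def by (metis scaleC_minus1_left)
  then show ?thesis using assms unfolding clinear_on_def by (metis diff_conv_add_uminus)
qed

lemma star_hom_diff:
  "cstar_algebra A \<Longrightarrow> star_hom A \<theta> \<Longrightarrow> a \<in> A \<Longrightarrow> b \<in> A \<Longrightarrow> \<theta> (a - b) = \<theta> a - \<theta> b"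
  by (rule clinear_on_diff[of A]) (auto simp: star_hom_def cstar_minus)

lemma star_hom_hermitian: "star_hom A \<theta> \<Longrightarrow> a \<in> A \<Longrightarrow> hermitian a \<Longrightarrow> hermitian (\<theta> a)"
  by (metis hermitianI_adj hermitian_adj star_homD(1,6))

text \<open>
  For hermitian \<open>a\<close> of norm less than one, \<open>b = 1 - \<surd>(1 - a\<^sup>2)\<close> is the fixed point of
  \<open>b \<mapsto> (a\<^sup>2 + b\<^sup>2) / 2\<close>. It lies in the algebra even without a unit.
\<close>

lemma hermitian_sqrt_fixpoint:
  assumes A: "cstar_algebra A" and a: "a \<in> A" "hermitian a" "norm a < 1"
  obtains b where "b \<in> A" "hermitian b" "b = (1/2) *\<^sub>R ((a o\<^sub>L a) + (b o\<^sub>L b))"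
proof -
  define S where "S = A \<inter> {b. hermitian b} \<inter> cball 0 (norm a)"
  define f where "f b = (1/2::real) *\<^sub>R ((a o\<^sub>L a) + (b o\<^sub>L b))" for b
  have "\<exists>!b\<in>S. f b = b"
  proof (rule Banach_fix)
    show "complete S"
      unfolding complete_eq_closed S_def by (intro closed_Int cstar_closed[OF A] closed_hermitian closed_cball)
    have "0 \<in> S" by (simp add: S_def cstar_zero[OF A] hermitian_def)
    then show "S \<noteq> {}" by blast
    show "f ` S \<subseteq> S"
    proof (rule image_subsetI)
      fix b assume b: "b \<in> S"
      have "f b \<in> A" unfolding f_def using b a(1) S_def
        by (intro cstar_scaleR[OF A] cstar_add[OF A] cstar_compose[OF A]) auto
      moreover have "hermitian (f b)" using a(2) b
        by (simp add: hermitian_def f_def S_def blinfun.scaleR_left blinfun.add_left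
            cinner_scaleR_left cinner_scaleR_right cinner_add_left cinner_add_right)
      moreover have "norm (f b) \<le> norm a"
      proof -
        have "norm ((a o\<^sub>L a) + (b o\<^sub>L b)) \<le> norm a * norm a + norm a * norm a"
          using b by (intro norm_triangle_le add_mono order_trans[OF norm_blinfun_compose] mult_mono) (auto simp: S_def)
        also have "\<dots> \<le> 2 * norm a" using a(3) mult_left_mono[of "norm a" 1 "norm a"] by simp
        finally show ?thesis by (simp add: f_def)
      qed
      ultimately show "f b \<in> S" by (simp add: S_def)
    qed
    fix b c assume b: "b \<in> S" and c: "c \<in> S"
    have "f b - f c = (1/2::real) *\<^sub>R ((b o\<^sub>L (b - c)) + ((b - c) o\<^sub>L c))"
      unfolding f_def by (rule blinfun_eqI)
        (simp add: blinfun.diff_left blinfun.diff_right blinfun.add_left blinfun.scaleR_left algebra_simps)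
    moreover have "norm ((b o\<^sub>L (b - c)) + ((b - c) o\<^sub>L c)) \<le> norm a * norm (b - c) + norm (b - c) * norm a"
      using b c by (intro norm_triangle_le add_mono order_trans[OF norm_blinfun_compose] mult_mono) (auto simp: S_def)
    ultimately show "dist (f b) (f c) \<le> norm a * dist b c" by (simp add: dist_norm)
  qed (use a in auto)
  then obtain b where b: "b \<in> S" "f b = b" by blast
  show thesis
    by (rule that[of b]) (use b(1) in \<open>simp_all add: S_def b(2)[unfolded f_def]\<close>)
qed

text \<open>
  For \<open>a\<close> and \<open>b\<close> as above, \<open>1 - \<theta>(a)\<^sup>2 = (1 - \<theta>(b))\<^sup>2\<close> is an algebraic consequence of
  \<open>1 - a\<^sup>2 = (1 - b)\<^sup>2\<close>, and shows that \<open>\<theta>(a)\<close> is a contraction.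
\<close>

lemma star_hom_contractive:
  assumes A: "cstar_algebra A" and \<theta>: "star_hom A \<theta>" and a: "a \<in> A"
  shows "norm (\<theta> a) \<le> norm a"
proof -
  note D = star_homD[OF \<theta>]
  have herm: "norm (blinfun_apply (\<theta> a) v) \<le> norm v" if a: "a \<in> A" "hermitian a" "norm a < 1" for a v
  proof -
    obtain b where b: "b \<in> A" "hermitian b" and eq: "b = (1/2) *\<^sub>R ((a o\<^sub>L a) + (b o\<^sub>L b))"
      by (rule hermitian_sqrt_fixpoint[OF A a])
    note hb = star_hom_hermitian[OF \<theta> b] and ha = star_hom_hermitian[OF \<theta> a(1,2)]
    let ?a = "blinfun_apply (\<theta> a)" and ?b = "blinfun_apply (\<theta> b)"
    have "\<theta> b = (1/2) *\<^sub>R ((\<theta> a o\<^sub>L \<theta> a) + (\<theta> b o\<^sub>L \<theta> b))"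
      by (subst eq) (simp add: D a b cstar_add[OF A] cstar_compose[OF A])
    from arg_cong[OF this, of "\<lambda>T. blinfun_apply T v"]
    have "blinfun_apply (\<theta> b) v = (1/2) *\<^sub>R (?a (?a v) + ?b (?b v))"
      by (simp only: blinfun.add_left blinfun.scaleR_left blinfun_apply_blinfun_compose)
    from arg_cong[OF this, of "\<lambda>u. Re (cinner u v)"]
    have "2 * Re (cinner (?b v) v) = Re (cinner (?a (?a v)) v) + Re (cinner (?b (?b v)) v)"
      by (simp add: cinner_scaleR_left cinner_add_left)
    then have "2 * Re (cinner (?b v) v) = (norm (?a v))\<^sup>2 + (norm (?b v))\<^sup>2"
      by (simp only: hermitianD[OF ha, of "?a v"] hermitianD[OF hb, of "?b v"] Re_cinner_self)
    then have "(norm (?a v))\<^sup>2 = (norm v)\<^sup>2 - (norm (v - ?b v))\<^sup>2"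
      unfolding norm_diff_sq Re_cinner_commute[of v "?b v"] by linarith
    then have "(norm (?a v))\<^sup>2 \<le> (norm v)\<^sup>2" by simp
    then show ?thesis by (rule power2_le_imp_le) simp
  qed
  \<comment> \<open>the general case, by the hermitian case for \<open>a\<^sup>*a\<close>\<close>
  have lt: "norm (\<theta> a) \<le> 1" if a: "a \<in> A" "norm a < 1" for a
  proof (rule norm_blinfun_bound)
    fix v
    have aB: "a \<in> BH" using a(1) by (rule cstar_BH[OF A])
    have cA: "adj a o\<^sub>L a \<in> A" using a by (intro cstar_compose[OF A] cstar_adj[OF A]) auto
    have "norm (adj a o\<^sub>L a) \<le> norm a * norm a"
      by (intro order_trans[OF norm_blinfun_compose] mult_right_mono norm_adj_le aB) simp
    also have "\<dots> < 1" using a(2) mult_strict_mono'[of "norm a" 1 "norm a" 1] by simp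
    finally have c1: "norm (adj a o\<^sub>L a) < 1" .
    have ch: "hermitian (adj a o\<^sub>L a)"
      by (simp add: hermitian_def cinner_adj_left[OF aB] cinner_adj_right[OF aB])
    have "(norm (blinfun_apply (\<theta> a) v))\<^sup>2 = Re (cinner (blinfun_apply (\<theta> (adj a o\<^sub>L a)) v) v)"
      using a(1) by (simp add: D cstar_adj[OF A] cinner_adj_left Re_cinner_self)
    also have "\<dots> \<le> norm (blinfun_apply (\<theta> (adj a o\<^sub>L a)) v) * norm v" by (rule Re_cinner_le)
    also have "\<dots> \<le> norm v * norm v" by (intro mult_right_mono herm cA ch c1) simp
    finally have "(norm (blinfun_apply (\<theta> a) v))\<^sup>2 \<le> (norm v)\<^sup>2" by (simp add: power2_eq_square)
    then show "norm (blinfun_apply (\<theta> a) v) \<le> 1 * norm v" using power2_le_imp_le[OF _ norm_ge_zero] by (metis mult_1)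
  qed simp
  show ?thesis
  proof (rule field_le_epsilon)
    fix \<epsilon> :: real assume "0 < \<epsilon>"
    define r where "r = norm a + \<epsilon>"
    have r: "0 < r" "norm a < r" using \<open>0 < \<epsilon>\<close> by (simp_all add: r_def add_nonneg_pos)
    have "norm (\<theta> ((1/r) *\<^sub>R a)) \<le> 1" using r by (intro lt cstar_scaleR[OF A] a) simp
    then show "norm (\<theta> a) \<le> norm a + \<epsilon>" using r by (simp add: D a) (simp add: r_def)
  qed
qed

lemma star_hom_one_minus_pow:
  assumes A: "cstar_algebra A" and \<theta>: "star_hom A \<theta>" and a: "a \<in> A"
  shows "\<theta> (one_minus_pow a n) = one_minus_pow (\<theta> a) n"
proof (induction n)
  case 0
  then show ?case using clinear_on_zero[of A \<theta>] \<theta> cstar_zero[OF A] by (simp add: star_hom_def)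
next
  case (Suc n)
  have "one_minus_pow a n \<in> A" by (rule cstar_one_minus_pow[OF A a])
  then show ?case using a Suc
    by (simp add: star_hom_diff[OF A \<theta>] star_homD[OF \<theta>] cstar_add[OF A] cstar_compose[OF A])
qed

text \<open>
  For \<open>0 \<le> a \<le> 1\<close> the powers of \<open>1 - a\<close> are bounded, hence so are those of \<open>1 - \<theta>(a)\<close>. For a
  hermitian operator this means norm at most one, and \<open>\<parallel>1 - \<theta>(a)\<parallel> \<le> 1\<close> gives \<open>\<theta>(a) \<ge> 0\<close>.
\<close>

lemma star_hom_positive:
  assumes A: "cstar_algebra A" and \<theta>: "star_hom A \<theta>" and a: "a \<in> A" "positive_op a"
  shows "positive_op (\<theta> a)"
proof -
  note D = star_homD[OF \<theta>]
  have *: "positive_op (\<theta> a)" if a: "a \<in> A" "positive_op a" and le1: "norm a \<le> 1" for a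
  proof -
    have ha: "hermitian a" by (rule positive_op_hermitian[OF cstar_BH[OF A a(1)] a(2)])
    define h where "h = \<theta> a"
    have hh: "hermitian h" unfolding h_def by (rule star_hom_hermitian[OF \<theta> a(1) ha])
    define y where "y = id_blinfun - h"
    have y_app: "blinfun_apply y v = v - blinfun_apply h v" for v by (simp add: y_def blinfun.diff_left)
    have y_fun: "blinfun_apply y = (\<lambda>v. v - blinfun_apply h v)" by (rule ext) (rule y_app)
    have bnd: "norm (((blinfun_apply y) ^^ n) v) \<le> 3 * norm v" for n v
    proof -
      have "norm (one_minus_pow a n) \<le> 2"
      proof (rule norm_blinfun_bound)
        fix w
        have "norm (blinfun_apply (one_minus_pow a n) w) \<le> norm w + norm (w - blinfun_apply (one_minus_pow a n) w)"
          by (metis norm_minus_commute norm_triangle_sub add.commute)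
        also have "\<dots> \<le> norm w + norm w"
          unfolding one_minus_pow_apply by (intro add_left_mono norm_one_minus_pow_apply_le[OF ha a(2) le1])
        finally show "norm (blinfun_apply (one_minus_pow a n) w) \<le> 2 * norm w" by simp
      qed simp
      then have "norm (one_minus_pow h n) \<le> 2"
        using star_hom_contractive[OF A \<theta> cstar_one_minus_pow[OF A a(1)]]
        by (simp add: h_def star_hom_one_minus_pow[OF A \<theta> a(1), symmetric]) (meson order_trans)
      then have "norm (blinfun_apply (one_minus_pow h n) v) \<le> 2 * norm v"
        by (intro order_trans[OF norm_blinfun] mult_right_mono) auto
      moreover have "(blinfun_apply y ^^ n) v = v - blinfun_apply (one_minus_pow h n) v"
        unfolding one_minus_pow_apply y_fun ..
      ultimately show ?thesis using norm_triangle_ineq4[of v "blinfun_apply (one_minus_pow h n) v"] by simp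
    qed
    have yh: "cinner ((blinfun_apply y ^^ n) v) w = cinner v ((blinfun_apply y ^^ n) w)" for n v w
      unfolding y_fun by (rule hermitian_funpow[OF hh])
    have sq: "(norm ((blinfun_apply y ^^ n) v))\<^sup>2 \<le> norm v * norm ((blinfun_apply y ^^ (n + n)) v)" for n v
    proof -
      have "(norm ((blinfun_apply y ^^ n) v))\<^sup>2 = Re (cinner v ((blinfun_apply y ^^ (n + n)) v))"
        by (simp add: Re_cinner_self[symmetric] yh funpow_add)
      then show ?thesis using Re_cinner_le by metis
    qed
    have "norm (blinfun_apply y v) \<le> norm v" for v
    proof (cases "v = 0")
      case False
      define q where "q = norm (blinfun_apply y v) / norm v"
      have "q ^ (2 ^ k) \<le> norm ((blinfun_apply y ^^ (2 ^ k)) v) / norm v" for k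
      proof (induction k)
        case (Suc k)
        have "q ^ (2 ^ Suc k) = (q ^ (2 ^ k))\<^sup>2" by (simp add: power_mult[symmetric] mult.commute)
        also have "\<dots> \<le> (norm ((blinfun_apply y ^^ (2 ^ k)) v) / norm v)\<^sup>2"
          using Suc by (rule power_mono) (simp add: q_def)
        also have "\<dots> \<le> norm ((blinfun_apply y ^^ (2 ^ k + 2 ^ k)) v) / norm v"
          using sq[of "2 ^ k" v] False by (simp add: field_simps power2_eq_square)
        finally show ?case by (simp add: mult_2)
      qed (simp add: q_def)
      moreover have "norm ((blinfun_apply y ^^ (2 ^ k)) v) / norm v \<le> 3" for k
        using bnd[of "2 ^ k" v] False by (simp add: field_simps)
      ultimately have q3: "q ^ (2 ^ k) \<le> 3" for k by (meson order_trans)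
      \<comment> \<open>squaring repeatedly turns any excess over \<open>1\<close> into unbounded growth\<close>
      have "q \<le> 1"
      proof (rule ccontr)
        assume "\<not> q \<le> 1"
        then obtain n where n: "3 < q ^ n" using real_arch_pow[of q 3] by auto
        also have "q ^ n \<le> q ^ (2 ^ n)" using \<open>\<not> q \<le> 1\<close> by (intro power_increasing) auto
        finally show False using q3[of n] by simp
      qed
      then show ?thesis using False by (simp add: q_def field_simps)
    qed simp
    then have "(norm (v - blinfun_apply h v))\<^sup>2 \<le> (norm v)\<^sup>2" for v
      unfolding y_app[symmetric] by (simp add: power_mono)
    moreover have "(norm (v - blinfun_apply h v))\<^sup>2
        = (norm v)\<^sup>2 - 2 * Re (cinner (blinfun_apply h v) v) + (norm (blinfun_apply h v))\<^sup>2" for v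
      unfolding norm_diff_sq Re_cinner_commute[of v "blinfun_apply h v"] ..
    ultimately have "0 \<le> Re (cinner (blinfun_apply h v) v)" for v
      using zero_le_power2[of "norm (blinfun_apply h v)"] by (smt (verit))
    then show ?thesis using positive_opI[OF hh] by (simp add: h_def)
  qed
  define r where "r = norm a + 1"
  have r: "0 < r" by (simp add: r_def add_nonneg_pos)
  have "positive_op ((1/r) *\<^sub>R a)"
    using a(2) r by (intro positive_op_scaleR) auto
  then have "positive_op (\<theta> ((1/r) *\<^sub>R a))"
    using r by (intro * cstar_scaleR[OF A] a) (simp_all add: r_def)
  moreover have "\<theta> a = r *\<^sub>R \<theta> ((1/r) *\<^sub>R a)" using r by (simp add: D a)
  ultimately show ?thesis using r positive_op_scaleR[of r "\<theta> ((1/r) *\<^sub>R a)"] by (metis less_imp_le)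
qed

section \<open>Matrix entries of operators on square summable families\<close>

lift_definition emb_vec :: "'x \<Rightarrow> 'h::chilbert_space \<Rightarrow> ('x, 'h) ell2"
  is "\<lambda>x h y. if y = x then h else 0"
proof -
  fix x :: 'x and h :: 'h
  have "(\<lambda>y. (norm (if y = x then h else 0))\<^sup>2) summable_on {x}" by simp
  then show "(\<lambda>y. (norm (if y = x then h else 0))\<^sup>2) summable_on UNIV"
    by (rule summable_on_cong_neutral[THEN iffD1, rotated -1]) auto
qed

lemma norm_ell2_sq: "(norm \<xi>)\<^sup>2 = (\<Sum>\<^sub>\<infinity>x. (norm (Rep_ell2 \<xi> x))\<^sup>2)"
  by (simp add: norm_ell2_def infsum_nonneg)

lemma norm_Rep_ell2_le: "norm (Rep_ell2 \<xi> x) \<le> norm \<xi>"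
  using ell2_norm_finite[of "{x}" \<xi>] by (simp add: norm_ell2_def)

lemma cinner_emb_vec: "cinner (emb_vec x h) \<xi> = cinner h (Rep_ell2 \<xi> x)"
proof -
  have "cinner (emb_vec x h) \<xi> = (\<Sum>\<^sub>\<infinity>y\<in>{x}. cinner h (Rep_ell2 \<xi> y))"
    unfolding cinner_ell2_def by (rule infsum_cong_neutral) (auto simp: emb_vec.rep_eq)
  then show ?thesis by simp
qed

lemma ell2_eqI: "(\<And>x. Rep_ell2 \<xi> x = Rep_ell2 \<eta> x) \<Longrightarrow> \<xi> = \<eta>"
  by (metis Rep_ell2_inject ext)

lemmas ell2_rep = zero_ell2.rep_eq plus_ell2.rep_eq uminus_ell2.rep_eq minus_ell2.rep_eq
  scaleR_ell2.rep_eq scaleC_ell2.rep_eq emb_vec.rep_eq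

lemma norm_emb_vec: "norm (emb_vec x h) = norm h"
proof -
  have "complex_of_real ((norm (emb_vec x h))\<^sup>2) = complex_of_real ((norm h)\<^sup>2)"
    unfolding cinner_norm[symmetric] cinner_emb_vec emb_vec.rep_eq by simp
  then show ?thesis by (simp only: of_real_eq_iff) simp
qed

definition emb :: "'x \<Rightarrow> 'h::chilbert_space \<Rightarrow>\<^sub>L ('x, 'h) ell2" where
  "emb x = Blinfun (emb_vec x)"

definition coord :: "'x \<Rightarrow> ('x, 'h::chilbert_space) ell2 \<Rightarrow>\<^sub>L 'h" where
  "coord x = Blinfun (\<lambda>\<xi>. Rep_ell2 \<xi> x)"

lemma emb_apply [simp]: "blinfun_apply (emb x) = emb_vec x"
  unfolding emb_def
  by (intro bounded_linear_Blinfun_apply bounded_linear_intro[where K = 1] ell2_eqI)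
    (auto simp: ell2_rep norm_emb_vec)

lemma coord_apply [simp]:
  fixes \<xi> :: "('x, 'h::chilbert_space) ell2"
  shows "blinfun_apply (coord x) \<xi> = Rep_ell2 \<xi> x"
proof -
  have "bounded_linear (\<lambda>\<xi> :: ('x, 'h) ell2. Rep_ell2 \<xi> x)"
    by (rule bounded_linear_intro[where K = 1]) (simp_all add: ell2_rep norm_Rep_ell2_le)
  then show ?thesis unfolding coord_def by (simp add: bounded_linear_Blinfun_apply)
qed

lemma Rep_ell2_sum: "Rep_ell2 (sum f I) x = (\<Sum>i\<in>I. Rep_ell2 (f i) x)"
  by (induction I rule: infinite_finite_induct) (simp_all add: ell2_rep)

lemma emb_vec_scaleC: "emb_vec x (c *\<^sub>C h) = c *\<^sub>C emb_vec x h"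
  by (rule ell2_eqI) (simp add: ell2_rep)

definition fin_vec :: "'x set \<Rightarrow> ('x \<Rightarrow> 'h::chilbert_space) \<Rightarrow> ('x, 'h) ell2" where
  "fin_vec F \<xi> = (\<Sum>x\<in>F. emb_vec x (\<xi> x))"

lemma Rep_fin_vec: "finite F \<Longrightarrow> Rep_ell2 (fin_vec F \<xi>) x = (if x \<in> F then \<xi> x else 0)"
  by (simp add: fin_vec_def Rep_ell2_sum emb_vec.rep_eq)

lemma cinner_fin_vec: "cinner (fin_vec F \<xi>) \<eta> = (\<Sum>x\<in>F. cinner (\<xi> x) (Rep_ell2 \<eta> x))"
  by (simp add: fin_vec_def cinner_sum_left cinner_emb_vec)

lemma norm_fin_vec_sq: "finite F \<Longrightarrow> (norm (fin_vec F \<xi>))\<^sup>2 = (\<Sum>x\<in>F. (norm (\<xi> x))\<^sup>2)"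
  by (simp add: Re_cinner_self[symmetric] cinner_fin_vec Rep_fin_vec cong: sum.cong)

lemma tendsto_fin_vec:
  "((\<lambda>F. fin_vec F (Rep_ell2 \<xi>)) \<longlongrightarrow> \<xi>) (finite_subsets_at_top UNIV)"
proof -
  have eq: "norm (fin_vec F (Rep_ell2 \<xi>) - \<xi>) = sqrt ((norm \<xi>)\<^sup>2 - (\<Sum>x\<in>F. (norm (Rep_ell2 \<xi> x))\<^sup>2))"
    if "finite F" for F
  proof -
    have "(norm (fin_vec F (Rep_ell2 \<xi>) - \<xi>))\<^sup>2 = (norm \<xi>)\<^sup>2 - (\<Sum>x\<in>F. (norm (Rep_ell2 \<xi> x))\<^sup>2)"
      unfolding norm_diff_sq norm_fin_vec_sq[OF that]
      by (simp add: cinner_fin_vec Re_cinner_self)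
    then show ?thesis by (metis real_sqrt_unique norm_ge_zero)
  qed
  have "((\<lambda>F. \<Sum>x\<in>F. (norm (Rep_ell2 \<xi> x))\<^sup>2) \<longlongrightarrow> (norm \<xi>)\<^sup>2) (finite_subsets_at_top UNIV)"
    unfolding norm_ell2_sq by (rule infsum_tendsto[OF ell2_summable])
  then have "((\<lambda>F. sqrt ((norm \<xi>)\<^sup>2 - (\<Sum>x\<in>F. (norm (Rep_ell2 \<xi> x))\<^sup>2))) \<longlongrightarrow> sqrt ((norm \<xi>)\<^sup>2 - (norm \<xi>)\<^sup>2))
      (finite_subsets_at_top UNIV)"
    by (intro tendsto_intros)
  then have "((\<lambda>F. norm (fin_vec F (Rep_ell2 \<xi>) - \<xi>)) \<longlongrightarrow> 0) (finite_subsets_at_top UNIV)"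
    by (simp, subst tendsto_cong[OF eventually_finite_subsets_at_top_weakI]) (auto simp: eq)
  then show ?thesis by (metis tendsto_norm_zero_iff LIM_zero_iff)
qed

lemma norm_fin_vec_Rep_le:
  assumes "finite F" shows "norm (fin_vec F (Rep_ell2 \<xi>)) \<le> norm \<xi>"
proof (rule power2_le_imp_le)
  show "(norm (fin_vec F (Rep_ell2 \<xi>)))\<^sup>2 \<le> (norm \<xi>)\<^sup>2"
    unfolding norm_fin_vec_sq[OF assms] norm_ell2_sq[of \<xi>]
    by (rule finite_sum_le_infsum[OF ell2_summable assms]) auto
qed simp

definition entry :: "(('x, 'h::chilbert_space) ell2 \<Rightarrow>\<^sub>L ('x, 'h) ell2) \<Rightarrow> 'x \<Rightarrow> 'x \<Rightarrow> 'h \<Rightarrow>\<^sub>L 'h" where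
  "entry T x y = coord x o\<^sub>L T o\<^sub>L emb y"

lemma entry_apply: "blinfun_apply (entry T x y) h = Rep_ell2 (blinfun_apply T (emb_vec y h)) x"
  by (simp add: entry_def)

lemma bounded_linear_entry: "bounded_linear (\<lambda>T. entry T x y)"
  unfolding entry_def
  by (rule bounded_linear_compose[of "\<lambda>S. S o\<^sub>L emb y" "\<lambda>T. coord x o\<^sub>L T"])
    (rule bounded_bilinear.bounded_linear_left[OF bounded_bilinear_blinfun_compose]
      bounded_bilinear.bounded_linear_right[OF bounded_bilinear_blinfun_compose])+

lemmas tendsto_entry = bounded_linear.tendsto[OF bounded_linear_entry]

lemma entry_add: "entry (S + T) x y = entry S x y + entry T x y"
  by (rule linear_add[OF bounded_linear.linear[OF bounded_linear_entry]])

lemma entry_diff: "entry (S - T) x y = entry S x y - entry T x y"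
  by (rule linear_diff[OF bounded_linear.linear[OF bounded_linear_entry]])

lemma entry_sum: "entry (sum f I) x y = (\<Sum>i\<in>I. entry (f i) x y)"
  by (rule linear_sum[OF bounded_linear.linear[OF bounded_linear_entry]])

lemma entry_scaleC: "entry (c *\<^sub>C T) x y = c *\<^sub>C entry T x y"
  by (rule blinfun_eqI) (simp add: entry_apply scaleC_blinfun.rep_eq ell2_rep)

lemma norm_entry_le: "norm (entry T x y) \<le> norm T"
proof (rule norm_blinfun_bound)
  fix h
  have "norm (blinfun_apply (entry T x y) h) \<le> norm (blinfun_apply T (emb_vec y h))"
    unfolding entry_apply by (rule norm_Rep_ell2_le)
  also have "\<dots> \<le> norm T * norm h" using norm_blinfun[of T "emb_vec y h"] by (simp add: norm_emb_vec)
  finally show "norm (blinfun_apply (entry T x y) h) \<le> norm T * norm h" .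
qed simp

lemma entry_BH: "T \<in> BH \<Longrightarrow> entry T x y \<in> BH"
  by (auto simp: BH_def entry_apply emb_vec_scaleC ell2_rep)

lemma cinner_entry:
  "cinner (blinfun_apply (entry T x y) h) k = cinner (blinfun_apply T (emb_vec y h)) (emb_vec x k)"
  using cinner_emb_vec[of x k "blinfun_apply T (emb_vec y h)"]
  by (metis cinner_commute entry_apply)

lemma cinner_fin_vec_entries:
  "cinner (blinfun_apply T (fin_vec F \<xi>)) (fin_vec F' \<eta>)
    = (\<Sum>x\<in>F'. \<Sum>y\<in>F. cinner (blinfun_apply (entry T x y) (\<xi> y)) (\<eta> x))"
  by (simp add: fin_vec_def blinfun.sum_right cinner_sum_left cinner_sum_right cinner_entry)

lemma tendsto_cinner_fin_vec:
  "((\<lambda>F. cinner (blinfun_apply T (fin_vec F (Rep_ell2 \<xi>))) (fin_vec F (Rep_ell2 \<eta>)))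
    \<longlongrightarrow> cinner (blinfun_apply T \<xi>) \<eta>) (finite_subsets_at_top UNIV)"
  by (intro tendsto_cinner blinfun.tendsto[OF tendsto_const] tendsto_fin_vec)

text \<open>
  Finitely supported vectors are dense, so that identities between operators can be verified entry
  by entry.
\<close>

lemma entry_eqI:
  assumes "\<And>x y. entry S x y = entry T x y" shows "S = T"
proof (rule blinfun_eqI, rule cinner_eqI)
  fix \<xi> \<eta>
  have "((\<lambda>F. cinner (blinfun_apply S (fin_vec F (Rep_ell2 \<xi>))) (fin_vec F (Rep_ell2 \<eta>)))
      \<longlongrightarrow> cinner (blinfun_apply T \<xi>) \<eta>) (finite_subsets_at_top UNIV)"
    using tendsto_cinner_fin_vec[of T \<xi> \<eta>] by (simp add: cinner_fin_vec_entries assms)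
  then show "cinner (blinfun_apply S \<xi>) \<eta> = cinner (blinfun_apply T \<xi>) \<eta>"
    by (rule tendsto_unique[OF finite_subsets_at_top_neq_bot tendsto_cinner_fin_vec])
qed

lemma norm_le_entries:
  assumes "0 \<le> K"
    and le: "\<And>F \<xi> \<eta>. finite F \<Longrightarrow> cmod (\<Sum>x\<in>F. \<Sum>y\<in>F. cinner (blinfun_apply (entry T x y) (Rep_ell2 \<xi> y)) (Rep_ell2 \<eta> x))
        \<le> K * norm \<xi> * norm \<eta>"
  shows "norm T \<le> K"
proof (rule norm_blinfun_bound[OF \<open>0 \<le> K\<close>], rule norm_le_cinnerI)
  fix \<xi> \<eta>
  show "cmod (cinner (blinfun_apply T \<xi>) \<eta>) \<le> K * norm \<xi> * norm \<eta>"
    by (rule tendsto_upperbound[OF tendsto_norm[OF tendsto_cinner_fin_vec] _ finite_subsets_at_top_neq_bot],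
        rule eventually_finite_subsets_at_top_weakI)
      (simp add: cinner_fin_vec_entries le)
qed (use \<open>0 \<le> K\<close> in simp)

section \<open>Finite matrices over a C*-algebra\<close>

definition fin_op :: "'x set \<Rightarrow> ('x \<Rightarrow> 'x \<Rightarrow> 'h::chilbert_space \<Rightarrow>\<^sub>L 'h) \<Rightarrow> ('x, 'h) ell2 \<Rightarrow>\<^sub>L ('x, 'h) ell2" where
  "fin_op F a = (\<Sum>x\<in>F. \<Sum>y\<in>F. emb x o\<^sub>L a x y o\<^sub>L coord y)"

lemma Rep_fin_op:
  assumes "finite F"
  shows "Rep_ell2 (blinfun_apply (fin_op F a) \<xi>) x
    = (if x \<in> F then \<Sum>y\<in>F. blinfun_apply (a x y) (Rep_ell2 \<xi> y) else 0)"
proof -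
  have "Rep_ell2 (blinfun_apply (fin_op F a) \<xi>) x
      = (\<Sum>z\<in>F. if z = x then \<Sum>y\<in>F. blinfun_apply (a z y) (Rep_ell2 \<xi> y) else 0)"
    unfolding fin_op_def blinfun.sum_left Rep_ell2_sum
    by (rule sum.cong) (auto simp: emb_vec.rep_eq)
  then show ?thesis using assms by simp
qed

lemma entry_fin_op:
  "finite F \<Longrightarrow> entry (fin_op F a) x y = (if x \<in> F \<and> y \<in> F then a x y else 0)"
  by (rule blinfun_eqI) (auto simp: entry_apply Rep_fin_op emb_vec.rep_eq if_distrib cong: if_cong)

lemma cinner_fin_op:
  assumes "finite F"
  shows "cinner (blinfun_apply (fin_op F a) \<xi>) \<eta>
    = (\<Sum>x\<in>F. \<Sum>y\<in>F. cinner (blinfun_apply (a x y) (Rep_ell2 \<xi> y)) (Rep_ell2 \<eta> x))"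
proof -
  have "blinfun_apply (fin_op F a) \<xi> = fin_vec F (\<lambda>x. \<Sum>y\<in>F. blinfun_apply (a x y) (Rep_ell2 \<xi> y))"
    by (rule ell2_eqI) (simp add: Rep_fin_op Rep_fin_vec assms)
  then show ?thesis by (simp add: cinner_fin_vec cinner_sum_left)
qed

lemma fin_op_cong: "(\<And>x y. x \<in> F \<Longrightarrow> y \<in> F \<Longrightarrow> a x y = b x y) \<Longrightarrow> fin_op F a = fin_op F b"
  unfolding fin_op_def by (intro sum.cong refl) simp

lemma tendsto_fin_op:
  assumes "\<And>x y. x \<in> F \<Longrightarrow> y \<in> F \<Longrightarrow> ((\<lambda>k. a k x y) \<longlongrightarrow> b x y) G"
  shows "((\<lambda>k. fin_op F (a k)) \<longlongrightarrow> fin_op F b) G"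
  unfolding fin_op_def
  by (intro tendsto_sum bounded_bilinear.tendsto[OF bounded_bilinear_blinfun_compose] tendsto_const assms)

text \<open>
  A copy of the algebra of matrices over \<open>A\<close> with index set \<open>F\<close>. Since it is cut out by conditions
  that are continuous in \<open>T\<close>, it is closed whenever \<open>A\<close> is.
\<close>

definition fin_alg :: "'x set \<Rightarrow> ('h::chilbert_space \<Rightarrow>\<^sub>L 'h) set \<Rightarrow> (('x, 'h) ell2 \<Rightarrow>\<^sub>L ('x, 'h) ell2) set" where
  "fin_alg F A = {T. (\<forall>x\<in>F. \<forall>y\<in>F. entry T x y \<in> A) \<and> fin_op F (entry T) = T}"

lemma fin_op_in_fin_alg:
  "finite F \<Longrightarrow> (\<And>x y. x \<in> F \<Longrightarrow> y \<in> F \<Longrightarrow> a x y \<in> A) \<Longrightarrow> fin_op F a \<in> fin_alg F A"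
  by (auto simp: fin_alg_def entry_fin_op intro!: fin_op_cong)

lemma fin_algE:
  assumes "T \<in> fin_alg F A"
  obtains a where "T = fin_op F a" "\<And>x y. x \<in> F \<Longrightarrow> y \<in> F \<Longrightarrow> a x y \<in> A"
  using assms by (auto simp: fin_alg_def) metis

lemma fin_op_add: "finite F \<Longrightarrow> fin_op F a + fin_op F b = fin_op F (\<lambda>x y. a x y + b x y)"
  by (rule entry_eqI) (auto simp: entry_add entry_fin_op)

lemma fin_op_scaleC: "finite F \<Longrightarrow> c *\<^sub>C fin_op F a = fin_op F (\<lambda>x y. c *\<^sub>C a x y)"
  by (rule entry_eqI) (auto simp: entry_scaleC entry_fin_op)

lemma fin_op_compose:
  assumes "finite F"
  shows "fin_op F a o\<^sub>L fin_op F b = fin_op F (\<lambda>x y. \<Sum>z\<in>F. a x z o\<^sub>L b z y)"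
  by (rule blinfun_eqI, rule ell2_eqI)
    (auto simp: Rep_fin_op assms blinfun.sum_left blinfun.sum_right intro: sum.swap)

lemma fin_op_BH: "finite F \<Longrightarrow> (\<And>x y. x \<in> F \<Longrightarrow> y \<in> F \<Longrightarrow> a x y \<in> BH) \<Longrightarrow> fin_op F a \<in> BH"
  by (auto simp: BH_def Rep_fin_op ell2_rep scaleC_sum_right intro!: ell2_eqI sum.cong)

lemma fin_op_adj:
  assumes F: "finite F" and a: "\<And>x y. x \<in> F \<Longrightarrow> y \<in> F \<Longrightarrow> a x y \<in> BH"
  shows "adj (fin_op F a) = fin_op F (\<lambda>x y. adj (a y x))"
proof (rule adj_eqI)
  fix \<xi> \<eta>
  have "cinner \<xi> (blinfun_apply (fin_op F (\<lambda>x y. adj (a y x))) \<eta>)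
      = cnj (\<Sum>x\<in>F. \<Sum>y\<in>F. cinner (blinfun_apply (adj (a y x)) (Rep_ell2 \<eta> y)) (Rep_ell2 \<xi> x))"
    by (subst cinner_commute) (simp add: cinner_fin_op[OF F])
  also have "\<dots> = (\<Sum>x\<in>F. \<Sum>y\<in>F. cinner (blinfun_apply (a y x) (Rep_ell2 \<xi> x)) (Rep_ell2 \<eta> y))"
    by (simp add: cinner_commute[symmetric] cinner_adj_right a cong: sum.cong)
  also have "\<dots> = cinner (blinfun_apply (fin_op F a) \<xi>) \<eta>"
    unfolding cinner_fin_op[OF F] by (rule sum.swap)
  finally show "cinner (blinfun_apply (fin_op F a) \<xi>) \<eta> = cinner \<xi> (blinfun_apply (fin_op F (\<lambda>x y. adj (a y x))) \<eta>)" ..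
qed

lemma cstar_algebra_fin_alg:
  assumes F: "finite F" and A: "cstar_algebra A"
  shows "cstar_algebra (fin_alg F A)"
proof -
  have "fin_alg F A \<subseteq> BH" by (auto elim!: fin_algE intro!: fin_op_BH[OF F] cstar_BH[OF A])
  moreover have "0 \<in> fin_alg F A"
    using fin_op_in_fin_alg[OF F, of "\<lambda>_ _. 0" A] cstar_zero[OF A] by (simp add: fin_op_def)
  moreover have "S + T \<in> fin_alg F A \<and> S o\<^sub>L T \<in> fin_alg F A" if S: "S \<in> fin_alg F A" and T: "T \<in> fin_alg F A" for S T
  proof -
    obtain a where a: "S = fin_op F a" "\<And>x y. x \<in> F \<Longrightarrow> y \<in> F \<Longrightarrow> a x y \<in> A" using S by (rule fin_algE) blast
    obtain b where b: "T = fin_op F b" "\<And>x y. x \<in> F \<Longrightarrow> y \<in> F \<Longrightarrow> b x y \<in> A" using T by (rule fin_algE) blast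
    show ?thesis unfolding a(1) b(1) fin_op_add[OF F] fin_op_compose[OF F]
      by (intro conjI fin_op_in_fin_alg[OF F] cstar_add[OF A] cstar_sum[OF A] cstar_compose[OF A] a b)
  qed
  moreover have "c *\<^sub>C T \<in> fin_alg F A" if "T \<in> fin_alg F A" for c T
    using that by (auto elim!: fin_algE simp: fin_op_scaleC[OF F] intro!: fin_op_in_fin_alg[OF F] cstar_scaleC[OF A])
  moreover have "adj T \<in> fin_alg F A" if "T \<in> fin_alg F A" for T
    using that by (auto elim!: fin_algE simp: fin_op_adj[OF F] cstar_BH[OF A]
        intro!: fin_op_in_fin_alg[OF F] cstar_adj[OF A])
  moreover have "closed (fin_alg F A)"
  proof -
    have "fin_alg F A = (\<Inter>x\<in>F. \<Inter>y\<in>F. (\<lambda>T. entry T x y) -` A) \<inter> {T. fin_op F (entry T) = T}"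
      by (auto simp: fin_alg_def)
    moreover have "closed ((\<lambda>T. entry T x y) -` A)" for x y
      by (intro continuous_closed_vimage cstar_closed[OF A]
          linear_continuous_at[OF bounded_linear_entry])
    moreover have "closed {T. fin_op F (entry T) = T}"
      unfolding fin_op_def
      by (intro closed_Collect_eq continuous_intros
          bounded_bilinear.continuous_on[OF bounded_bilinear_blinfun_compose]
          linear_continuous_on[OF bounded_linear_entry])
    ultimately show ?thesis by (auto intro!: closed_Int closed_INT)
  qed
  ultimately show ?thesis unfolding cstar_algebra_def by blast
qed

lemma clinear_on_sum:
  assumes "clinear_on A \<theta>" "cstar_algebra A" "\<And>i. i \<in> I \<Longrightarrow> f i \<in> A"
  shows "\<theta> (sum f I) = (\<Sum>i\<in>I. \<theta> (f i))"
  using assms(3)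
proof (induction I rule: infinite_finite_induct)
  case (insert i I)
  then have "sum f I \<in> A" "f i \<in> A" by (auto intro!: cstar_sum[OF assms(2)])
  then show ?case using insert assms(1) by (simp add: clinear_on_def)
qed (simp_all add: clinear_on_zero[OF assms(1) cstar_zero[OF assms(2)]])

text \<open>
  Through this homomorphism, contractivity and positivity of homomorphisms carry over to matrices
  of every size.
\<close>

lemma star_hom_amplify:
  assumes F: "finite F" and A: "cstar_algebra A" and \<sigma>: "star_hom A \<sigma>"
  shows "star_hom (fin_alg F A) (\<lambda>T. fin_op F (\<lambda>x y. \<sigma> (entry T x y)))" (is "star_hom _ ?S")
proof -
  have S: "?S (fin_op F a) = fin_op F (\<lambda>x y. \<sigma> (a x y))" for a
    by (rule fin_op_cong) (simp add: entry_fin_op[OF F])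
  note D = star_homD[OF \<sigma>]
  have cl: "clinear_on A \<sigma>" using \<sigma> by (simp add: star_hom_def)
  show ?thesis
    unfolding star_hom_def clinear_on_def
  proof (intro conjI ballI allI image_subsetI)
    fix T assume "T \<in> fin_alg F A"
    then obtain b where b: "T = fin_op F b" "\<And>x y. x \<in> F \<Longrightarrow> y \<in> F \<Longrightarrow> b x y \<in> A" by (rule fin_algE) blast
    show "?S T \<in> BH" unfolding b(1) S by (intro fin_op_BH[OF F] D(1) b(2))
    show "?S (c *\<^sub>C T) = c *\<^sub>C ?S T" for c
      unfolding b(1) fin_op_scaleC[OF F] S by (rule fin_op_cong) (simp add: D b)
    show "?S (adj T) = adj (?S T)"
      using b(2) by (simp add: b(1) S fin_op_adj[OF F] cstar_BH[OF A] D cong: fin_op_cong)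
    fix S' assume "S' \<in> fin_alg F A"
    then obtain a where a: "S' = fin_op F a" "\<And>x y. x \<in> F \<Longrightarrow> y \<in> F \<Longrightarrow> a x y \<in> A" by (rule fin_algE) blast
    show "?S (S' + T) = ?S S' + ?S T"
      unfolding a(1) b(1) fin_op_add[OF F] S by (rule fin_op_cong) (simp add: D a b)
    show "?S (S' o\<^sub>L T) = ?S S' o\<^sub>L ?S T"
      unfolding a(1) b(1) fin_op_compose[OF F] S
      by (rule fin_op_cong) (simp add: clinear_on_sum[OF cl A] D a b cstar_compose[OF A])
  qed
qed

lemma norm_fin_op_star_hom_le:
  assumes F: "finite F" and A: "cstar_algebra A" and \<sigma>: "star_hom A \<sigma>"
    and a: "\<And>x y. x \<in> F \<Longrightarrow> y \<in> F \<Longrightarrow> a x y \<in> A"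
  shows "norm (fin_op F (\<lambda>x y. \<sigma> (a x y))) \<le> norm (fin_op F a)"
proof -
  have "fin_op F (\<lambda>x y. \<sigma> (entry (fin_op F a) x y)) = fin_op F (\<lambda>x y. \<sigma> (a x y))"
    by (rule fin_op_cong) (simp add: entry_fin_op[OF F])
  then show ?thesis
    using star_hom_contractive[OF cstar_algebra_fin_alg[OF F A] star_hom_amplify[OF F A \<sigma>]
        fin_op_in_fin_alg[OF F, of a, OF a]]
    by simp
qed

lemma positive_fin_op_star_hom:
  assumes F: "finite F" and A: "cstar_algebra A" and \<sigma>: "star_hom A \<sigma>"
    and a: "\<And>x y. x \<in> F \<Longrightarrow> y \<in> F \<Longrightarrow> a x y \<in> A" and pos: "positive_op (fin_op F a)"
  shows "positive_op (fin_op F (\<lambda>x y. \<sigma> (a x y)))"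
proof -
  have "fin_op F (\<lambda>x y. \<sigma> (entry (fin_op F a) x y)) = fin_op F (\<lambda>x y. \<sigma> (a x y))"
    by (rule fin_op_cong) (simp add: entry_fin_op[OF F])
  then show ?thesis
    using star_hom_positive[OF cstar_algebra_fin_alg[OF F A] star_hom_amplify[OF F A \<sigma>]
        fin_op_in_fin_alg[OF F, of a, OF a] pos]
    by simp
qed

lemma norm_fin_op_apply:
  assumes "finite F"
  shows "norm (blinfun_apply (fin_op F T) \<xi>) = sqrt (\<Sum>i\<in>F. (norm (\<Sum>j\<in>F. blinfun_apply (T i j) (Rep_ell2 \<xi> j)))\<^sup>2)"
proof -
  have "blinfun_apply (fin_op F T) \<xi> = fin_vec F (\<lambda>x. \<Sum>y\<in>F. blinfun_apply (T x y) (Rep_ell2 \<xi> y))"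
    by (rule ell2_eqI) (simp add: Rep_fin_op Rep_fin_vec assms)
  then show ?thesis
    by (simp only: real_sqrt_unique[OF norm_fin_vec_sq[OF assms] norm_ge_zero])
qed

text \<open>
  Realising matrices as operators on \<open>\<ell>\<^sup>2(\<nat>, H)\<close> makes the facts about homomorphisms of
  C*-algebras available for \<open>mat_norm\<close> and \<open>mat_positive\<close>.
\<close>

lemma mat_norm_eq: "mat_norm n T = norm (fin_op {..<n} T)"
proof (rule antisym)
  let ?f = "\<lambda>\<xi>. sqrt (\<Sum>i<n. (norm (\<Sum>j<n. blinfun_apply (T i j) (\<xi> j)))\<^sup>2)"
  let ?S = "{?f \<xi> | \<xi>. (\<Sum>j<n. (norm (\<xi> j))\<^sup>2) \<le> 1}"
  have le: "s \<le> norm (fin_op {..<n} T)" if s: "s \<in> ?S" for s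
  proof -
    obtain \<xi> where \<xi>: "s = ?f \<xi>" "(\<Sum>j<n. (norm (\<xi> j))\<^sup>2) \<le> 1" using s by blast
    have "s = norm (blinfun_apply (fin_op {..<n} T) (fin_vec {..<n} \<xi>))"
      unfolding norm_fin_op_apply[OF finite_lessThan] \<xi>(1) Rep_fin_vec[OF finite_lessThan]
      by (intro arg_cong[where f = sqrt] sum.cong arg_cong[where f = "\<lambda>v. (norm v)\<^sup>2"] refl) auto
    also have "\<dots> \<le> norm (fin_op {..<n} T) * norm (fin_vec {..<n} \<xi>)" by (rule norm_blinfun)
    also have "\<dots> \<le> norm (fin_op {..<n} T) * 1"
    proof (rule mult_left_mono)
      show "norm (fin_vec {..<n} \<xi>) \<le> 1"
        by (rule power2_le_imp_le) (use \<xi>(2) in \<open>simp_all add: norm_fin_vec_sq\<close>)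
    qed simp
    finally show ?thesis by simp
  qed
  have zero: "0 \<in> ?S" by (auto intro!: exI[of _ "\<lambda>_. 0"])
  show "mat_norm n T \<le> norm (fin_op {..<n} T)"
    unfolding mat_norm_def using zero by (intro cSup_least le) auto
  have bdd: "bdd_above ?S" using le by (rule bdd_aboveI)
  have nonneg: "0 \<le> mat_norm n T" unfolding mat_norm_def by (rule cSup_upper[OF zero bdd])
  show "norm (fin_op {..<n} T) \<le> mat_norm n T"
  proof (rule norm_blinfun_bound[OF nonneg])
    fix \<xi> :: "(nat, 'a) ell2"
    show "norm (blinfun_apply (fin_op {..<n} T) \<xi>) \<le> mat_norm n T * norm \<xi>"
    proof (cases "\<xi> = 0")
      case False
      define \<eta> where "\<eta> = (1 / norm \<xi>) *\<^sub>R \<xi>"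
      have "norm \<eta> = 1" using False by (simp add: \<eta>_def)
      then have "(\<Sum>j<n. (norm (Rep_ell2 \<eta> j))\<^sup>2) \<le> 1"
        using norm_fin_vec_Rep_le[of "{..<n}" \<eta>] power_mono[of "norm (fin_vec {..<n} (Rep_ell2 \<eta>))" 1 2]
        by (simp add: norm_fin_vec_sq)
      then have "?f (Rep_ell2 \<eta>) \<le> mat_norm n T"
        unfolding mat_norm_def by (intro cSup_upper[OF _ bdd]) blast
      then have "norm (blinfun_apply (fin_op {..<n} T) \<eta>) \<le> mat_norm n T" by (simp add: norm_fin_op_apply)
      then show ?thesis using False by (simp add: \<eta>_def blinfun.scaleR_right field_simps)
    qed simp
  qed
qed

lemma mat_positive_eq: "mat_positive n T \<longleftrightarrow> positive_op (fin_op {..<n} T)"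
proof
  assume *: "mat_positive n T"
  show "positive_op (fin_op {..<n} T)"
    unfolding positive_op_def cinner_fin_op[OF finite_lessThan]
    by (intro allI) (rule *[unfolded mat_positive_def, THEN spec])
next
  assume *: "positive_op (fin_op {..<n} T)"
  show "mat_positive n T"
    unfolding mat_positive_def
  proof (intro allI)
    fix \<xi> :: "nat \<Rightarrow> 'a"
    have "(\<Sum>i<n. \<Sum>j<n. cinner (blinfun_apply (T i j) (\<xi> j)) (\<xi> i))
        = cinner (blinfun_apply (fin_op {..<n} T) (fin_vec {..<n} \<xi>)) (fin_vec {..<n} \<xi>)"
      unfolding cinner_fin_op[OF finite_lessThan] Rep_fin_vec[OF finite_lessThan] by (intro sum.cong) auto
    then show "(\<Sum>i<n. \<Sum>j<n. cinner (blinfun_apply (T i j) (\<xi> j)) (\<xi> i)) \<in> \<real>\<^sub>\<ge>\<^sub>0"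
      using * by (simp only: positive_op_def)
  qed
qed

lemma mat_norm_star_hom_le:
  assumes "cstar_algebra A" "star_hom A \<sigma>" "a \<in> mats n A"
  shows "mat_norm n (\<lambda>i j. \<sigma> (a i j)) \<le> mat_norm n a"
  unfolding mat_norm_eq
  by (rule norm_fin_op_star_hom_le[OF finite_lessThan assms(1,2), of n a]) (use assms(3) in \<open>simp add: mats_def\<close>)

lemma mat_positive_star_hom:
  assumes "cstar_algebra A" "star_hom A \<sigma>" "a \<in> mats n A" "mat_positive n a"
  shows "mat_positive n (\<lambda>i j. \<sigma> (a i j))"
  unfolding mat_positive_eq
proof (rule positive_fin_op_star_hom[OF finite_lessThan assms(1,2), of n a])
  show "positive_op (fin_op {..<n} a)" using assms(4) by (simp only: mat_positive_eq)
qed (use assms(3) in \<open>simp add: mats_def\<close>)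

lemma norm_le_quadratic:
  assumes K: "0 \<le> K"
    and le: "\<And>\<xi> \<eta>. 2 * cmod (cinner (blinfun_apply T \<xi>) \<eta>) \<le> K * ((norm \<xi>)\<^sup>2 + (norm \<eta>)\<^sup>2)"
  shows "norm T \<le> K"
proof (rule norm_blinfun_bound[OF K], rule norm_le_cinnerI)
  fix \<xi> \<eta>
  show "cmod (cinner (blinfun_apply T \<xi>) \<eta>) \<le> K * norm \<xi> * norm \<eta>"
  proof (cases "\<xi> = 0 \<or> \<eta> = 0")
    case False
    have "2 * cmod (cinner (blinfun_apply T ((1 / norm \<xi>) *\<^sub>R \<xi>)) ((1 / norm \<eta>) *\<^sub>R \<eta>)) \<le> K * (1 + 1)"
      using False le[of "(1 / norm \<xi>) *\<^sub>R \<xi>" "(1 / norm \<eta>) *\<^sub>R \<eta>"] by simp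
    then have "cmod (cinner (blinfun_apply T \<xi>) \<eta>) / (norm \<xi> * norm \<eta>) \<le> K"
      by (simp add: blinfun.scaleR_right cinner_scaleR_left cinner_scaleR_right norm_mult norm_divide mult.commute)
    then show ?thesis using False by (simp add: pos_divide_le_eq mult.assoc)
  qed auto
qed (use K in simp)

lemma quadratic_bound:
  "2 * cmod (cinner (blinfun_apply T \<xi>) \<eta>) \<le> norm T * ((norm \<xi>)\<^sup>2 + (norm (\<eta>::'h::chilbert_space))\<^sup>2)"
proof -
  have "cmod (cinner (blinfun_apply T \<xi>) \<eta>) \<le> norm (blinfun_apply T \<xi>) * norm \<eta>" by (rule cinner_Cauchy_Schwarz)
  also have "\<dots> \<le> (norm T * norm \<xi>) * norm \<eta>" by (intro mult_right_mono norm_blinfun) simp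
  finally have "2 * cmod (cinner (blinfun_apply T \<xi>) \<eta>) \<le> norm T * (2 * (norm \<xi> * norm \<eta>))" by simp
  also have "\<dots> \<le> norm T * ((norm \<xi>)\<^sup>2 + (norm \<eta>)\<^sup>2)"
    using sum_squares_bound[of "norm \<xi>" "norm \<eta>"] by (intro mult_left_mono) simp_all
  finally show ?thesis .
qed

lemma positive_fin_op_iff:
  fixes a :: "'i \<Rightarrow> 'i \<Rightarrow> 'h::chilbert_space \<Rightarrow>\<^sub>L 'h"
  assumes I: "finite I"
  shows "positive_op (fin_op I a) \<longleftrightarrow>
    (\<forall>\<xi>. (\<Sum>i\<in>I. \<Sum>j\<in>I. cinner (blinfun_apply (a i j) (\<xi> j)) (\<xi> i)) \<in> \<real>\<^sub>\<ge>\<^sub>0)"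
proof (intro iffI allI)
  fix \<xi> :: "'i \<Rightarrow> 'h"
  assume *: "positive_op (fin_op I a)"
  have "(\<Sum>i\<in>I. \<Sum>j\<in>I. cinner (blinfun_apply (a i j) (\<xi> j)) (\<xi> i))
      = cinner (blinfun_apply (fin_op I a) (fin_vec I \<xi>)) (fin_vec I \<xi>)"
    unfolding cinner_fin_op[OF I] Rep_fin_vec[OF I] by (intro sum.cong) auto
  then show "(\<Sum>i\<in>I. \<Sum>j\<in>I. cinner (blinfun_apply (a i j) (\<xi> j)) (\<xi> i)) \<in> \<real>\<^sub>\<ge>\<^sub>0"
    using * by (simp only: positive_op_def)
next
  assume *: "\<forall>\<xi>. (\<Sum>i\<in>I. \<Sum>j\<in>I. cinner (blinfun_apply (a i j) (\<xi> j)) (\<xi> i)) \<in> \<real>\<^sub>\<ge>\<^sub>0"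
  show "positive_op (fin_op I a)"
    unfolding positive_op_def cinner_fin_op[OF I] by (intro allI) (rule *[THEN spec])
qed

lemma sum_norm_Rep_le: "finite F \<Longrightarrow> (\<Sum>x\<in>F. (norm (Rep_ell2 \<xi> x))\<^sup>2) \<le> (norm \<xi>)\<^sup>2"
  unfolding norm_ell2_sq by (rule finite_sum_le_infsum[OF ell2_summable]) auto

lemma norm_fin_op_le:
  fixes a :: "'i \<Rightarrow> 'i \<Rightarrow> 'h::chilbert_space \<Rightarrow>\<^sub>L 'h"
  assumes I: "finite I" and K: "0 \<le> K"
    and le: "\<And>\<xi> \<eta>. 2 * cmod (\<Sum>i\<in>I. \<Sum>j\<in>I. cinner (blinfun_apply (a i j) (\<xi> j)) (\<eta> i))
      \<le> K * ((\<Sum>i\<in>I. (norm (\<xi> i))\<^sup>2) + (\<Sum>i\<in>I. (norm (\<eta> i))\<^sup>2))"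
  shows "norm (fin_op I a) \<le> K"
proof (rule norm_le_quadratic[OF K])
  fix \<xi> \<eta>
  have "2 * cmod (cinner (blinfun_apply (fin_op I a) \<xi>) \<eta>)
      \<le> K * ((\<Sum>i\<in>I. (norm (Rep_ell2 \<xi> i))\<^sup>2) + (\<Sum>i\<in>I. (norm (Rep_ell2 \<eta> i))\<^sup>2))"
    unfolding cinner_fin_op[OF I] by (rule le)
  also have "\<dots> \<le> K * ((norm \<xi>)\<^sup>2 + (norm \<eta>)\<^sup>2)"
    using K by (intro mult_left_mono add_mono sum_norm_Rep_le I)
  finally show "2 * cmod (cinner (blinfun_apply (fin_op I a) \<xi>) \<eta>) \<le> K * ((norm \<xi>)\<^sup>2 + (norm \<eta>)\<^sup>2)" .
qed

lemma fin_op_quadratic_bound: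
  fixes a :: "'i \<Rightarrow> 'i \<Rightarrow> 'h::chilbert_space \<Rightarrow>\<^sub>L 'h"
  assumes I: "finite I"
  shows "2 * cmod (\<Sum>i\<in>I. \<Sum>j\<in>I. cinner (blinfun_apply (a i j) (\<xi> j)) (\<eta> i))
      \<le> norm (fin_op I a) * ((\<Sum>i\<in>I. (norm (\<xi> i))\<^sup>2) + (\<Sum>i\<in>I. (norm (\<eta> i))\<^sup>2))"
proof -
  have "(\<Sum>i\<in>I. \<Sum>j\<in>I. cinner (blinfun_apply (a i j) (\<xi> j)) (\<eta> i))
      = cinner (blinfun_apply (fin_op I a) (fin_vec I \<xi>)) (fin_vec I \<eta>)"
    unfolding cinner_fin_op[OF I] Rep_fin_vec[OF I] by (intro sum.cong) auto
  then show ?thesis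
    using quadratic_bound[of "fin_op I a" "fin_vec I \<xi>" "fin_vec I \<eta>"] by (simp only: norm_fin_vec_sq[OF I])
qed

text \<open>
  The quadratic form of the conjugated matrix at \<open>\<xi>\<close> is that of \<open>S\<close> at the vectors \<open>W p (\<xi> p)\<close>.
  With \<open>emb\<close>, \<open>coord\<close> and \<open>shift_op\<close> in place of \<open>V\<close> and \<open>W\<close> this serves to cut matrices
  of operators down to entries, to fill in entries, and to translate them by group elements.
\<close>

lemma fin_op_conjugate:
  fixes S :: "'i \<Rightarrow> 'i \<Rightarrow> 'h::chilbert_space \<Rightarrow>\<^sub>L 'h" and W :: "'i \<Rightarrow> 'k::chilbert_space \<Rightarrow>\<^sub>L 'h"
  assumes N: "finite N" and adj: "\<And>p h k. cinner (blinfun_apply (V p) h) k = cinner h (blinfun_apply (W p) k)"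
    and W: "\<And>p k. norm (blinfun_apply (W p) k) \<le> norm k"
  shows "norm (fin_op N (\<lambda>p q. V p o\<^sub>L S p q o\<^sub>L W q)) \<le> norm (fin_op N S)"
    and "positive_op (fin_op N S) \<Longrightarrow> positive_op (fin_op N (\<lambda>p q. V p o\<^sub>L S p q o\<^sub>L W q))"
proof -
  show "norm (fin_op N (\<lambda>p q. V p o\<^sub>L S p q o\<^sub>L W q)) \<le> norm (fin_op N S)"
  proof (rule norm_fin_op_le[OF N norm_ge_zero])
    fix \<xi> \<eta> :: "'i \<Rightarrow> 'k"
    have "2 * cmod (\<Sum>p\<in>N. \<Sum>q\<in>N. cinner (blinfun_apply (V p o\<^sub>L S p q o\<^sub>L W q) (\<xi> q)) (\<eta> p))
        \<le> norm (fin_op N S) * ((\<Sum>p\<in>N. (norm (blinfun_apply (W p) (\<xi> p)))\<^sup>2) + (\<Sum>p\<in>N. (norm (blinfun_apply (W p) (\<eta> p)))\<^sup>2))"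
      unfolding blinfun_apply_blinfun_compose adj by (rule fin_op_quadratic_bound[OF N])
    also have "\<dots> \<le> norm (fin_op N S) * ((\<Sum>p\<in>N. (norm (\<xi> p))\<^sup>2) + (\<Sum>p\<in>N. (norm (\<eta> p))\<^sup>2))"
      by (intro mult_left_mono add_mono sum_mono power_mono W) simp_all
    finally show "2 * cmod (\<Sum>p\<in>N. \<Sum>q\<in>N. cinner (blinfun_apply (V p o\<^sub>L S p q o\<^sub>L W q) (\<xi> q)) (\<eta> p))
        \<le> norm (fin_op N S) * ((\<Sum>p\<in>N. (norm (\<xi> p))\<^sup>2) + (\<Sum>p\<in>N. (norm (\<eta> p))\<^sup>2))" .
  qed
  assume pos: "positive_op (fin_op N S)"
  show "positive_op (fin_op N (\<lambda>p q. V p o\<^sub>L S p q o\<^sub>L W q))"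
    unfolding positive_fin_op_iff[OF N] blinfun_apply_blinfun_compose adj
  proof (intro allI)
    fix \<xi>
    show "(\<Sum>p\<in>N. \<Sum>q\<in>N. cinner (blinfun_apply (S p q) (blinfun_apply (W q) (\<xi> q))) (blinfun_apply (W p) (\<xi> p))) \<in> \<real>\<^sub>\<ge>\<^sub>0"
      using pos[unfolded positive_fin_op_iff[OF N], THEN spec, of "\<lambda>q. blinfun_apply (W q) (\<xi> q)"] .
  qed
qed

lemma cinner_coord_emb:
  "cinner (blinfun_apply (emb x) h) k = cinner h (blinfun_apply (coord x) k)"
  "cinner (blinfun_apply (coord x) k) h = cinner k (blinfun_apply (emb x) h)"
proof -
  show *: "cinner (blinfun_apply (emb x) h) k = cinner h (blinfun_apply (coord x) k)" by (simp add: cinner_emb_vec)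
  show "cinner (blinfun_apply (coord x) k) h = cinner k (blinfun_apply (emb x) h)"
    using * by (metis cinner_commute)
qed

section \<open>Completely bounded maps\<close>

lemma mat_norm_nonneg: "0 \<le> mat_norm n T" by (simp add: mat_norm_eq)

lemma mat_norm_scaleR: "mat_norm n (\<lambda>i j. r *\<^sub>R T i j) = \<bar>r\<bar> * mat_norm n T"
proof -
  have "fin_op {..<n} (\<lambda>i j. r *\<^sub>R T i j) = r *\<^sub>R fin_op {..<n} T"
    by (simp add: scaleR_scaleC fin_op_scaleC)
  then show ?thesis by (simp add: mat_norm_eq)
qed

lemma mat_norm_cong: "(\<And>i j. i < n \<Longrightarrow> j < n \<Longrightarrow> S i j = T i j) \<Longrightarrow> mat_norm n S = mat_norm n T"
  unfolding mat_norm_eq by (rule arg_cong[where f = norm], rule fin_op_cong) simp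

lemma mat_norm_1: "mat_norm (Suc 0) (\<lambda>_ _. b) = norm b"
proof (rule antisym)
  have eq: "fin_op {..<Suc 0} (\<lambda>_ _. b) = emb 0 o\<^sub>L b o\<^sub>L coord 0" by (simp add: fin_op_def)
  show "mat_norm (Suc 0) (\<lambda>_ _. b) \<le> norm b"
    unfolding mat_norm_eq eq
  proof (rule norm_blinfun_bound)
    fix \<xi>
    have "norm (blinfun_apply (emb 0 o\<^sub>L b o\<^sub>L coord 0) \<xi>) \<le> norm b * norm (Rep_ell2 \<xi> 0)"
      by (simp add: norm_emb_vec norm_blinfun)
    also have "\<dots> \<le> norm b * norm \<xi>" by (intro mult_left_mono norm_Rep_ell2_le) simp
    finally show "norm (blinfun_apply (emb 0 o\<^sub>L b o\<^sub>L coord 0) \<xi>) \<le> norm b * norm \<xi>" .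
  qed simp
  show "norm b \<le> mat_norm (Suc 0) (\<lambda>_ _. b)"
    using norm_entry_le[of "fin_op {..<Suc 0} (\<lambda>_ _. b)" 0 0] by (simp add: mat_norm_eq entry_fin_op)
qed

lemma completely_bounded_bound:
  assumes "completely_bounded V \<phi>"
  obtains C where "0 \<le> C" "\<And>n T. T \<in> mats n V \<Longrightarrow> mat_norm n (\<lambda>i j. \<phi> (T i j)) \<le> C * mat_norm n T"
    "\<And>T. T \<in> V \<Longrightarrow> norm (\<phi> T) \<le> C * norm T"
proof -
  obtain C where C: "\<And>n T. T \<in> mats n V \<Longrightarrow> mat_norm n (\<lambda>i j. \<phi> (T i j)) \<le> C * mat_norm n T"
    using assms unfolding completely_bounded_def by blast
  have C': "mat_norm n (\<lambda>i j. \<phi> (T i j)) \<le> max C 0 * mat_norm n T" if "T \<in> mats n V" for n T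
    using C[OF that] mult_right_mono[OF max.cobounded1[of C 0] mat_norm_nonneg[of n T]] by linarith
  have "norm (\<phi> T) \<le> max C 0 * norm T" if "T \<in> V" for T
    using C'[of "\<lambda>_ _. T" "Suc 0"] that by (simp add: mats_def mat_norm_1)
  then show thesis using that[of "max C 0"] C' by simp
qed

lemma bdd_above_cb_norm:
  assumes "completely_bounded V \<phi>"
  shows "bdd_above {mat_norm n (\<lambda>i j. \<phi> (T i j)) | n T. T \<in> mats n V \<and> mat_norm n T \<le> 1}"
proof -
  obtain C where C: "0 \<le> C" "\<And>n T. T \<in> mats n V \<Longrightarrow> mat_norm n (\<lambda>i j. \<phi> (T i j)) \<le> C * mat_norm n T"
    by (rule completely_bounded_bound[OF assms]) blast
  show ?thesis
  proof (rule bdd_aboveI[where M = C], clarify)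
    fix n T assume "T \<in> mats n V" "mat_norm n T \<le> 1"
    then show "mat_norm n (\<lambda>i j. \<phi> (T i j)) \<le> C"
      using C(2)[of T n] mult_left_mono[OF _ C(1), of "mat_norm n T" 1] by simp
  qed
qed

lemma mat_norm_le_cb_norm:
  assumes "completely_bounded V \<phi>" and T: "T \<in> mats n V"
    and hom: "\<And>r T. T \<in> V \<Longrightarrow> r *\<^sub>R T \<in> V \<and> \<phi> (r *\<^sub>R T) = r *\<^sub>R \<phi> T"
  shows "mat_norm n (\<lambda>i j. \<phi> (T i j)) \<le> cb_norm V \<phi> * mat_norm n T"
proof (cases "mat_norm n T = 0")
  case True
  obtain C where C: "0 \<le> C" "\<And>n T. T \<in> mats n V \<Longrightarrow> mat_norm n (\<lambda>i j. \<phi> (T i j)) \<le> C * mat_norm n T"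
    by (rule completely_bounded_bound[OF assms(1)]) blast
  show ?thesis using C(2)[OF T] True by simp
next
  case False
  define r where "r = 1 / mat_norm n T"
  have r: "0 < r" using False mat_norm_nonneg[of n T] by (simp add: r_def)
  have "(\<lambda>i j. r *\<^sub>R T i j) \<in> mats n V" using T hom by (simp add: mats_def)
  moreover have "mat_norm n (\<lambda>i j. r *\<^sub>R T i j) \<le> 1" using r False by (simp add: mat_norm_scaleR) (simp add: r_def)
  ultimately have "mat_norm n (\<lambda>i j. \<phi> (r *\<^sub>R T i j))
      \<in> {mat_norm n (\<lambda>i j. \<phi> (T i j)) | n T. T \<in> mats n V \<and> mat_norm n T \<le> 1}"
    by (intro CollectI exI[of _ n] exI[of _ "\<lambda>i j. r *\<^sub>R T i j"]) simp
  then have "mat_norm n (\<lambda>i j. \<phi> (r *\<^sub>R T i j)) \<le> cb_norm V \<phi>"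
    unfolding cb_norm_def by (rule cSup_upper[OF _ bdd_above_cb_norm[OF assms(1)]])
  moreover have "mat_norm n (\<lambda>i j. \<phi> (r *\<^sub>R T i j)) = mat_norm n (\<lambda>i j. r *\<^sub>R \<phi> (T i j))"
    by (rule mat_norm_cong) (use T hom in \<open>simp add: mats_def\<close>)
  ultimately have "mat_norm n (\<lambda>i j. \<phi> (T i j)) / mat_norm n T \<le> cb_norm V \<phi>"
    using r by (simp add: mat_norm_scaleR) (simp add: r_def)
  then show ?thesis using False mat_norm_nonneg[of n T] by (simp add: pos_divide_le_eq less_le)
qed

lemma cb_norm_le:
  assumes K: "0 \<le> K" and le: "\<And>n T. T \<in> mats n V \<Longrightarrow> mat_norm n (\<lambda>i j. \<phi> (T i j)) \<le> K * mat_norm n T"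
  shows "cb_norm V \<phi> \<le> K" "completely_bounded V \<phi>"
proof -
  let ?S = "{mat_norm n (\<lambda>i j. \<phi> (T i j)) | n T. T \<in> mats n V \<and> mat_norm n T \<le> 1}"
  show "cb_norm V \<phi> \<le> K"
    unfolding cb_norm_def
  proof (rule cSup_least)
    have "mat_norm 0 (\<lambda>i j. \<phi> 0) \<in> ?S"
      by (intro CollectI exI[of _ 0] exI[of _ "\<lambda>_ _. 0"]) (simp add: mats_def mat_norm_eq fin_op_def)
    then show "?S \<noteq> {}" by blast
    fix s assume "s \<in> ?S"
    then obtain n T where s: "s = mat_norm n (\<lambda>i j. \<phi> (T i j))" "T \<in> mats n V" "mat_norm n T \<le> 1" by blast
    then show "s \<le> K" using le[OF s(2)] mult_left_mono[OF s(3) K] by simp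
  qed
  show "completely_bounded V \<phi>" unfolding completely_bounded_def using le by blast
qed

lemma CB_D:
  assumes "\<phi> \<in> CB V W"
  shows "clinear_on V \<phi>" "completely_bounded V \<phi>" "T \<in> V \<Longrightarrow> \<phi> T \<in> W"
  using assms by (auto simp: CB_def)

lemma clinear_on_scaleR: "clinear_on V \<phi> \<Longrightarrow> T \<in> V \<Longrightarrow> \<phi> (r *\<^sub>R T) = r *\<^sub>R \<phi> T"
  by (simp add: clinear_on_def scaleR_scaleC)

lemma norm_le_cb_norm:
  assumes "\<phi> \<in> CB V W" "T \<in> V" and V: "\<And>r T. T \<in> V \<Longrightarrow> r *\<^sub>R T \<in> V"
  shows "norm (\<phi> T) \<le> cb_norm V \<phi> * norm T"
  using mat_norm_le_cb_norm[OF CB_D(2)[OF assms(1)], of "\<lambda>_ _. T" "Suc 0"] assms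
  by (simp add: mats_def mat_norm_1 clinear_on_scaleR[OF CB_D(1)[OF assms(1)]])

lemma cb_norm_nonneg:
  assumes "completely_bounded V \<phi>" shows "0 \<le> cb_norm V \<phi>"
proof -
  have "mat_norm 0 (\<lambda>i j. \<phi> 0) \<in> {mat_norm n (\<lambda>i j. \<phi> (T i j)) | n T. T \<in> mats n V \<and> mat_norm n T \<le> 1}"
    by (intro CollectI exI[of _ 0] exI[of _ "\<lambda>_ _. 0"]) (simp add: mats_def mat_norm_eq fin_op_def)
  from cSup_upper[OF this bdd_above_cb_norm[OF assms]] show ?thesis
    unfolding cb_norm_def using mat_norm_nonneg order_trans by blast
qed

section \<open>Kernels of positive type\<close>

lemma bounded_CB_family_CB: "bounded_CB_family A W (case_prod \<phi>) \<Longrightarrow> \<phi> x y \<in> CB A W"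
  by (auto simp: bounded_CB_family_def image_subset_iff)

lemma positive_type_CB: "positive_type A \<phi> \<Longrightarrow> \<phi> x y \<in> CB A BH"
  by (rule bounded_CB_family_CB) (simp add: positive_type_def)

lemma positive_typeD:
  "positive_type A \<phi> \<Longrightarrow> a \<in> mats m A \<Longrightarrow> mat_positive m a \<Longrightarrow> mat_positive m (\<lambda>p q. \<phi> (x p) (x q) (a p q))"
  by (simp add: positive_type_def)

text \<open>
  Arbitrary finite index sets make room for the two-by-two block matrices and the matrices indexed
  by pairs that are needed below.
\<close>

lemma positive_type_finite:
  fixes x :: "'i \<Rightarrow> 'x" and A :: "('h::chilbert_space \<Rightarrow>\<^sub>L 'h) set"
  assumes \<phi>: "positive_type A \<phi>" and I: "finite I"
    and a: "\<And>i j. i \<in> I \<Longrightarrow> j \<in> I \<Longrightarrow> a i j \<in> A" and pos: "positive_op (fin_op I a)"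
  shows "positive_op (fin_op I (\<lambda>i j. \<phi> (x i) (x j) (a i j)))"
proof -
  obtain g where g: "bij_betw g {..<card I} I"
    using ex_bij_betw_nat_finite[OF I] by (auto simp: lessThan_atLeast0)
  have gI: "g p \<in> I" if "p < card I" for p using bij_betwE[OF g] that by simp
  have sums: "(\<Sum>p<card I. \<Sum>q<card I. f (g p) (g q)) = (\<Sum>i\<in>I. \<Sum>j\<in>I. f i j)" for f :: "'i \<Rightarrow> 'i \<Rightarrow> complex"
    by (simp add: sum.reindex_bij_betw[OF g] sum.reindex_bij_betw[OF g, of "\<lambda>i. \<Sum>j\<in>I. f i j"])
  have "mat_positive (card I) (\<lambda>p q. a (g p) (g q))"
    unfolding mat_positive_def
  proof (intro allI)
    fix \<xi> :: "nat \<Rightarrow> 'h"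
    define \<eta> where "\<eta> i = \<xi> (inv_into {..<card I} g i)" for i
    have "\<eta> (g p) = \<xi> p" if "p < card I" for p
      unfolding \<eta>_def using that g by (simp add: bij_betw_def inv_into_f_f)
    then have "(\<Sum>p<card I. \<Sum>q<card I. cinner (blinfun_apply (a (g p) (g q)) (\<xi> q)) (\<xi> p))
        = (\<Sum>p<card I. \<Sum>q<card I. cinner (blinfun_apply (a (g p) (g q)) (\<eta> (g q))) (\<eta> (g p)))"
      by (intro sum.cong) auto
    also have "\<dots> \<in> \<real>\<^sub>\<ge>\<^sub>0"
      unfolding sums[of "\<lambda>i j. cinner (blinfun_apply (a i j) (\<eta> j)) (\<eta> i)"]
      using pos by (simp only: positive_fin_op_iff[OF I])
    finally show "(\<Sum>p<card I. \<Sum>q<card I. cinner (blinfun_apply (a (g p) (g q)) (\<xi> q)) (\<xi> p)) \<in> \<real>\<^sub>\<ge>\<^sub>0" .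
  qed
  moreover have "(\<lambda>p q. a (g p) (g q)) \<in> mats (card I) A" by (simp add: mats_def a gI)
  ultimately have *: "mat_positive (card I) (\<lambda>p q. \<phi> (x (g p)) (x (g q)) (a (g p) (g q)))"
    by (rule positive_typeD[OF \<phi>, of "\<lambda>p q. a (g p) (g q)" "card I" "\<lambda>p. x (g p)", rotated])
  show ?thesis
    unfolding positive_fin_op_iff[OF I]
  proof (intro allI)
    fix \<xi> :: "'i \<Rightarrow> 'h"
    show "(\<Sum>i\<in>I. \<Sum>j\<in>I. cinner (blinfun_apply (\<phi> (x i) (x j) (a i j)) (\<xi> j)) (\<xi> i)) \<in> \<real>\<^sub>\<ge>\<^sub>0"
      unfolding sums[of "\<lambda>i j. cinner (blinfun_apply (\<phi> (x i) (x j) (a i j)) (\<xi> j)) (\<xi> i)", symmetric]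
      by (rule *[unfolded mat_positive_def, THEN spec, of "\<lambda>p. \<xi> (g p)"])
  qed
qed

text \<open>
  Without a unit in \<open>A\<close> one cannot pass from a contraction \<open>a\<close> to the positive matrix with
  rows \<open>(1, a)\<close> and \<open>(a\<^sup>*, 1)\<close>; cutting down by a hermitian contraction \<open>e \<in> A\<close> gives rows
  \<open>(e\<^sup>2, eae)\<close> and \<open>(ea\<^sup>*e, e\<^sup>2)\<close>. The multiplier preserves its positivity, so the
  image of \<open>eae\<close> is dominated by the image of the diagonal matrix \<open>e\<^sup>2\<close>.
\<close>

lemma schur_compressed_bound:
  fixes a :: "'i \<Rightarrow> 'i \<Rightarrow> 'h::chilbert_space \<Rightarrow>\<^sub>L 'h"
  assumes A: "cstar_algebra A" and \<phi>: "positive_type A \<phi>" and I: "finite I"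
    and a: "\<And>i j. i \<in> I \<Longrightarrow> j \<in> I \<Longrightarrow> a i j \<in> A"
    and C: "0 \<le> C" and diag: "\<And>i b. i \<in> I \<Longrightarrow> b \<in> A \<Longrightarrow> norm (\<phi> (x i) (x i) b) \<le> C * norm b"
    and e: "e \<in> A" "hermitian e" "norm e \<le> 1"
  shows "norm (fin_op I (\<lambda>i j. \<phi> (x i) (x j) (e o\<^sub>L a i j o\<^sub>L e))) \<le> C * norm (fin_op I a)"
proof -
  define K where "K = norm (fin_op I a)"
  have K: "0 \<le> K" by (simp add: K_def)
  define d where "d = K *\<^sub>R (e o\<^sub>L e)"
  define R where "R p q = (case p of
      Inl i \<Rightarrow> (case q of Inl j \<Rightarrow> if i = j then d else 0 | Inr j \<Rightarrow> e o\<^sub>L a i j o\<^sub>L e)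
    | Inr i \<Rightarrow> (case q of Inl j \<Rightarrow> e o\<^sub>L adj (a j i) o\<^sub>L e | Inr j \<Rightarrow> if i = j then d else 0))"
    for p q :: "'i + 'i"
  define y where "y = case_sum x x"
  define J where "J = I <+> I"
  have J: "finite J" by (simp add: J_def I)
  have sumJ: "(\<Sum>p\<in>J. \<Sum>q\<in>J. f p q) = (\<Sum>i\<in>I. \<Sum>j\<in>I. f (Inl i) (Inl j)) + (\<Sum>i\<in>I. \<Sum>j\<in>I. f (Inl i) (Inr j))
      + (\<Sum>i\<in>I. \<Sum>j\<in>I. f (Inr i) (Inl j)) + (\<Sum>i\<in>I. \<Sum>j\<in>I. f (Inr i) (Inr j))" for f :: "'i + 'i \<Rightarrow> 'i + 'i \<Rightarrow> complex"
    by (simp add: J_def sum.Plus[OF I I] sum.distrib)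
  have dA: "d \<in> A" unfolding d_def by (intro cstar_scaleR[OF A] cstar_compose[OF A] e)
  have RA: "R p q \<in> A" if "p \<in> J" "q \<in> J" for p q
    using that by (auto simp: J_def R_def dA cstar_zero[OF A] intro!: cstar_compose[OF A] cstar_adj[OF A] e a)
  have "positive_op (fin_op J R)"
    unfolding positive_fin_op_iff[OF J]
  proof (intro allI)
    fix \<xi> :: "'i + 'i \<Rightarrow> 'h"
    define u where "u i = blinfun_apply e (\<xi> (Inl i))" for i
    define w where "w i = blinfun_apply e (\<xi> (Inr i))" for i
    define Z where "Z = (\<Sum>i\<in>I. \<Sum>j\<in>I. cinner (blinfun_apply (a i j) (w j)) (u i))"
    have diagsum: "(\<Sum>i\<in>I. \<Sum>j\<in>I. cinner (blinfun_apply (if i = j then d else 0) (v j)) (v i))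
        = complex_of_real (K * (\<Sum>i\<in>I. (norm (blinfun_apply e (v i)))\<^sup>2))" for v :: "'i \<Rightarrow> 'h"
    proof -
      have "(\<Sum>j\<in>I. cinner (blinfun_apply (if i = j then d else 0) (v j)) (v i))
          = complex_of_real (K * (norm (blinfun_apply e (v i)))\<^sup>2)" if "i \<in> I" for i
      proof -
        have "(\<Sum>j\<in>I. cinner (blinfun_apply (if i = j then d else 0) (v j)) (v i))
            = (\<Sum>j\<in>I. if i = j then cinner (blinfun_apply d (v i)) (v i) else 0)"
          by (rule sum.cong) auto
        also have "\<dots> = cinner (blinfun_apply d (v i)) (v i)" using that I by simp
        also have "\<dots> = complex_of_real (K * (norm (blinfun_apply e (v i)))\<^sup>2)"
          by (simp add: d_def blinfun.scaleR_left cinner_scaleR_left hermitianD[OF e(2), of "blinfun_apply e (v i)"] cinner_norm)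
        finally show ?thesis .
      qed
      then show ?thesis by (simp add: sum_distrib_left)
    qed
    have T12: "(\<Sum>i\<in>I. \<Sum>j\<in>I. cinner (blinfun_apply (e o\<^sub>L a i j o\<^sub>L e) (\<xi> (Inr j))) (\<xi> (Inl i))) = Z"
      unfolding Z_def u_def w_def blinfun_apply_blinfun_compose by (intro sum.cong refl hermitianD[OF e(2)])
    have "(\<Sum>i\<in>I. \<Sum>j\<in>I. cinner (blinfun_apply (e o\<^sub>L adj (a j i) o\<^sub>L e) (\<xi> (Inl j))) (\<xi> (Inr i)))
        = (\<Sum>i\<in>I. \<Sum>j\<in>I. cnj (cinner (blinfun_apply (a j i) (w i)) (u j)))"
    proof (intro sum.cong refl)
      fix i j assume "i \<in> I" "j \<in> I"
      then have "a j i \<in> BH" using a cstar_BH[OF A] by blast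
      then have "cinner (blinfun_apply (adj (a j i)) (u j)) (w i) = cinner (u j) (blinfun_apply (a j i) (w i))"
        by (rule cinner_adj_left)
      then show "cinner (blinfun_apply (e o\<^sub>L adj (a j i) o\<^sub>L e) (\<xi> (Inl j))) (\<xi> (Inr i))
          = cnj (cinner (blinfun_apply (a j i) (w i)) (u j))"
        unfolding blinfun_apply_blinfun_compose hermitianD[OF e(2), of "blinfun_apply (adj (a j i)) _"]
        using cinner_commute by (simp add: u_def w_def)
    qed
    also have "\<dots> = cnj Z" unfolding Z_def cnj_sum by (rule sum.swap)
    finally have T21: "(\<Sum>i\<in>I. \<Sum>j\<in>I. cinner (blinfun_apply (e o\<^sub>L adj (a j i) o\<^sub>L e) (\<xi> (Inl j))) (\<xi> (Inr i))) = cnj Z" .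
    have "(\<Sum>p\<in>J. \<Sum>q\<in>J. cinner (blinfun_apply (R p q) (\<xi> q)) (\<xi> p))
        = complex_of_real (K * (\<Sum>i\<in>I. (norm (u i))\<^sup>2)) + Z + cnj Z + complex_of_real (K * (\<Sum>i\<in>I. (norm (w i))\<^sup>2))"
      unfolding sumJ R_def sum.case diagsum[of "\<lambda>i. \<xi> (Inl i)"] diagsum[of "\<lambda>i. \<xi> (Inr i)"] T12 T21 u_def w_def ..
    moreover have "2 * cmod Z \<le> K * ((\<Sum>i\<in>I. (norm (w i))\<^sup>2) + (\<Sum>i\<in>I. (norm (u i))\<^sup>2))"
      unfolding Z_def K_def by (rule fin_op_quadratic_bound[OF I])
    moreover have "- cmod Z \<le> Re Z" using abs_Re_le_cmod[of Z] by linarith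
    ultimately show "(\<Sum>p\<in>J. \<Sum>q\<in>J. cinner (blinfun_apply (R p q) (\<xi> q)) (\<xi> p)) \<in> \<real>\<^sub>\<ge>\<^sub>0"
      by (simp add: complex_nonneg_Reals_iff ring_distribs del: of_real_mult)
  qed
  then have pos: "positive_op (fin_op J (\<lambda>p q. \<phi> (y p) (y q) (R p q)))"
    by (intro positive_type_finite[OF \<phi> J RA])
  define \<theta> where "\<theta> i j = \<phi> (x i) (x j)" for i j
  have \<theta>CB: "\<theta> i j \<in> CB A BH" for i j unfolding \<theta>_def by (rule positive_type_CB[OF \<phi>])
  have \<theta>0: "\<theta> i j 0 = 0" for i j by (rule clinear_on_zero[OF CB_D(1)[OF \<theta>CB] cstar_zero[OF A]])
  have \<theta>B: "\<theta> i j b \<in> BH" if "b \<in> A" for i j b by (rule CB_D(3)[OF \<theta>CB that])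
  define P where "P v = (\<Sum>i\<in>I. cinner (blinfun_apply (\<theta> i i d) (v i)) (v i))" for v :: "'i \<Rightarrow> 'h"
  define B where "B u w = (\<Sum>i\<in>I. \<Sum>j\<in>I. cinner (blinfun_apply (\<theta> i j (e o\<^sub>L a i j o\<^sub>L e)) (w j)) (u i))"
    for u w :: "'i \<Rightarrow> 'h"
  define B' where "B' u w = (\<Sum>i\<in>I. \<Sum>j\<in>I. cinner (blinfun_apply (\<theta> i j (e o\<^sub>L adj (a j i) o\<^sub>L e)) (u j)) (w i))"
    for u w :: "'i \<Rightarrow> 'h"
  have form: "P u + B u w + B' u w + P w \<in> \<real>\<^sub>\<ge>\<^sub>0" for u w
  proof -
    have diagsum: "(\<Sum>i\<in>I. \<Sum>j\<in>I. cinner (blinfun_apply (\<theta> i j (if i = j then d else 0)) (v j)) (v i)) = P v" for v :: "'i \<Rightarrow> 'h"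
      unfolding P_def
    proof (rule sum.cong[OF refl])
      fix i assume "i \<in> I"
      have "(\<Sum>j\<in>I. cinner (blinfun_apply (\<theta> i j (if i = j then d else 0)) (v j)) (v i))
          = (\<Sum>j\<in>I. if i = j then cinner (blinfun_apply (\<theta> i i d) (v i)) (v i) else 0)"
        by (rule sum.cong) (auto simp: \<theta>0)
      then show "(\<Sum>j\<in>I. cinner (blinfun_apply (\<theta> i j (if i = j then d else 0)) (v j)) (v i))
          = cinner (blinfun_apply (\<theta> i i d) (v i)) (v i)" using \<open>i \<in> I\<close> I by simp
    qed
    have "(\<Sum>p\<in>J. \<Sum>q\<in>J. cinner (blinfun_apply (\<phi> (y p) (y q) (R p q)) (case_sum u w q)) (case_sum u w p))
        = P u + B u w + B' u w + P w"
      unfolding sumJ R_def y_def sum.case \<theta>_def[symmetric] diagsum B_def B'_def ..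
    then show ?thesis using pos[unfolded positive_fin_op_iff[OF J], THEN spec, of "case_sum u w"] by simp
  qed
  have P_nonneg: "P u \<in> \<real>\<^sub>\<ge>\<^sub>0" for u
    using form[of u "\<lambda>_. 0"] by (simp add: B_def B'_def P_def)
  have P_le: "Re (P u) \<le> C * K * (\<Sum>i\<in>I. (norm (u i))\<^sup>2)" for u
  proof -
    have "norm d \<le> K"
    proof -
      have "norm (e o\<^sub>L e) \<le> 1" using norm_blinfun_compose[of e e] e(3) mult_le_one[OF e(3) norm_ge_zero e(3)] by linarith
      then show ?thesis using K mult_left_mono[of "norm (e o\<^sub>L e)" 1 K] by (simp add: d_def)
    qed
    then have n: "norm (\<theta> i i d) \<le> C * K" if "i \<in> I" for i
      unfolding \<theta>_def using diag[OF that dA] mult_left_mono[of "norm d" K C] C by simp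
    have "Re (P u) = (\<Sum>i\<in>I. Re (cinner (blinfun_apply (\<theta> i i d) (u i)) (u i)))" by (simp add: P_def)
    also have "\<dots> \<le> (\<Sum>i\<in>I. C * K * (norm (u i))\<^sup>2)"
    proof (rule sum_mono)
      fix i assume i: "i \<in> I"
      have "Re (cinner (blinfun_apply (\<theta> i i d) (u i)) (u i)) \<le> norm (blinfun_apply (\<theta> i i d) (u i)) * norm (u i)"
        by (rule Re_cinner_le)
      also have "\<dots> \<le> (norm (\<theta> i i d) * norm (u i)) * norm (u i)" by (intro mult_right_mono norm_blinfun) simp
      also have "\<dots> \<le> (C * K * norm (u i)) * norm (u i)" by (intro mult_right_mono n i) simp_all
      finally show "Re (cinner (blinfun_apply (\<theta> i i d) (u i)) (u i)) \<le> C * K * (norm (u i))\<^sup>2"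
        by (simp add: power2_eq_square mult.assoc)
    qed
    finally show ?thesis by (simp add: sum_distrib_left)
  qed
  have eaeA: "e o\<^sub>L b o\<^sub>L e \<in> A" if "b \<in> A" for b by (intro cstar_compose[OF A] e that)
  have B_scale: "B u (\<lambda>i. c *\<^sub>C w i) = c * B u w" for c u w
    unfolding B_def sum_distrib_left
    by (intro sum.cong refl) (simp add: BH_scaleC[OF \<theta>B[OF eaeA[OF a]]] cinner_scaleC_left)
  have B'_scale: "B' u (\<lambda>i. c *\<^sub>C w i) = cnj c * B' u w" for c u w
    unfolding B'_def sum_distrib_left by (intro sum.cong refl) (simp add: cinner_scaleC_right)
  \<comment> \<open>the form is real for \<open>w\<close> replaced by \<open>c w\<close>; take \<open>c = 1\<close> and \<open>c = \<i>\<close>\<close>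
  have herm: "B' u w = cnj (B u w)" for u w
  proof (rule complex_eqI)
    have im: "Im (c * B u w + cnj c * B' u w) = 0" for c
      using form[of u "\<lambda>i. c *\<^sub>C w i"] P_nonneg[of u] P_nonneg[of "\<lambda>i. c *\<^sub>C w i"]
      by (simp add: complex_nonneg_Reals_iff B_scale B'_scale)
    show "Im (B' u w) = Im (cnj (B u w))" using im[of 1] by simp
    show "Re (B' u w) = Re (cnj (B u w))" using im[of \<i>] by simp
  qed
  show ?thesis
  proof (rule norm_fin_op_le[OF I])
    show "0 \<le> C * norm (fin_op I a)" using C by simp
    fix w u :: "'i \<Rightarrow> 'h"
    \<comment> \<open>turn \<open>w\<close> by a phase that makes the off-diagonal part of the form as negative as possible\<close>
    obtain c where c: "cmod c = 1" "c * B u w = complex_of_real (cmod (B u w))" using exists_phase by blast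
    have "0 \<le> Re (P u) + Re ((- c) * B u w) + Re (cnj (- c) * cnj (B u w)) + Re (P (\<lambda>i. (- c) *\<^sub>C w i))"
      using form[of u "\<lambda>i. (- c) *\<^sub>C w i"] by (simp add: complex_nonneg_Reals_iff B_scale B'_scale herm)
    moreover have "Re ((- c) * B u w) = - cmod (B u w)" using c(2) by simp
    moreover have "Re (cnj (- c) * cnj (B u w)) = Re ((- c) * B u w)"
      by simp
    ultimately have "2 * cmod (B u w) \<le> Re (P u) + Re (P (\<lambda>i. (- c) *\<^sub>C w i))" by linarith
    also have "\<dots> \<le> C * K * (\<Sum>i\<in>I. (norm (u i))\<^sup>2) + C * K * (\<Sum>i\<in>I. (norm ((- c) *\<^sub>C w i))\<^sup>2)"
      by (intro add_mono P_le)
    also have "\<dots> = C * K * ((\<Sum>i\<in>I. (norm (w i))\<^sup>2) + (\<Sum>i\<in>I. (norm (u i))\<^sup>2))"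
      by (simp add: norm_scaleC c(1) ring_distribs)
    finally show "2 * cmod (\<Sum>i\<in>I. \<Sum>j\<in>I. cinner (blinfun_apply (\<phi> (x i) (x j) (e o\<^sub>L a i j o\<^sub>L e)) (w j)) (u i))
        \<le> C * norm (fin_op I a) * ((\<Sum>i\<in>I. (norm (w i))\<^sup>2) + (\<Sum>i\<in>I. (norm (u i))\<^sup>2))"
      by (simp add: B_def \<theta>_def K_def)
  qed
qed

lemma tendsto_CB:
  assumes \<phi>: "\<phi> \<in> CB A W" and A: "\<And>k. f k \<in> A" "b \<in> A" "\<And>k. f k - b \<in> A" "- b \<in> A" and lim: "(f \<longlongrightarrow> b) G"
  shows "((\<lambda>k. \<phi> (f k)) \<longlongrightarrow> \<phi> b) G"
proof -
  obtain C where C: "0 \<le> C" "\<And>T. T \<in> A \<Longrightarrow> norm (\<phi> T) \<le> C * norm T"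
    by (rule completely_bounded_bound[OF CB_D(2)[OF \<phi>]]) blast
  have le: "norm (\<phi> (f k) - \<phi> b) \<le> C * norm (f k - b)" for k
    using C(2)[OF A(3)] clinear_on_diff[OF CB_D(1)[OF \<phi>] A(1,2,4)] by metis
  have "((\<lambda>k. C * norm (f k - b)) \<longlongrightarrow> 0) G"
    using tendsto_mult[OF tendsto_const tendsto_norm_zero[OF LIM_zero[OF lim]], of C] by simp
  from Lim_null_comparison[OF always_eventually[OF allI[OF le]] this]
  show ?thesis by (rule LIM_zero_cancel)
qed

text \<open>
  Letting \<open>e\<close> run through an approximate unit removes the compression, because each \<open>\<phi> x y\<close> is
  continuous.
\<close>

lemma schur_finite_norm:
  fixes a :: "'i \<Rightarrow> 'i \<Rightarrow> 'h::chilbert_space \<Rightarrow>\<^sub>L 'h"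
  assumes A: "cstar_algebra A" and \<phi>: "positive_type A \<phi>" and I: "finite I"
    and a: "\<And>i j. i \<in> I \<Longrightarrow> j \<in> I \<Longrightarrow> a i j \<in> A"
    and C: "0 \<le> C" and diag: "\<And>i b. i \<in> I \<Longrightarrow> b \<in> A \<Longrightarrow> norm (\<phi> (x i) (x i) b) \<le> C * norm b"
  shows "norm (fin_op I (\<lambda>i j. \<phi> (x i) (x j) (a i j))) \<le> C * norm (fin_op I a)"
proof -
  have "finite (case_prod a ` (I \<times> I))" "case_prod a ` (I \<times> I) \<subseteq> A" using I a by auto
  from approximate_unit[OF A this] obtain e where eA: "\<And>k. e k \<in> A" and eh: "\<And>k. hermitian (e k)"
    and e1: "\<And>k. norm (e k) \<le> 1" and lim: "\<And>b. b \<in> case_prod a ` (I \<times> I) \<Longrightarrow> (\<lambda>k. e k o\<^sub>L b o\<^sub>L e k) \<longlonglongrightarrow> b"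
    by blast
  have "(\<lambda>k. fin_op I (\<lambda>i j. \<phi> (x i) (x j) (e k o\<^sub>L a i j o\<^sub>L e k))) \<longlonglongrightarrow> fin_op I (\<lambda>i j. \<phi> (x i) (x j) (a i j))"
  proof (rule tendsto_fin_op)
    fix i j assume ij: "i \<in> I" "j \<in> I"
    have A1: "e k o\<^sub>L a i j o\<^sub>L e k \<in> A" for k by (intro cstar_compose[OF A] eA a ij)
    show "(\<lambda>k. \<phi> (x i) (x j) (e k o\<^sub>L a i j o\<^sub>L e k)) \<longlonglongrightarrow> \<phi> (x i) (x j) (a i j)"
      by (rule tendsto_CB[OF positive_type_CB[OF \<phi>]]) (use ij A1 a in \<open>auto intro!: lim cstar_diff[OF A] cstar_minus[OF A]\<close>)
  qed
  from tendsto_norm[OF this] show ?thesis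
    by (rule LIMSEQ_le_const2)
      (intro exI allI impI schur_compressed_bound[OF A \<phi> I a C diag eA eh e1], assumption+)
qed

section \<open>Maps acting entrywise by a kernel of positive type\<close>

text \<open>
  A matrix of operators on \<open>\<ell>\<^sup>2(X, H)\<close>, seen as a matrix over \<open>B(H)\<close> with rows and columns
  indexed by \<open>\<nat> \<times> X\<close>. Its norm and its positivity are decided on finite sets of indices.
\<close>

definition block_entry ::
  "(nat \<Rightarrow> nat \<Rightarrow> ('x, 'h::chilbert_space) ell2 \<Rightarrow>\<^sub>L ('x, 'h) ell2) \<Rightarrow> nat \<times> 'x \<Rightarrow> nat \<times> 'x \<Rightarrow> 'h \<Rightarrow>\<^sub>L 'h" where
  "block_entry S p q = entry (S (fst p) (fst q)) (snd p) (snd q)"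

lemma sum_Times: "(\<Sum>p\<in>N \<times> F. g p) = (\<Sum>i\<in>N. \<Sum>x\<in>F. g (i, x))"
  by (simp add: sum.cartesian_product)

lemma block_entry_form:
  "(\<Sum>i\<in>N. \<Sum>j\<in>N. cinner (blinfun_apply (S i j) (fin_vec F (\<xi> j))) (fin_vec F (\<eta> i)))
    = (\<Sum>p\<in>N \<times> F. \<Sum>q\<in>N \<times> F. cinner (blinfun_apply (block_entry S p q) (\<xi> (fst q) (snd q))) (\<eta> (fst p) (snd p)))"
proof -
  have "(\<Sum>i\<in>N. \<Sum>j\<in>N. cinner (blinfun_apply (S i j) (fin_vec F (\<xi> j))) (fin_vec F (\<eta> i)))
      = (\<Sum>i\<in>N. \<Sum>j\<in>N. \<Sum>x\<in>F. \<Sum>y\<in>F. cinner (blinfun_apply (entry (S i j) x y) (\<xi> j y)) (\<eta> i x))"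
    by (simp only: cinner_fin_vec_entries)
  also have "\<dots> = (\<Sum>i\<in>N. \<Sum>x\<in>F. \<Sum>j\<in>N. \<Sum>y\<in>F. cinner (blinfun_apply (entry (S i j) x y) (\<xi> j y)) (\<eta> i x))"
    by (intro sum.cong refl sum.swap)
  also have "\<dots> = (\<Sum>p\<in>N \<times> F. \<Sum>q\<in>N \<times> F. cinner (blinfun_apply (block_entry S p q) (\<xi> (fst q) (snd q))) (\<eta> (fst p) (snd p)))"
    by (simp add: sum_Times block_entry_def)
  finally show ?thesis .
qed

lemma tendsto_matrix_form:
  "((\<lambda>F. \<Sum>i\<in>N. \<Sum>j\<in>N. cinner (blinfun_apply (S i j) (fin_vec F (Rep_ell2 (\<xi> j)))) (fin_vec F (Rep_ell2 (\<eta> i))))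
    \<longlongrightarrow> (\<Sum>i\<in>N. \<Sum>j\<in>N. cinner (blinfun_apply (S i j) (\<xi> j)) (\<eta> i))) (finite_subsets_at_top UNIV)"
  by (intro tendsto_sum tendsto_cinner blinfun.tendsto[OF tendsto_const] tendsto_fin_vec)

lemma mat_positive_iff_blocks:
  "mat_positive n S \<longleftrightarrow> (\<forall>F. finite F \<longrightarrow> positive_op (fin_op ({..<n} \<times> F) (block_entry S)))"
proof (intro iffI allI impI)
  fix F :: "'a set" assume S: "mat_positive n S" and F: "finite F"
  show "positive_op (fin_op ({..<n} \<times> F) (block_entry S))"
    unfolding positive_fin_op_iff[OF finite_cartesian_product[OF finite_lessThan F]]
  proof (intro allI)
    fix \<xi> :: "nat \<times> 'a \<Rightarrow> 'b"
    show "(\<Sum>p\<in>{..<n} \<times> F. \<Sum>q\<in>{..<n} \<times> F. cinner (blinfun_apply (block_entry S p q) (\<xi> q)) (\<xi> p)) \<in> \<real>\<^sub>\<ge>\<^sub>0"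
      using S[unfolded mat_positive_def, THEN spec, of "\<lambda>i. fin_vec F (\<lambda>x. \<xi> (i, x))"]
      unfolding block_entry_form[of S F "\<lambda>i x. \<xi> (i, x)" "\<lambda>i x. \<xi> (i, x)"] by simp
  qed
next
  assume *: "\<forall>F. finite F \<longrightarrow> positive_op (fin_op ({..<n} \<times> F) (block_entry S))"
  show "mat_positive n S"
    unfolding mat_positive_def
  proof (intro allI)
    fix \<xi> :: "nat \<Rightarrow> ('a, 'b) ell2"
    have "(\<Sum>i<n. \<Sum>j<n. cinner (blinfun_apply (S i j) (fin_vec F (Rep_ell2 (\<xi> j)))) (fin_vec F (Rep_ell2 (\<xi> i)))) \<in> \<real>\<^sub>\<ge>\<^sub>0"
      if F: "finite F" for F
      unfolding block_entry_form
      using *[rule_format, OF F, unfolded positive_fin_op_iff[OF finite_cartesian_product[OF finite_lessThan F]],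
          THEN spec, of "\<lambda>p. Rep_ell2 (\<xi> (fst p)) (snd p)"] .
    then have ev: "\<forall>\<^sub>F F in finite_subsets_at_top UNIV.
        (\<Sum>i<n. \<Sum>j<n. cinner (blinfun_apply (S i j) (fin_vec F (Rep_ell2 (\<xi> j)))) (fin_vec F (Rep_ell2 (\<xi> i)))) \<in> \<real>\<^sub>\<ge>\<^sub>0"
      by (intro eventually_finite_subsets_at_top_weakI)
    show "(\<Sum>i<n. \<Sum>j<n. cinner (blinfun_apply (S i j) (\<xi> j)) (\<xi> i)) \<in> \<real>\<^sub>\<ge>\<^sub>0"
      by (rule Lim_in_closed_set[OF closed_nonneg_Reals_complex ev finite_subsets_at_top_neq_bot tendsto_matrix_form])
  qed
qed

lemma norm_block_le:
  assumes F: "finite F"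
  shows "norm (fin_op ({..<n} \<times> F) (block_entry S)) \<le> mat_norm n S"
proof (rule norm_fin_op_le[OF finite_cartesian_product[OF finite_lessThan F] mat_norm_nonneg])
  fix \<xi> \<eta> :: "nat \<times> 'a \<Rightarrow> 'b"
  let ?J = "{..<n} \<times> F"
  have sums: "(\<Sum>i<n. (norm (fin_vec F (\<lambda>x. v (i, x))))\<^sup>2) = (\<Sum>p\<in>?J. (norm (v p))\<^sup>2)" for v :: "nat \<times> 'a \<Rightarrow> 'b"
    by (simp add: norm_fin_vec_sq[OF F] sum.cartesian_product)
  have "(\<Sum>p\<in>?J. \<Sum>q\<in>?J. cinner (blinfun_apply (block_entry S p q) (\<xi> q)) (\<eta> p))
      = (\<Sum>i<n. \<Sum>j<n. cinner (blinfun_apply (S i j) (fin_vec F (\<lambda>x. \<xi> (j, x)))) (fin_vec F (\<lambda>x. \<eta> (i, x))))"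
    unfolding block_entry_form[of S F "\<lambda>i x. \<xi> (i, x)" "\<lambda>i x. \<eta> (i, x)"] by simp
  then show "2 * cmod (\<Sum>p\<in>?J. \<Sum>q\<in>?J. cinner (blinfun_apply (block_entry S p q) (\<xi> q)) (\<eta> p))
      \<le> mat_norm n S * ((\<Sum>p\<in>?J. (norm (\<xi> p))\<^sup>2) + (\<Sum>p\<in>?J. (norm (\<eta> p))\<^sup>2))"
    using fin_op_quadratic_bound[OF finite_lessThan[of n],
        where a = S and \<xi> = "\<lambda>j. fin_vec F (\<lambda>x. \<xi> (j, x))" and \<eta> = "\<lambda>j. fin_vec F (\<lambda>x. \<eta> (j, x))"]
    by (simp only: mat_norm_eq sums)
qed

lemma mat_norm_le_blocks:
  assumes K: "0 \<le> K" and le: "\<And>F. finite F \<Longrightarrow> norm (fin_op ({..<n} \<times> F) (block_entry S)) \<le> K"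
  shows "mat_norm n S \<le> K"
  unfolding mat_norm_eq
proof (rule norm_fin_op_le[OF finite_lessThan K])
  fix \<xi> \<eta> :: "nat \<Rightarrow> ('a, 'b) ell2"
  let ?B = "K * ((\<Sum>i<n. (norm (\<xi> i))\<^sup>2) + (\<Sum>i<n. (norm (\<eta> i))\<^sup>2))"
  have "2 * cmod (\<Sum>i<n. \<Sum>j<n. cinner (blinfun_apply (S i j) (fin_vec F (Rep_ell2 (\<xi> j)))) (fin_vec F (Rep_ell2 (\<eta> i)))) \<le> ?B"
    if F: "finite F" for F
  proof -
    have le_sum: "(\<Sum>p\<in>{..<n} \<times> F. (norm (Rep_ell2 (v (fst p)) (snd p)))\<^sup>2) \<le> (\<Sum>i<n. (norm (v i))\<^sup>2)"
      for v :: "nat \<Rightarrow> ('a, 'b) ell2"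
    proof -
      have "(\<Sum>p\<in>{..<n} \<times> F. (norm (Rep_ell2 (v (fst p)) (snd p)))\<^sup>2) = (\<Sum>i<n. \<Sum>x\<in>F. (norm (Rep_ell2 (v i) x))\<^sup>2)"
        by (simp add: sum_Times)
      also have "\<dots> \<le> (\<Sum>i<n. (norm (v i))\<^sup>2)" by (intro sum_mono sum_norm_Rep_le F)
      finally show ?thesis .
    qed
    have "2 * cmod (\<Sum>i<n. \<Sum>j<n. cinner (blinfun_apply (S i j) (fin_vec F (Rep_ell2 (\<xi> j)))) (fin_vec F (Rep_ell2 (\<eta> i))))
        \<le> norm (fin_op ({..<n} \<times> F) (block_entry S)) *
          ((\<Sum>p\<in>{..<n} \<times> F. (norm (Rep_ell2 (\<xi> (fst p)) (snd p)))\<^sup>2) + (\<Sum>p\<in>{..<n} \<times> F. (norm (Rep_ell2 (\<eta> (fst p)) (snd p)))\<^sup>2))"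
      unfolding block_entry_form by (rule fin_op_quadratic_bound[OF finite_cartesian_product[OF finite_lessThan F]])
    also have "\<dots> \<le> ?B"
      by (intro mult_mono le[OF F] add_mono le_sum K add_nonneg_nonneg sum_nonneg) simp_all
    finally show ?thesis .
  qed
  then have ev: "\<forall>\<^sub>F F in finite_subsets_at_top UNIV.
      2 * cmod (\<Sum>i<n. \<Sum>j<n. cinner (blinfun_apply (S i j) (fin_vec F (Rep_ell2 (\<xi> j)))) (fin_vec F (Rep_ell2 (\<eta> i)))) \<le> ?B"
    by (intro eventually_finite_subsets_at_top_weakI)
  show "2 * cmod (\<Sum>i<n. \<Sum>j<n. cinner (blinfun_apply (S i j) (\<xi> j)) (\<eta> i)) \<le> ?B"
    by (rule tendsto_upperbound[OF tendsto_mult[OF tendsto_const tendsto_norm[OF tendsto_matrix_form]] ev finite_subsets_at_top_neq_bot])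
qed

text \<open>
  Both the Herz-Schur map and the Schur map act on matrix entries by the same kernel, and this
  is all that complete positivity and the bound on the norm depend on.
\<close>

definition acts_entrywise ::
  "('h::chilbert_space \<Rightarrow>\<^sub>L 'h) set \<Rightarrow> ('x \<Rightarrow> 'x \<Rightarrow> ('h \<Rightarrow>\<^sub>L 'h) \<Rightarrow> 'h \<Rightarrow>\<^sub>L 'h)
    \<Rightarrow> (('x, 'h) ell2 \<Rightarrow>\<^sub>L ('x, 'h) ell2) set
    \<Rightarrow> ((('x, 'h) ell2 \<Rightarrow>\<^sub>L ('x, 'h) ell2) \<Rightarrow> ('x, 'h) ell2 \<Rightarrow>\<^sub>L ('x, 'h) ell2) \<Rightarrow> bool" where
  "acts_entrywise A \<phi> V \<psi> \<longleftrightarrow>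
     (\<forall>T\<in>V. \<forall>x y. entry T x y \<in> A \<and> entry (\<psi> T) x y = \<phi> x y (entry T x y))"

lemma acts_entrywise_positive:
  assumes \<phi>: "positive_type A \<phi>" and \<psi>: "acts_entrywise A \<phi> V \<psi>"
    and T: "T \<in> mats n V" "mat_positive n T"
  shows "mat_positive n (\<lambda>i j. \<psi> (T i j))"
  unfolding mat_positive_iff_blocks
proof (intro allI impI)
  fix F :: "'b set" assume F: "finite F"
  let ?J = "{..<n} \<times> F"
  have J: "finite ?J" using F by simp
  have V: "T (fst p) (fst q) \<in> V" if "p \<in> ?J" "q \<in> ?J" for p q using T(1) that by (auto simp: mats_def)
  have "positive_op (fin_op ?J (\<lambda>p q. \<phi> (snd p) (snd q) (block_entry T p q)))"
  proof (rule positive_type_finite[OF \<phi> J])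
    show "block_entry T p q \<in> A" if "p \<in> ?J" "q \<in> ?J" for p q
      using \<psi> V[OF that] by (simp add: block_entry_def acts_entrywise_def)
    show "positive_op (fin_op ?J (block_entry T))" using T(2) F by (simp add: mat_positive_iff_blocks)
  qed
  moreover have "fin_op ?J (block_entry (\<lambda>i j. \<psi> (T i j))) = fin_op ?J (\<lambda>p q. \<phi> (snd p) (snd q) (block_entry T p q))"
    by (rule fin_op_cong) (use \<psi> V in \<open>simp add: block_entry_def acts_entrywise_def\<close>)
  ultimately show "positive_op (fin_op ?J (block_entry (\<lambda>i j. \<psi> (T i j))))" by (simp only:)
qed

lemma acts_entrywise_norm:
  assumes A: "cstar_algebra A" and \<phi>: "positive_type A \<phi>" and \<psi>: "acts_entrywise A \<phi> V \<psi>"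
    and C: "0 \<le> C" and diag: "\<And>x b. b \<in> A \<Longrightarrow> norm (\<phi> x x b) \<le> C * norm b"
    and T: "T \<in> mats n V"
  shows "mat_norm n (\<lambda>i j. \<psi> (T i j)) \<le> C * mat_norm n T"
proof (rule mat_norm_le_blocks)
  show "0 \<le> C * mat_norm n T" by (intro mult_nonneg_nonneg C mat_norm_nonneg)
  fix F :: "'b set" assume F: "finite F"
  let ?J = "{..<n} \<times> F"
  have J: "finite ?J" using F by simp
  have V: "T (fst p) (fst q) \<in> V" if "p \<in> ?J" "q \<in> ?J" for p q using T that by (auto simp: mats_def)
  have "fin_op ?J (block_entry (\<lambda>i j. \<psi> (T i j))) = fin_op ?J (\<lambda>p q. \<phi> (snd p) (snd q) (block_entry T p q))"
    by (rule fin_op_cong) (use \<psi> V in \<open>simp add: block_entry_def acts_entrywise_def\<close>)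
  also have "norm \<dots> \<le> C * norm (fin_op ?J (block_entry T))"
    by (rule schur_finite_norm[OF A \<phi> J _ C diag])
      (use \<psi> V in \<open>simp_all add: block_entry_def acts_entrywise_def\<close>)
  also have "\<dots> \<le> C * mat_norm n T" by (intro mult_left_mono norm_block_le F C)
  finally show "norm (fin_op ?J (block_entry (\<lambda>i j. \<psi> (T i j)))) \<le> C * mat_norm n T" .
qed

text \<open>
  Conversely, cutting the positive matrix \<open>\<psi>(T\<^sub>p\<^sub>q)\<close> down to its entries at \<open>(x p, x q)\<close> leaves
  the matrix whose positivity is asked for, as soon as some positive \<open>T\<close> over \<open>V\<close> carries the
  given matrix \<open>a\<close> at these places.
\<close>

lemma positive_typeI_entrywise:
  assumes fam: "bounded_CB_family A BH (case_prod \<phi>)" and \<psi>: "acts_entrywise A \<phi> V \<psi>"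
    and cp: "completely_positive V \<psi>"
    and lift: "\<And>m x a. a \<in> mats m A \<Longrightarrow> mat_positive m a \<Longrightarrow>
      \<exists>T\<in>mats m V. mat_positive m T \<and> (\<forall>p<m. \<forall>q<m. entry (T p q) (x p) (x q) = a p q)"
  shows "positive_type A \<phi>"
  unfolding positive_type_def
proof (intro conjI fam allI ballI impI)
  fix m x a assume "a \<in> mats m A" "mat_positive m a"
  then obtain T where T: "T \<in> mats m V" "mat_positive m T" and ent: "\<And>p q. p < m \<Longrightarrow> q < m \<Longrightarrow> entry (T p q) (x p) (x q) = a p q"
    using lift[of a m x] by blast
  have "mat_positive m (\<lambda>p q. \<psi> (T p q))" using cp T unfolding completely_positive_def by blast
  then have "positive_op (fin_op {..<m} (\<lambda>p q. coord (x p) o\<^sub>L \<psi> (T p q) o\<^sub>L emb (x q)))"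
    unfolding mat_positive_eq
    by (intro fin_op_conjugate(2) cinner_coord_emb) (simp_all add: norm_emb_vec)
  moreover have "fin_op {..<m} (\<lambda>p q. coord (x p) o\<^sub>L \<psi> (T p q) o\<^sub>L emb (x q)) = fin_op {..<m} (\<lambda>p q. \<phi> (x p) (x q) (a p q))"
    by (rule fin_op_cong) (use \<psi> T(1) ent in \<open>simp add: entry_def[symmetric] acts_entrywise_def mats_def\<close>)
  ultimately show "mat_positive m (\<lambda>p q. \<phi> (x p) (x q) (a p q))" by (simp add: mat_positive_eq)
qed

text \<open>The same compression at a single point recovers \<open>\<phi> x x\<close> from \<open>\<psi>\<close>, hence bounds its norm.\<close>

lemma cb_norm_le_entrywise:
  assumes \<psi>: "acts_entrywise A \<phi> V \<psi>" and cb: "completely_bounded V \<psi>"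
    and lift: "\<And>n a. a \<in> mats n A \<Longrightarrow> \<exists>T\<in>mats n V. mat_norm n T \<le> mat_norm n a \<and> (\<forall>p<n. \<forall>q<n. entry (T p q) x x = a p q)"
  shows "cb_norm A (\<phi> x x) \<le> cb_norm V \<psi>"
  unfolding cb_norm_def[of A]
proof (rule cSup_least)
  let ?S = "{mat_norm n (\<lambda>i j. \<phi> x x (T i j)) | n T. T \<in> mats n A \<and> mat_norm n T \<le> 1}"
  have "mat_norm 0 (\<lambda>i j. \<phi> x x 0) \<in> ?S"
    by (intro CollectI exI[of _ 0] exI[of _ "\<lambda>_ _. 0"]) (simp add: mats_def mat_norm_eq fin_op_def)
  then show "?S \<noteq> {}" by blast
  fix s assume "s \<in> ?S"
  then obtain n a where s: "s = mat_norm n (\<lambda>i j. \<phi> x x (a i j))" "a \<in> mats n A" "mat_norm n a \<le> 1" by blast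
  obtain T where T: "T \<in> mats n V" "mat_norm n T \<le> mat_norm n a" "\<And>p q. p < n \<Longrightarrow> q < n \<Longrightarrow> entry (T p q) x x = a p q"
    using lift[OF s(2)] by blast
  have "s = norm (fin_op {..<n} (\<lambda>p q. coord x o\<^sub>L \<psi> (T p q) o\<^sub>L emb x))"
    unfolding s(1) mat_norm_eq
    by (rule arg_cong[where f = norm], rule fin_op_cong)
      (use \<psi> T(1,3) in \<open>simp add: entry_def[symmetric] acts_entrywise_def mats_def\<close>)
  also have "\<dots> \<le> mat_norm n (\<lambda>p q. \<psi> (T p q))"
    unfolding mat_norm_eq by (intro fin_op_conjugate(1) cinner_coord_emb) (simp_all add: norm_emb_vec)
  also have "\<dots> \<le> cb_norm V \<psi>"
  proof -
    have "mat_norm n T \<le> 1" using T(2) s(3) by linarith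
    then have "mat_norm n (\<lambda>p q. \<psi> (T p q)) \<in> {mat_norm n (\<lambda>i j. \<psi> (T i j)) | n T. T \<in> mats n V \<and> mat_norm n T \<le> 1}"
      using T(1) by (intro CollectI exI[of _ n] exI[of _ T]) simp
    then show ?thesis unfolding cb_norm_def by (rule cSup_upper[OF _ bdd_above_cb_norm[OF cb]])
  qed
  finally show "s \<le> cb_norm V \<psi>" .
qed

section \<open>Extension of completely bounded maps to the closure\<close>

interpretation complex_module: module "scaleC :: complex \<Rightarrow> 'a \<Rightarrow> 'a::complex_normed_vector"
  by standard (simp_all add: scaleC_add_right scaleC_add_left scaleC_scaleC scaleC_one)

abbreviation csubspace :: "'a::complex_normed_vector set \<Rightarrow> bool" where
  "csubspace \<equiv> module.subspace scaleC"

lemma csubspace_scaleR: "csubspace D \<Longrightarrow> T \<in> D \<Longrightarrow> r *\<^sub>R T \<in> D"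
  by (simp add: scaleR_scaleC complex_module.subspace_scale)

lemma csubspace_minus: "csubspace D \<Longrightarrow> T \<in> D \<Longrightarrow> - T \<in> D"
  using complex_module.subspace_scale[of D T "-1"] by (simp add: scaleC_minus1_left)

lemma csubspace_diff: "csubspace D \<Longrightarrow> S \<in> D \<Longrightarrow> T \<in> D \<Longrightarrow> S - T \<in> D"
  using complex_module.subspace_add[of D S "- T"] csubspace_minus[of D T] by simp

lemma csubspace_cstar: "cstar_algebra A \<Longrightarrow> csubspace A"
  by (rule complex_module.subspaceI) (auto intro: cstar_zero cstar_add cstar_scaleC)

lemma csubspace_closure:
  assumes D: "csubspace D" shows "csubspace (closure D)"
proof (rule complex_module.subspaceI)
  show "0 \<in> closure D" using complex_module.subspace_0[OF D] closure_subset by blast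
next
  fix x y assume "x \<in> closure D" "y \<in> closure D"
  then obtain f g where f: "\<And>n. f n \<in> D" "f \<longlonglongrightarrow> x" and g: "\<And>n. g n \<in> D" "g \<longlonglongrightarrow> y"
    unfolding closure_sequential by blast
  have "\<And>n. f n + g n \<in> D" using complex_module.subspace_add[OF D f(1) g(1)] .
  then show "x + y \<in> closure D" unfolding closure_sequential
    by (intro exI[of _ "\<lambda>n. f n + g n"] conjI allI tendsto_add f(2) g(2))
next
  fix c x assume "x \<in> closure D"
  then obtain f where f: "\<And>n. f n \<in> D" "f \<longlonglongrightarrow> x" unfolding closure_sequential by blast
  have "\<And>n. c *\<^sub>C f n \<in> D" using complex_module.subspace_scale[OF D f(1)] .
  then show "c *\<^sub>C x \<in> closure D" unfolding closure_sequential
    by (intro exI[of _ "\<lambda>n. c *\<^sub>C f n"] conjI allI bounded_linear.tendsto[OF bounded_linear_scaleC] f(2))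
qed

lemma tendsto_CB_subspace:
  assumes \<phi>: "\<phi> \<in> CB D W" and D: "csubspace D" and f: "\<And>n. f n \<in> D" "b \<in> D" "(f \<longlongrightarrow> b) G"
  shows "((\<lambda>n. \<phi> (f n)) \<longlongrightarrow> \<phi> b) G"
  by (rule tendsto_CB[OF \<phi> f(1,2) csubspace_diff[OF D f(1,2)] csubspace_minus[OF D f(2)] f(3)])

lemma mats_closure_sequence:
  fixes T :: "nat \<Rightarrow> nat \<Rightarrow> 'a::real_normed_vector"
  assumes "T \<in> mats n (closure D)"
  obtains S where "\<And>k i j. i < n \<Longrightarrow> j < n \<Longrightarrow> S k i j \<in> D" "\<And>i j. i < n \<Longrightarrow> j < n \<Longrightarrow> (\<lambda>k. S k i j) \<longlonglongrightarrow> T i j"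
proof -
  have "\<exists>f. (\<forall>k. f k \<in> D) \<and> f \<longlonglongrightarrow> T i j" if ij: "i < n \<and> j < n" for i j
  proof -
    have "T i j \<in> closure D" using assms ij by (simp add: mats_def)
    then show ?thesis by (simp only: closure_sequential)
  qed
  then obtain f where f: "\<And>i j. i < n \<and> j < n \<Longrightarrow> (\<forall>k. f i j k \<in> D) \<and> f i j \<longlonglongrightarrow> T i j"
    by metis
  show thesis by (rule that[of "\<lambda>k i j. f i j k"]) (use f in auto)
qed

lemma tendsto_mat_norm:
  "(\<And>i j. i < n \<Longrightarrow> j < n \<Longrightarrow> ((\<lambda>k. S k i j) \<longlongrightarrow> T i j) G) \<Longrightarrow> ((\<lambda>k. mat_norm n (S k)) \<longlongrightarrow> mat_norm n T) G"
  unfolding mat_norm_eq by (intro tendsto_norm tendsto_fin_op) auto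

text \<open>
  The map is Lipschitz and so has a continuous extension; the estimates for all matrix sizes pass
  to limits because \<open>mat_norm\<close> is continuous in each entry.
\<close>

lemma CB_extension_exists:
  assumes \<phi>: "\<phi> \<in> CB D W" and D: "csubspace D" and W: "closed W"
  shows "\<exists>\<psi>. \<psi> \<in> CB (closure D) W \<and> (\<forall>T\<in>D. \<psi> T = \<phi> T)"
proof -
  obtain C where C: "0 \<le> C" "\<And>n T. T \<in> mats n D \<Longrightarrow> mat_norm n (\<lambda>i j. \<phi> (T i j)) \<le> C * mat_norm n T"
    "\<And>T. T \<in> D \<Longrightarrow> norm (\<phi> T) \<le> C * norm T"
    by (rule completely_bounded_bound[OF CB_D(2)[OF \<phi>]]) blast
  have "C-lipschitz_on D \<phi>"
  proof (rule lipschitz_onI[OF _ C(1)])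
    fix S T assume ST: "S \<in> D" "T \<in> D"
    have "\<phi> (S - T) = \<phi> S - \<phi> T"
      by (rule clinear_on_diff[OF CB_D(1)[OF \<phi>] ST csubspace_minus[OF D ST(2)]])
    then show "dist (\<phi> S) (\<phi> T) \<le> C * dist S T"
      using C(3)[OF csubspace_diff[OF D ST]] by (simp add: dist_norm)
  qed
  then have uc0: "uniformly_continuous_on D \<phi>" by (rule lipschitz_on_uniformly_continuous)
  obtain \<psi> where uc: "uniformly_continuous_on (closure D) \<psi>" and eq: "\<And>T. T \<in> D \<Longrightarrow> \<phi> T = \<psi> T"
    by (rule uniformly_continuous_on_extension_on_closure[OF uc0]) (rule that, assumption+)
  have lim: "(\<lambda>n. \<phi> (f n)) \<longlonglongrightarrow> \<psi> T" if "\<And>n. f n \<in> D" "f \<longlonglongrightarrow> T" for f T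
  proof -
    have "T \<in> closure D" using that unfolding closure_sequential by blast
    moreover have "f n \<in> closure D" for n using that(1) closure_subset by blast
    ultimately have "(\<lambda>n. \<psi> (f n)) \<longlonglongrightarrow> \<psi> T"
      using uniformly_continuous_imp_continuous[OF uc, unfolded continuous_on_sequentially] that(2)
      by (auto simp: o_def)
    then show ?thesis by (simp add: eq that(1))
  qed
  have "clinear_on (closure D) \<psi>"
    unfolding clinear_on_def
  proof (intro conjI ballI allI)
    fix a b assume "a \<in> closure D" "b \<in> closure D"
    then obtain f g where f: "\<And>n. f n \<in> D" "f \<longlonglongrightarrow> a" and g: "\<And>n. g n \<in> D" "g \<longlonglongrightarrow> b"
      unfolding closure_sequential by blast
    have "(\<lambda>n. \<phi> (f n + g n)) \<longlonglongrightarrow> \<psi> (a + b)"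
      by (rule lim[OF complex_module.subspace_add[OF D f(1) g(1)] tendsto_add[OF f(2) g(2)]])
    moreover have "\<phi> (f n + g n) = \<phi> (f n) + \<phi> (g n)" for n
      using CB_D(1)[OF \<phi>] f(1) g(1) by (simp add: clinear_on_def)
    moreover have "(\<lambda>n. \<phi> (f n) + \<phi> (g n)) \<longlonglongrightarrow> \<psi> a + \<psi> b"
      by (intro tendsto_add lim f g)
    ultimately show "\<psi> (a + b) = \<psi> a + \<psi> b" using LIMSEQ_unique by simp
  next
    fix c a assume "a \<in> closure D"
    then obtain f where f: "\<And>n. f n \<in> D" "f \<longlonglongrightarrow> a" unfolding closure_sequential by blast
    have "(\<lambda>n. \<phi> (c *\<^sub>C f n)) \<longlonglongrightarrow> \<psi> (c *\<^sub>C a)"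
      by (rule lim[OF complex_module.subspace_scale[OF D f(1)] bounded_linear.tendsto[OF bounded_linear_scaleC f(2)]])
    moreover have "\<phi> (c *\<^sub>C f n) = c *\<^sub>C \<phi> (f n)" for n
      using CB_D(1)[OF \<phi>] f(1) by (simp add: clinear_on_def)
    moreover have "(\<lambda>n. c *\<^sub>C \<phi> (f n)) \<longlonglongrightarrow> c *\<^sub>C \<psi> a"
      by (intro bounded_linear.tendsto[OF bounded_linear_scaleC] lim f)
    ultimately show "\<psi> (c *\<^sub>C a) = c *\<^sub>C \<psi> a" using LIMSEQ_unique by simp
  qed
  moreover have "\<psi> T \<in> W" if T: "T \<in> closure D" for T
  proof -
    obtain f where f: "\<And>n. f n \<in> D" "f \<longlonglongrightarrow> T" using T unfolding closure_sequential by blast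
    show ?thesis by (rule closed_sequentially[OF W _ lim[OF f]]) (rule CB_D(3)[OF \<phi> f(1)])
  qed
  moreover have "completely_bounded (closure D) \<psi>"
  proof (rule cb_norm_le(2)[OF C(1)])
    fix n T assume T: "T \<in> mats n (closure D)"
    obtain S where S: "\<And>k i j. i < n \<Longrightarrow> j < n \<Longrightarrow> S k i j \<in> D"
      "\<And>i j. i < n \<Longrightarrow> j < n \<Longrightarrow> (\<lambda>k. S k i j) \<longlonglongrightarrow> T i j"
      by (rule mats_closure_sequence[OF T]) blast
    have "(\<lambda>k. mat_norm n (\<lambda>i j. \<phi> (S k i j))) \<longlonglongrightarrow> mat_norm n (\<lambda>i j. \<psi> (T i j))"
      by (rule tendsto_mat_norm) (intro lim S)
    moreover have "(\<lambda>k. C * mat_norm n (S k)) \<longlonglongrightarrow> C * mat_norm n T"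
      by (intro tendsto_mult tendsto_const tendsto_mat_norm S)
    moreover have "mat_norm n (\<lambda>i j. \<phi> (S k i j)) \<le> C * mat_norm n (S k)" for k
      by (rule C(2)) (simp add: mats_def S)
    ultimately show "mat_norm n (\<lambda>i j. \<psi> (T i j)) \<le> C * mat_norm n T" by (intro LIMSEQ_le) auto
  qed
  ultimately show ?thesis unfolding CB_def using eq by (intro exI[of _ \<psi>]) auto
qed

lemma cb_extension_works:
  assumes "\<phi> \<in> CB D W" "csubspace D" "closed W" "V = closure D"
  shows "cb_extension D V W \<phi> \<in> CB V W" "T \<in> D \<Longrightarrow> cb_extension D V W \<phi> T = \<phi> T"
proof -
  have "\<exists>\<psi>. \<psi> \<in> CB V W \<and> (\<forall>T\<in>D. \<psi> T = \<phi> T)" using CB_extension_exists[OF assms(1-3)] assms(4) by simp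
  from someI_ex[OF this] have *: "cb_extension D V W \<phi> \<in> CB V W \<and> (\<forall>T\<in>D. cb_extension D V W \<phi> T = \<phi> T)"
    unfolding cb_extension_def .
  show "cb_extension D V W \<phi> \<in> CB V W" "T \<in> D \<Longrightarrow> cb_extension D V W \<phi> T = \<phi> T" using * by blast+
qed

text \<open>Entries depend continuously on the operator, so the description by entries passes to limits.\<close>

lemma acts_entrywise_closure:
  assumes A: "cstar_algebra A" and \<phi>: "\<And>x y. \<phi> x y \<in> CB A W'" and \<phi>0: "acts_entrywise A \<phi> D \<psi>"
    and D: "csubspace D" and \<psi>: "\<psi> \<in> CB (closure D) W"
  shows "acts_entrywise A \<phi> (closure D) \<psi>"
  unfolding acts_entrywise_def
proof (intro ballI allI)
  fix T x y assume T: "T \<in> closure D"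
  then obtain f where f: "\<And>n. f n \<in> D" "f \<longlonglongrightarrow> T" unfolding closure_sequential by blast
  have ent: "entry (f n) x y \<in> A" "entry (\<psi> (f n)) x y = \<phi> x y (entry (f n) x y)" for n
    using \<phi>0 f(1) by (auto simp: acts_entrywise_def)
  have lim: "(\<lambda>n. entry (f n) x y) \<longlonglongrightarrow> entry T x y" by (rule tendsto_entry[OF f(2)])
  have TA: "entry T x y \<in> A" by (rule closed_sequentially[OF cstar_closed[OF A] ent(1) lim])
  have "(\<lambda>n. \<psi> (f n)) \<longlonglongrightarrow> \<psi> T"
    by (rule tendsto_CB_subspace[OF \<psi> csubspace_closure[OF D] _ T f(2)]) (use f(1) closure_subset in blast)
  then have "(\<lambda>n. entry (\<psi> (f n)) x y) \<longlonglongrightarrow> entry (\<psi> T) x y" by (rule tendsto_entry)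
  moreover have "(\<lambda>n. \<phi> x y (entry (f n) x y)) \<longlonglongrightarrow> \<phi> x y (entry T x y)"
    by (rule tendsto_CB_subspace[OF \<phi> csubspace_cstar[OF A] ent(1) TA lim])
  ultimately show "entry T x y \<in> A \<and> entry (\<psi> T) x y = \<phi> x y (entry T x y)"
    using TA LIMSEQ_unique by (simp add: ent(2))
qed

lemma acts_entrywise_clinear:
  assumes \<psi>: "acts_entrywise A \<phi> D \<psi>" and D: "csubspace D" and \<phi>: "\<And>x y. clinear_on A (\<phi> x y)"
  shows "clinear_on D \<psi>"
proof -
  have ent: "entry (\<psi> T) x y = \<phi> x y (entry T x y)" "entry T x y \<in> A" if "T \<in> D" for T x y
    using \<psi> that by (auto simp: acts_entrywise_def)
  show ?thesis
    unfolding clinear_on_def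
  proof (intro conjI ballI allI)
    fix S T assume ST: "S \<in> D" "T \<in> D"
    show "\<psi> (S + T) = \<psi> S + \<psi> T"
      by (rule entry_eqI)
        (use \<phi> ST in \<open>simp add: entry_add ent complex_module.subspace_add[OF D] clinear_on_def\<close>)
  next
    fix c T assume T: "T \<in> D"
    show "\<psi> (c *\<^sub>C T) = c *\<^sub>C \<psi> T"
      by (rule entry_eqI)
        (use \<phi> T in \<open>simp add: entry_scaleC ent complex_module.subspace_scale[OF D] clinear_on_def\<close>)
  qed
qed

section \<open>Operators with square summable kernels\<close>

lemma infsum_Cauchy_Schwarz:
  fixes f :: "'x \<Rightarrow> 'a::real_normed_vector" and g :: "'x \<Rightarrow> 'b::real_normed_vector"
  assumes f: "(\<lambda>x. (norm (f x))\<^sup>2) summable_on UNIV" and g: "(\<lambda>x. (norm (g x))\<^sup>2) summable_on UNIV"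
  shows "(\<lambda>x. norm (f x) * norm (g x)) summable_on UNIV"
    and "(\<Sum>\<^sub>\<infinity>x. norm (f x) * norm (g x)) \<le> sqrt (\<Sum>\<^sub>\<infinity>x. (norm (f x))\<^sup>2) * sqrt (\<Sum>\<^sub>\<infinity>x. (norm (g x))\<^sup>2)"
proof -
  have fin: "(\<Sum>x\<in>F. norm (f x) * norm (g x)) \<le> sqrt (\<Sum>\<^sub>\<infinity>x. (norm (f x))\<^sup>2) * sqrt (\<Sum>\<^sub>\<infinity>x. (norm (g x))\<^sup>2)"
    if F: "finite F" for F
  proof -
    have "(\<Sum>x\<in>F. norm (f x) * norm (g x)) \<le> L2_set (\<lambda>x. norm (f x)) F * L2_set (\<lambda>x. norm (g x)) F"
      using L2_set_mult_ineq[of "\<lambda>x. norm (f x)" "\<lambda>x. norm (g x)" F] by simp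
    also have "\<dots> \<le> sqrt (\<Sum>\<^sub>\<infinity>x. (norm (f x))\<^sup>2) * sqrt (\<Sum>\<^sub>\<infinity>x. (norm (g x))\<^sup>2)"
      unfolding L2_set_def
      by (intro mult_mono real_sqrt_le_mono finite_sum_le_infsum f g F) (auto simp: infsum_nonneg sum_nonneg)
    finally show ?thesis .
  qed
  show s: "(\<lambda>x. norm (f x) * norm (g x)) summable_on UNIV"
    by (rule nonneg_bdd_above_summable_on) (auto intro!: bdd_aboveI2 fin)
  show "(\<Sum>\<^sub>\<infinity>x. norm (f x) * norm (g x)) \<le> sqrt (\<Sum>\<^sub>\<infinity>x. (norm (f x))\<^sup>2) * sqrt (\<Sum>\<^sub>\<infinity>x. (norm (g x))\<^sup>2)"
    by (rule infsum_le_finite_sums[OF s]) (rule fin)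
qed

definition hs_kernel :: "('x \<Rightarrow> 'x \<Rightarrow> 'h::chilbert_space \<Rightarrow>\<^sub>L 'h) \<Rightarrow> bool" where
  "hs_kernel k \<longleftrightarrow> (\<lambda>(x, y). (norm (k x y))\<^sup>2) summable_on UNIV"

definition hs_norm_sq :: "('x \<Rightarrow> 'x \<Rightarrow> 'h::chilbert_space \<Rightarrow>\<^sub>L 'h) \<Rightarrow> real" where
  "hs_norm_sq k = (\<Sum>\<^sub>\<infinity>(x, y). (norm (k x y))\<^sup>2)"

lemma hs_norm_sq_nonneg: "0 \<le> hs_norm_sq k"
  unfolding hs_norm_sq_def by (rule infsum_nonneg) auto

lemma hs_kernel_row: "hs_kernel k \<Longrightarrow> (\<lambda>y. (norm (k x y))\<^sup>2) summable_on UNIV"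
  unfolding hs_kernel_def
  by (rule summable_on_SigmaD1[where A = UNIV and B = "\<lambda>_. UNIV" and f = "\<lambda>x y. (norm (k x y))\<^sup>2"]) simp_all

lemma kernel_op_apply:
  fixes k :: "'x \<Rightarrow> 'x \<Rightarrow> 'h::chilbert_space \<Rightarrow>\<^sub>L 'h"
  assumes k: "hs_kernel k"
  shows "Rep_ell2 (blinfun_apply (kernel_op k) \<xi>) x = (\<Sum>\<^sub>\<infinity>y. blinfun_apply (k x y) (Rep_ell2 \<xi> y))"
    and "norm (kernel_op k) \<le> sqrt (hs_norm_sq k)"
proof -
  define g where "g \<xi> x = (\<Sum>\<^sub>\<infinity>y. blinfun_apply (k x y) (Rep_ell2 \<xi> y))" for \<xi> x
  define c where "c x = (\<Sum>\<^sub>\<infinity>y. (norm (k x y))\<^sup>2)" for x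
  have abs: "(\<lambda>y. blinfun_apply (k x y) (Rep_ell2 \<xi> y)) abs_summable_on UNIV" for \<xi> x
    by (rule Infinite_Sum.abs_summable_on_comparison_test'[OF infsum_Cauchy_Schwarz(1)[OF hs_kernel_row[OF k] ell2_summable]])
      (rule norm_blinfun)
  have summ: "(\<lambda>y. blinfun_apply (k x y) (Rep_ell2 \<xi> y)) summable_on UNIV" for \<xi> x
    by (rule abs_summable_summable[OF abs])
  have g_le: "(norm (g \<xi> x))\<^sup>2 \<le> c x * (norm \<xi>)\<^sup>2" for \<xi> x
  proof -
    have "norm (g \<xi> x) \<le> (\<Sum>\<^sub>\<infinity>y. norm (blinfun_apply (k x y) (Rep_ell2 \<xi> y)))"
      unfolding g_def by (rule norm_infsum_bound[OF abs])
    also have "\<dots> \<le> (\<Sum>\<^sub>\<infinity>y. norm (k x y) * norm (Rep_ell2 \<xi> y))"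
      by (rule infsum_mono[OF abs infsum_Cauchy_Schwarz(1)[OF hs_kernel_row[OF k] ell2_summable]]) (rule norm_blinfun)
    also have "\<dots> \<le> sqrt (c x) * norm \<xi>"
      unfolding c_def norm_ell2_def by (rule infsum_Cauchy_Schwarz(2)[OF hs_kernel_row[OF k] ell2_summable])
    finally have "(norm (g \<xi> x))\<^sup>2 \<le> (sqrt (c x) * norm \<xi>)\<^sup>2" by (rule power_mono) simp
    then show ?thesis by (simp add: power_mult_distrib c_def infsum_nonneg)
  qed
  have c_sum: "c summable_on UNIV" and c_inf: "(\<Sum>\<^sub>\<infinity>x. c x) = hs_norm_sq k"
  proof -
    have s: "(\<lambda>(x, y). (norm (k x y))\<^sup>2) summable_on (Sigma UNIV (\<lambda>_. UNIV))" using k by (simp add: hs_kernel_def)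
    show "c summable_on UNIV" unfolding c_def[abs_def]
      using summable_on_SigmaD[OF s] hs_kernel_row[OF k] by simp
    show "(\<Sum>\<^sub>\<infinity>x. c x) = hs_norm_sq k"
      unfolding c_def hs_norm_sq_def using infsum_Sigma_banach[OF s] by simp
  qed
  have g_sum: "(\<lambda>x. (norm (g \<xi> x))\<^sup>2) summable_on UNIV" for \<xi>
    by (rule summable_on_comparison_test[OF summable_on_cmult_left[OF c_sum]]) (use g_le in auto)
  have rep: "Rep_ell2 (Abs_ell2 (g \<xi>)) = g \<xi>" for \<xi> by (rule Abs_ell2_inverse) (simp add: g_sum)
  have bl: "bounded_linear (\<lambda>\<xi>. Abs_ell2 (g \<xi>))"
    and bound: "norm (Abs_ell2 (g \<xi>)) \<le> sqrt (hs_norm_sq k) * norm \<xi>" for \<xi>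
  proof -
    show bound: "norm (Abs_ell2 (g \<xi>)) \<le> sqrt (hs_norm_sq k) * norm \<xi>" for \<xi>
    proof (rule power2_le_imp_le)
      have "(norm (Abs_ell2 (g \<xi>)))\<^sup>2 = (\<Sum>\<^sub>\<infinity>x. (norm (g \<xi> x))\<^sup>2)" by (simp add: norm_ell2_sq rep)
      also have "\<dots> \<le> (\<Sum>\<^sub>\<infinity>x. c x * (norm \<xi>)\<^sup>2)"
        by (rule infsum_mono[OF g_sum summable_on_cmult_left[OF c_sum]]) (rule g_le)
      also have "\<dots> = hs_norm_sq k * (norm \<xi>)\<^sup>2" by (simp add: infsum_cmult_left' c_inf)
      finally show "(norm (Abs_ell2 (g \<xi>)))\<^sup>2 \<le> (sqrt (hs_norm_sq k) * norm \<xi>)\<^sup>2"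
        by (simp add: power_mult_distrib hs_norm_sq_nonneg)
    qed (simp add: hs_norm_sq_nonneg)
    show "bounded_linear (\<lambda>\<xi>. Abs_ell2 (g \<xi>))"
    proof (rule bounded_linear_intro)
      show "Abs_ell2 (g (\<xi> + \<eta>)) = Abs_ell2 (g \<xi>) + Abs_ell2 (g \<eta>)" for \<xi> \<eta>
        by (rule ell2_eqI) (simp add: rep ell2_rep, simp add: g_def ell2_rep blinfun.add_right infsum_add[OF summ summ])
      show "Abs_ell2 (g (r *\<^sub>R \<xi>)) = r *\<^sub>R Abs_ell2 (g \<xi>)" for r \<xi>
        by (rule ell2_eqI) (simp add: rep ell2_rep, simp add: g_def ell2_rep blinfun.scaleR_right infsum_scaleR_right)
      show "norm (Abs_ell2 (g \<xi>)) \<le> norm \<xi> * sqrt (hs_norm_sq k)" for \<xi>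
        using bound[of \<xi>] by (simp add: mult.commute)
    qed
  qed
  have app: "blinfun_apply (kernel_op k) \<xi> = Abs_ell2 (g \<xi>)" for \<xi>
    unfolding kernel_op_def using bounded_linear_Blinfun_apply[OF bl] by (simp add: g_def[abs_def])
  show "Rep_ell2 (blinfun_apply (kernel_op k) \<xi>) x = (\<Sum>\<^sub>\<infinity>y. blinfun_apply (k x y) (Rep_ell2 \<xi> y))"
    by (simp add: app rep) (simp add: g_def)
  show "norm (kernel_op k) \<le> sqrt (hs_norm_sq k)"
    by (rule norm_blinfun_bound) (simp_all add: app bound hs_norm_sq_nonneg)
qed

lemma entry_kernel_op:
  assumes "hs_kernel k" shows "entry (kernel_op k) x y = k x y"
proof (rule blinfun_eqI)
  fix h
  have "blinfun_apply (entry (kernel_op k) x y) h = (\<Sum>\<^sub>\<infinity>z. blinfun_apply (k x z) (if z = y then h else 0))"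
    by (simp add: entry_apply kernel_op_apply(1)[OF assms] emb_vec.rep_eq)
  also have "\<dots> = (\<Sum>\<^sub>\<infinity>z\<in>{y}. blinfun_apply (k x z) h)"
    by (rule infsum_cong_neutral) auto
  finally show "blinfun_apply (entry (kernel_op k) x y) h = blinfun_apply (k x y) h" by simp
qed

lemma ell2_kernels_iff: "k \<in> ell2_kernels A \<longleftrightarrow> (\<forall>x y. k x y \<in> A) \<and> hs_kernel k"
  by (simp add: ell2_kernels_def hs_kernel_def)

lemma hs_kernel_diff_restrict:
  assumes k: "hs_kernel k" and F: "finite F"
  defines "k' \<equiv> \<lambda>x y. if (x, y) \<in> F then 0 else k x y"
  shows "hs_kernel k'" "hs_norm_sq k' = hs_norm_sq k - (\<Sum>(x, y)\<in>F. (norm (k x y))\<^sup>2)"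
proof -
  have s: "(\<lambda>(x, y). (norm (k x y))\<^sup>2) summable_on UNIV" using k by (simp add: hs_kernel_def)
  have s': "(\<lambda>(x, y). (norm (k x y))\<^sup>2) summable_on (UNIV - F)" by (rule summable_on_subset_banach[OF s]) auto
  have "((\<lambda>(x, y). (norm (k' x y))\<^sup>2) summable_on UNIV) = ((\<lambda>(x, y). (norm (k x y))\<^sup>2) summable_on (UNIV - F))"
    by (rule summable_on_cong_neutral) (auto simp: k'_def)
  then show "hs_kernel k'" using s' by (simp add: hs_kernel_def)
  have "hs_norm_sq k' = (\<Sum>\<^sub>\<infinity>(x, y)\<in>UNIV - F. (norm (k x y))\<^sup>2)"
    unfolding hs_norm_sq_def by (rule infsum_cong_neutral) (auto simp: k'_def)
  also have "\<dots> = hs_norm_sq k - (\<Sum>(x, y)\<in>F. (norm (k x y))\<^sup>2)"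
    unfolding hs_norm_sq_def using infsum_Diff[OF s, of F] F by simp
  finally show "hs_norm_sq k' = hs_norm_sq k - (\<Sum>(x, y)\<in>F. (norm (k x y))\<^sup>2)" .
qed

lemma entry_elementary: "entry (emb x o\<^sub>L a o\<^sub>L coord y) x' y' = (if x' = x \<and> y' = y then a else 0)"
  by (rule blinfun_eqI) (simp add: entry_apply emb_vec.rep_eq)

lemma hs_kernel_finite_support:
  assumes "finite F" "\<And>x y. (x, y) \<notin> F \<Longrightarrow> k x y = 0" shows "hs_kernel k"
proof -
  have "((\<lambda>(x, y). (norm (k x y))\<^sup>2) summable_on UNIV) = ((\<lambda>(x, y). (norm (k x y))\<^sup>2) summable_on F)"
    by (rule summable_on_cong_neutral) (use assms(2) in auto)
  then show ?thesis using assms(1) by (simp add: hs_kernel_def)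
qed

lemma kernel_op_finite_approximation:
  assumes k: "hs_kernel k"
  shows "((\<lambda>F. \<Sum>(x, y)\<in>F. emb x o\<^sub>L k x y o\<^sub>L coord y) \<longlongrightarrow> kernel_op k) (finite_subsets_at_top UNIV)"
proof -
  let ?S = "\<lambda>F. \<Sum>(x, y)\<in>F. emb x o\<^sub>L k x y o\<^sub>L coord y"
  have le: "norm (kernel_op k - ?S F) \<le> sqrt (hs_norm_sq k - (\<Sum>(x, y)\<in>F. (norm (k x y))\<^sup>2))" if F: "finite F" for F
  proof -
    let ?k = "\<lambda>x y. if (x, y) \<in> F then 0 else k x y"
    have "kernel_op k - ?S F = kernel_op ?k"
    proof (rule entry_eqI)
      fix x y
      have "entry (?S F) x y = (\<Sum>z\<in>F. if z = (x, y) then k x y else 0)"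
        unfolding entry_sum
      proof (rule sum.cong[OF refl])
        fix z
        show "entry (case z of (x, y) \<Rightarrow> emb x o\<^sub>L k x y o\<^sub>L coord y) x y = (if z = (x, y) then k x y else 0)"
          by (cases z, cases "z = (x, y)") (auto simp: entry_elementary)
      qed
      also have "\<dots> = (if (x, y) \<in> F then k x y else 0)" using F by simp
      finally show "entry (kernel_op k - ?S F) x y = entry (kernel_op ?k) x y"
        by (simp add: entry_diff entry_kernel_op k hs_kernel_diff_restrict(1)[OF k F])
    qed
    then show ?thesis
      using kernel_op_apply(2)[OF hs_kernel_diff_restrict(1)[OF k F]] by (simp add: hs_kernel_diff_restrict(2)[OF k F])
  qed
  have "((\<lambda>F. \<Sum>(x, y)\<in>F. (norm (k x y))\<^sup>2) \<longlongrightarrow> hs_norm_sq k) (finite_subsets_at_top UNIV)"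
    unfolding hs_norm_sq_def by (rule infsum_tendsto) (use k in \<open>simp add: hs_kernel_def\<close>)
  then have "((\<lambda>F. sqrt (hs_norm_sq k - (\<Sum>(x, y)\<in>F. (norm (k x y))\<^sup>2))) \<longlongrightarrow> sqrt (hs_norm_sq k - hs_norm_sq k))
      (finite_subsets_at_top UNIV)"
    by (intro tendsto_intros)
  then have lim0: "((\<lambda>F. sqrt (hs_norm_sq k - (\<Sum>(x, y)\<in>F. (norm (k x y))\<^sup>2))) \<longlongrightarrow> 0) (finite_subsets_at_top UNIV)"
    by simp
  have "\<forall>\<^sub>F F in finite_subsets_at_top UNIV.
      norm (?S F - kernel_op k) \<le> sqrt (hs_norm_sq k - (\<Sum>(x, y)\<in>F. (norm (k x y))\<^sup>2))"
    by (rule eventually_finite_subsets_at_top_weakI) (use le in \<open>simp add: norm_minus_commute\<close>)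
  from Lim_null_comparison[OF this lim0] show ?thesis by (rule LIM_zero_cancel)
qed

lemma kernel_op_add:
  assumes "hs_kernel k" "hs_kernel k'"
  shows "hs_kernel (\<lambda>x y. k x y + k' x y)" "kernel_op k + kernel_op k' = kernel_op (\<lambda>x y. k x y + k' x y)"
proof -
  show *: "hs_kernel (\<lambda>x y. k x y + k' x y)"
    using ell2_add_summable[of "\<lambda>p. k (fst p) (snd p)" "\<lambda>p. k' (fst p) (snd p)"] assms
    by (simp add: hs_kernel_def case_prod_unfold)
  show "kernel_op k + kernel_op k' = kernel_op (\<lambda>x y. k x y + k' x y)"
    by (rule entry_eqI) (simp add: entry_add entry_kernel_op assms *)
qed

lemma kernel_op_scaleC:
  assumes "hs_kernel k"
  shows "hs_kernel (\<lambda>x y. c *\<^sub>C k x y)" "c *\<^sub>C kernel_op k = kernel_op (\<lambda>x y. c *\<^sub>C k x y)"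
proof -
  show *: "hs_kernel (\<lambda>x y. c *\<^sub>C k x y)"
    using ell2_scaleC_summable[of "\<lambda>p. k (fst p) (snd p)" c] assms
    by (simp add: hs_kernel_def case_prod_unfold)
  show "c *\<^sub>C kernel_op k = kernel_op (\<lambda>x y. c *\<^sub>C k x y)"
    by (rule entry_eqI) (simp add: entry_scaleC entry_kernel_op assms *)
qed

lemma entry_zero: "entry 0 x y = 0"
  by (rule blinfun_eqI) (simp add: entry_apply zero_ell2.rep_eq)

lemma csubspace_kernel_ops:
  fixes A :: "('h::chilbert_space \<Rightarrow>\<^sub>L 'h) set"
  assumes A: "csubspace A"
  shows "csubspace (kernel_op ` ell2_kernels A :: (('x, 'h) ell2 \<Rightarrow>\<^sub>L ('x, 'h) ell2) set)"
    (is "csubspace ?K")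
proof (rule complex_module.subspaceI)
  have "hs_kernel (\<lambda>(x::'x) y. 0 :: 'h \<Rightarrow>\<^sub>L 'h)" by (simp add: hs_kernel_def case_prod_unfold)
  moreover from this have "kernel_op (\<lambda>(x::'x) y. 0 :: 'h \<Rightarrow>\<^sub>L 'h) = 0"
    by (intro entry_eqI) (simp add: entry_kernel_op entry_zero)
  ultimately show "0 \<in> ?K"
    using complex_module.subspace_0[OF A] by (auto simp: ell2_kernels_iff intro!: image_eqI[of _ _ "\<lambda>_ _. 0"])
next
  fix S T assume "S \<in> ?K" "T \<in> ?K"
  then show "S + T \<in> ?K"
    by (auto simp: ell2_kernels_iff kernel_op_add complex_module.subspace_add[OF A])
next
  fix c T assume "T \<in> ?K"
  then show "c *\<^sub>C T \<in> ?K"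
    by (auto simp: ell2_kernels_iff kernel_op_scaleC complex_module.subspace_scale[OF A])
qed

section \<open>The compact operators tensored with a C*-algebra\<close>

lemma norm_fin_op_entry_le:
  assumes F: "finite F" shows "norm (fin_op F (entry S)) \<le> norm S"
proof (rule norm_fin_op_le[OF F norm_ge_zero])
  fix \<xi> \<eta>
  have "(\<Sum>i\<in>F. \<Sum>j\<in>F. cinner (blinfun_apply (entry S i j) (\<xi> j)) (\<eta> i))
      = cinner (blinfun_apply S (fin_vec F \<xi>)) (fin_vec F \<eta>)" by (simp only: cinner_fin_vec_entries)
  then show "2 * cmod (\<Sum>i\<in>F. \<Sum>j\<in>F. cinner (blinfun_apply (entry S i j) (\<xi> j)) (\<eta> i))
      \<le> norm S * ((\<Sum>i\<in>F. (norm (\<xi> i))\<^sup>2) + (\<Sum>i\<in>F. (norm (\<eta> i))\<^sup>2))"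
    using quadratic_bound[of S "fin_vec F \<xi>" "fin_vec F \<eta>"] by (simp only: norm_fin_vec_sq[OF F])
qed

text \<open>
  The representation of \<open>\<complex> = B(\<complex>)\<close> by scalars; applied to each entry of a matrix \<open>S\<close> it
  yields \<open>S \<otimes> 1\<close>.
\<close>

definition scalar_op :: "(complex \<Rightarrow>\<^sub>L complex) \<Rightarrow> 'h::chilbert_space \<Rightarrow>\<^sub>L 'h" where
  "scalar_op s = blinfun_apply s 1 *\<^sub>C id_blinfun"

lemma scalar_op_apply: "blinfun_apply (scalar_op s) h = blinfun_apply s 1 *\<^sub>C h"
  by (simp add: scalar_op_def scaleC_blinfun.rep_eq)

lemma BH_complex_apply: "s \<in> BH \<Longrightarrow> blinfun_apply s z = z * blinfun_apply s (1::complex)"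
  using BH_scaleC[of s z 1] by (simp add: scaleC_complex_def)

lemma star_hom_scalar_op: "star_hom BH (scalar_op :: _ \<Rightarrow> 'h::chilbert_space \<Rightarrow>\<^sub>L 'h)"
  unfolding star_hom_def clinear_on_def
proof (intro conjI ballI allI image_subsetI)
  fix s t :: "complex \<Rightarrow>\<^sub>L complex" and c assume s: "s \<in> BH"
  show "scalar_op s \<in> BH" by (simp add: BH_def scalar_op_apply scaleC_scaleC mult.commute)
  show "scalar_op (c *\<^sub>C s) = c *\<^sub>C (scalar_op s :: 'h \<Rightarrow>\<^sub>L 'h)"
    by (rule blinfun_eqI) (simp add: scalar_op_apply scaleC_blinfun.rep_eq scaleC_scaleC scaleC_complex_def)
  have "blinfun_apply (adj s) 1 = cnj (blinfun_apply s 1)"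
    using cinner_adj_left[OF s, of 1 1] by (simp add: cinner_complex_def)
  then show "scalar_op (adj s) = adj (scalar_op s :: 'h \<Rightarrow>\<^sub>L 'h)"
    by (intro adj_eqI[symmetric]) (simp add: scalar_op_apply cinner_scaleC_left cinner_scaleC_right)
  assume "t \<in> BH"
  show "scalar_op (s + t) = scalar_op s + (scalar_op t :: 'h \<Rightarrow>\<^sub>L 'h)"
    by (rule blinfun_eqI) (simp add: scalar_op_apply blinfun.add_left scaleC_add_left)
  show "scalar_op (s o\<^sub>L t) = scalar_op s o\<^sub>L (scalar_op t :: 'h \<Rightarrow>\<^sub>L 'h)"
    by (rule blinfun_eqI)
      (simp add: scalar_op_apply scaleC_scaleC BH_complex_apply[OF s, of "blinfun_apply t 1"] mult.commute)
qed

text \<open>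
  This is \<open>\<parallel>S \<otimes> b\<parallel> \<le> \<parallel>S\<parallel> \<parallel>b\<parallel>\<close>: on finitely many coordinates \<open>S \<mapsto> S \<otimes> 1\<close> is a homomorphism
  of C*-algebras.
\<close>

lemma norm_tensor_le:
  fixes S :: "('x, complex) ell2 \<Rightarrow>\<^sub>L ('x, complex) ell2" and T :: "('x, 'h::chilbert_space) ell2 \<Rightarrow>\<^sub>L ('x, 'h) ell2"
  assumes S: "S \<in> BH" and ent: "\<And>x y. entry T x y = blinfun_apply (entry S x y) 1 *\<^sub>C b"
  shows "norm T \<le> norm S * norm b"
proof (rule norm_le_entries)
  show "0 \<le> norm S * norm b" by simp
  fix F :: "'x set" and \<xi> \<eta> :: "('x, 'h) ell2" assume F: "finite F"
  define v where "v = fin_vec F (\<lambda>y. blinfun_apply b (Rep_ell2 \<xi> y))"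
  have "norm v \<le> norm b * norm \<xi>"
  proof (rule power2_le_imp_le)
    have "(norm v)\<^sup>2 \<le> (\<Sum>y\<in>F. (norm b * norm (Rep_ell2 \<xi> y))\<^sup>2)"
      unfolding v_def norm_fin_vec_sq[OF F] by (intro sum_mono power_mono norm_blinfun norm_ge_zero)
    also have "\<dots> \<le> (norm b)\<^sup>2 * (norm \<xi>)\<^sup>2"
      unfolding power_mult_distrib sum_distrib_left[symmetric] by (intro mult_left_mono sum_norm_Rep_le F) simp
    finally show "(norm v)\<^sup>2 \<le> (norm b * norm \<xi>)\<^sup>2" by (simp add: power_mult_distrib)
  qed simp
  define M where "M = fin_op F (\<lambda>x y. scalar_op (entry S x y) :: 'h \<Rightarrow>\<^sub>L 'h)"
  have "norm M \<le> norm (fin_op F (entry S))"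
    unfolding M_def by (rule norm_fin_op_star_hom_le[OF F cstar_algebra_BH star_hom_scalar_op]) (rule entry_BH[OF S])
  also have "\<dots> \<le> norm S" by (rule norm_fin_op_entry_le[OF F])
  finally have M: "norm M \<le> norm S" .
  have "(\<Sum>x\<in>F. \<Sum>y\<in>F. cinner (blinfun_apply (entry T x y) (Rep_ell2 \<xi> y)) (Rep_ell2 \<eta> x)) = cinner (blinfun_apply M v) \<eta>"
    unfolding M_def cinner_fin_op[OF F] v_def
    by (intro sum.cong refl) (simp add: ent Rep_fin_vec[OF F] scalar_op_apply scaleC_blinfun.rep_eq)
  also have "cmod \<dots> \<le> norm (blinfun_apply M v) * norm \<eta>" by (rule cinner_Cauchy_Schwarz)
  also have "\<dots> \<le> (norm S * (norm b * norm \<xi>)) * norm \<eta>"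
    using M \<open>norm v \<le> norm b * norm \<xi>\<close>
    by (intro mult_right_mono order_trans[OF norm_blinfun] mult_mono) simp_all
  finally show "cmod (\<Sum>x\<in>F. \<Sum>y\<in>F. cinner (blinfun_apply (entry T x y) (Rep_ell2 \<xi> y)) (Rep_ell2 \<eta> x))
      \<le> norm S * norm b * norm \<xi> * norm \<eta>" by (simp add: mult_ac)
qed

definition proj_op :: "'x set \<Rightarrow> ('x, 'h::chilbert_space) ell2 \<Rightarrow>\<^sub>L ('x, 'h) ell2" where
  "proj_op F = (\<Sum>x\<in>F. emb x o\<^sub>L coord x)"

lemma proj_op_apply: "blinfun_apply (proj_op F) \<xi> = fin_vec F (Rep_ell2 \<xi>)"
  by (simp add: proj_op_def fin_vec_def blinfun.sum_left)

lemma norm_proj_op_le: "finite F \<Longrightarrow> norm (blinfun_apply (proj_op F) \<xi>) \<le> norm \<xi>"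
  unfolding proj_op_apply by (rule norm_fin_vec_Rep_le)

lemma proj_op_tail:
  assumes "finite C" "0 < \<epsilon>"
  shows "\<exists>F. finite F \<and> (\<forall>\<xi>\<in>C. norm (\<xi> - blinfun_apply (proj_op F) \<xi>) < \<epsilon>)"
proof -
  have "\<forall>\<^sub>F F in finite_subsets_at_top UNIV. norm (\<xi> - blinfun_apply (proj_op F) \<xi>) < \<epsilon>" for \<xi> :: "('a, 'b) ell2"
    using tendstoD[OF tendsto_fin_vec[of \<xi>] assms(2)] by (simp add: dist_norm proj_op_apply norm_minus_commute)
  then have "\<forall>\<^sub>F F in finite_subsets_at_top UNIV. \<forall>\<xi>\<in>C. norm (\<xi> - blinfun_apply (proj_op F) \<xi>) < \<epsilon>"
    using assms(1) by (simp add: eventually_ball_finite)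
  then obtain F where "finite F" and
    *: "\<forall>Y. finite Y \<and> F \<subseteq> Y \<and> Y \<subseteq> UNIV \<longrightarrow> (\<forall>\<xi>\<in>C. norm (\<xi> - blinfun_apply (proj_op Y) \<xi>) < \<epsilon>)"
    unfolding eventually_finite_subsets_at_top by auto
  with *[THEN spec, of F] show ?thesis by (intro exI[of _ F]) simp
qed

text \<open>
  A compact operator is approximated by its finite submatrices: on the rows by total
  boundedness of the image of the unit ball, on the columns because each of the finitely many
  remaining rows is the inner product with a square summable family.
\<close>

lemma compact_op_finite_approximation:
  fixes k :: "('x, complex) ell2 \<Rightarrow>\<^sub>L ('x, complex) ell2"
  assumes k: "k \<in> compact_ops" and \<epsilon>: "0 < \<epsilon>"
  obtains E F where "finite E" "finite F" "norm (k - (proj_op E o\<^sub>L k o\<^sub>L proj_op F)) \<le> \<epsilon>"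
proof -
  have kB: "k \<in> BH" and cc: "compact (closure (blinfun_apply k ` cball 0 1))" using k by (auto simp: compact_ops_def)
  from cc have "seq_compact (closure (blinfun_apply k ` cball 0 1))" by (rule compact_imp_seq_compact)
  from seq_compact_imp_totally_bounded[OF this, rule_format, of "\<epsilon> / 6"]
  obtain C where C: "finite C" "closure (blinfun_apply k ` cball 0 1) \<subseteq> (\<Union>c\<in>C. ball c (\<epsilon> / 6))"
    using \<epsilon> by auto
  obtain E where E: "finite E" "\<And>c. c \<in> C \<Longrightarrow> norm (c - blinfun_apply (proj_op E) c) < \<epsilon> / 6"
    using proj_op_tail[OF C(1), of "\<epsilon> / 6"] \<epsilon> by auto
  have rows: "norm (k - (proj_op E o\<^sub>L k)) \<le> \<epsilon> / 2"
  proof (rule norm_blinfun_bound)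
    fix \<xi>
    show "norm (blinfun_apply (k - (proj_op E o\<^sub>L k)) \<xi>) \<le> \<epsilon> / 2 * norm \<xi>"
    proof (cases "\<xi> = 0")
      case False
      define u where "u = blinfun_apply k ((1 / norm \<xi>) *\<^sub>R \<xi>)"
      have "(1 / norm \<xi>) *\<^sub>R \<xi> \<in> cball 0 1" using False by simp
      then have "u \<in> closure (blinfun_apply k ` cball 0 1)" unfolding u_def
        by (intro subsetD[OF closure_subset] imageI)
      then obtain c where c: "c \<in> C" "norm (u - c) < \<epsilon> / 6" using C(2) by (auto simp: dist_norm norm_minus_commute)
      have "u - blinfun_apply (proj_op E) u
          = (u - c) + (c - blinfun_apply (proj_op E) c) + blinfun_apply (proj_op E) (c - u)"
        by (simp add: blinfun.diff_right)
      then have "norm (u - blinfun_apply (proj_op E) u)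
          \<le> norm (u - c) + norm (c - blinfun_apply (proj_op E) c) + norm (blinfun_apply (proj_op E) (c - u))"
        by (simp only:) (intro norm_triangle_mono order_refl)
      also have "norm (blinfun_apply (proj_op E) (c - u)) \<le> norm (u - c)"
        using norm_proj_op_le[OF E(1), of "c - u"] by (simp add: norm_minus_commute)
      finally have "norm (u - blinfun_apply (proj_op E) u) \<le> \<epsilon> / 2" using c(2) E(2)[OF c(1)] by linarith
      moreover have "blinfun_apply (k - (proj_op E o\<^sub>L k)) \<xi> = norm \<xi> *\<^sub>R (u - blinfun_apply (proj_op E) u)"
        using False by (simp add: u_def blinfun.diff_left blinfun.scaleR_right scaleR_diff_right)
      ultimately show ?thesis
        using mult_left_mono[of "norm (u - blinfun_apply (proj_op E) u)" "\<epsilon> / 2" "norm \<xi>"]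
        by (simp add: mult.commute)
    qed simp
  qed (use \<epsilon> in simp)
  have "\<exists>w. \<forall>\<xi>. Rep_ell2 (blinfun_apply k \<xi>) x = cinner \<xi> w" for x
  proof (rule Riesz_representation)
    show "bounded_linear (\<lambda>\<xi>. Rep_ell2 (blinfun_apply k \<xi>) x)"
      using blinfun.bounded_linear_right[of "coord x o\<^sub>L k"] by simp
    show "Rep_ell2 (blinfun_apply k (c *\<^sub>C \<xi>)) x = c * Rep_ell2 (blinfun_apply k \<xi>) x" for c \<xi>
      by (simp add: BH_scaleC[OF kB] ell2_rep scaleC_complex_def)
  qed
  then obtain w where w: "\<And>x \<xi>. Rep_ell2 (blinfun_apply k \<xi>) x = cinner \<xi> (w x)" by metis
  define \<delta> where "\<delta> = \<epsilon> / (2 * (real (card E) + 1))"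
  have \<delta>: "0 < \<delta>" "real (card E) * \<delta> \<le> \<epsilon> / 2" using \<epsilon> by (simp_all add: \<delta>_def field_simps)
  obtain F where F: "finite F" "\<And>x. x \<in> E \<Longrightarrow> norm (w x - blinfun_apply (proj_op F) (w x)) < \<delta>"
    using proj_op_tail[of "w ` E" \<delta>] E(1) \<delta>(1) by auto
  have cols: "norm ((proj_op E o\<^sub>L k) - (proj_op E o\<^sub>L k o\<^sub>L proj_op F)) \<le> \<epsilon> / 2"
  proof (rule norm_blinfun_bound)
    fix \<xi>
    have comp: "Rep_ell2 (blinfun_apply k (\<xi> - blinfun_apply (proj_op F) \<xi>)) x
        = cinner \<xi> (w x - blinfun_apply (proj_op F) (w x))" for x
    proof -
      have "cinner (blinfun_apply (proj_op F) \<xi>) (w x) = cinner \<xi> (blinfun_apply (proj_op F) (w x))"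
        unfolding proj_op_apply cinner_fin_vec
        by (subst (2) cinner_commute) (simp add: cinner_fin_vec cinner_commute[symmetric])
      then show ?thesis by (simp add: w cinner_diff_left cinner_diff_right)
    qed
    have "blinfun_apply ((proj_op E o\<^sub>L k) - (proj_op E o\<^sub>L k o\<^sub>L proj_op F)) \<xi>
        = fin_vec E (\<lambda>x. cinner \<xi> (w x - blinfun_apply (proj_op F) (w x)))"
    proof -
      have "blinfun_apply ((proj_op E o\<^sub>L k) - (proj_op E o\<^sub>L k o\<^sub>L proj_op F)) \<xi>
          = blinfun_apply (proj_op E) (blinfun_apply k (\<xi> - blinfun_apply (proj_op F) \<xi>))"
        by (simp add: blinfun.diff_left blinfun.diff_right)
      then show ?thesis unfolding proj_op_apply[of E] fin_vec_def comp .
    qed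
    also have "norm \<dots> \<le> (\<Sum>x\<in>E. norm (cinner \<xi> (w x - blinfun_apply (proj_op F) (w x))))"
      unfolding fin_vec_def by (rule order_trans[OF norm_sum]) (simp add: norm_emb_vec)
    also have "\<dots> \<le> (\<Sum>x\<in>E. norm \<xi> * \<delta>)"
      using F(2) by (intro sum_mono order_trans[OF cinner_Cauchy_Schwarz] mult_left_mono) (auto intro: less_imp_le)
    also have "\<dots> \<le> \<epsilon> / 2 * norm \<xi>"
      using mult_right_mono[OF \<delta>(2) norm_ge_zero[of \<xi>]] by (simp add: mult_ac)
    finally show "norm (blinfun_apply ((proj_op E o\<^sub>L k) - (proj_op E o\<^sub>L k o\<^sub>L proj_op F)) \<xi>) \<le> \<epsilon> / 2 * norm \<xi>" .
  qed (use \<epsilon> in simp)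
  have total: "norm (k - (proj_op E o\<^sub>L k o\<^sub>L proj_op F)) \<le> \<epsilon>"
    using norm_triangle_ineq[of "k - (proj_op E o\<^sub>L k)" "(proj_op E o\<^sub>L k) - (proj_op E o\<^sub>L k o\<^sub>L proj_op F)"] rows cols
    by simp
  show thesis by (rule that[OF E(1) F(1) total])
qed

lemma entry_proj_compress:
  fixes k :: "('x, 'h::chilbert_space) ell2 \<Rightarrow>\<^sub>L ('x, 'h) ell2"
  assumes "finite E" "finite F"
  shows "entry (proj_op E o\<^sub>L k o\<^sub>L proj_op F) x y = (if x \<in> E \<and> y \<in> F then entry k x y else 0)"
proof -
  have "fin_vec F (Rep_ell2 (emb_vec y h)) = (if y \<in> F then emb_vec y h else 0)" for h :: 'h
    by (rule ell2_eqI) (auto simp: Rep_fin_vec assms ell2_rep)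
  then show ?thesis
    by (intro blinfun_eqI) (auto simp: entry_apply proj_op_apply Rep_fin_vec assms zero_ell2.rep_eq)
qed

lemma tensor_vec_emb: "tensor_vec (emb_vec y c) h = emb_vec y (c *\<^sub>C h)"
  by (rule ell2_eqI) (simp add: tensor_vec.rep_eq ell2_rep)

lemma closed_compact_tensor: "closed (compact_tensor A)" by (simp add: compact_tensor_def)

lemma csubspace_compact_tensor: "csubspace (compact_tensor A)"
  unfolding compact_tensor_def by (rule csubspace_closure[OF complex_module.subspace_span])

lemma elementary_in_compact_tensor:
  fixes a :: "'h::chilbert_space \<Rightarrow>\<^sub>L 'h"
  assumes a: "a \<in> A" and A: "A \<subseteq> BH"
  shows "emb x o\<^sub>L a o\<^sub>L coord y \<in> compact_tensor A"
proof -
  have aB: "a \<in> BH" using a A by blast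
  define k :: "('a, complex) ell2 \<Rightarrow>\<^sub>L ('a, complex) ell2" where "k = emb x o\<^sub>L coord y"
  have "k \<in> compact_ops"
  proof -
    have "k \<in> BH" by (simp add: BH_def k_def ell2_rep emb_vec_scaleC)
    moreover have "compact (closure (blinfun_apply k ` cball 0 1))"
    proof -
      have c: "compact (emb_vec x ` cball (0::complex) 1 :: ('a, complex) ell2 set)"
        by (rule compact_continuous_image[OF _ compact_cball])
          (use linear_continuous_on[OF blinfun.bounded_linear_right[of "emb x :: complex \<Rightarrow>\<^sub>L ('a, complex) ell2"]] in simp)
      have "blinfun_apply k ` cball 0 1 \<subseteq> emb_vec x ` cball 0 1"
      proof (rule image_subsetI)
        fix \<xi> :: "('a, complex) ell2" assume "\<xi> \<in> cball 0 1"
        then have "Rep_ell2 \<xi> y \<in> cball 0 1" using norm_Rep_ell2_le[of \<xi> y] by simp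
        then show "blinfun_apply k \<xi> \<in> emb_vec x ` cball 0 1" by (simp add: k_def)
      qed
      then have "closure (blinfun_apply k ` cball 0 1) \<subseteq> emb_vec x ` cball 0 1"
        by (rule closure_minimal[OF _ compact_imp_closed[OF c]])
      then have eq: "closure (blinfun_apply k ` cball 0 1) = emb_vec x ` cball 0 1 \<inter> closure (blinfun_apply k ` cball 0 1)"
        by blast
      show ?thesis by (subst eq) (rule compact_Int_closed[OF c closed_closure])
    qed
    ultimately show ?thesis by (simp add: compact_ops_def)
  qed
  moreover have "emb x o\<^sub>L a o\<^sub>L coord y \<in> BH" by (simp add: BH_def ell2_rep BH_scaleC[OF aB] emb_vec_scaleC)
  moreover have "blinfun_apply (emb x o\<^sub>L a o\<^sub>L coord y) (tensor_vec \<xi> \<eta>) = tensor_vec (blinfun_apply k \<xi>) (blinfun_apply a \<eta>)" for \<xi> \<eta>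
    by (rule ell2_eqI) (simp add: k_def tensor_vec.rep_eq ell2_rep BH_scaleC[OF aB])
  ultimately have "emb x o\<^sub>L a o\<^sub>L coord y \<in> {T \<in> BH. \<exists>k \<in> compact_ops. \<exists>b \<in> A.
     \<forall>\<xi> \<eta>. blinfun_apply T (tensor_vec \<xi> \<eta>) = tensor_vec (blinfun_apply k \<xi>) (blinfun_apply b \<eta>)}"
    using a by blast
  then have "emb x o\<^sub>L a o\<^sub>L coord y \<in> cspan {T \<in> BH. \<exists>k \<in> compact_ops. \<exists>b \<in> A.
     \<forall>\<xi> \<eta>. blinfun_apply T (tensor_vec \<xi> \<eta>) = tensor_vec (blinfun_apply k \<xi>) (blinfun_apply b \<eta>)}"
    by (rule complex_module.span_base)
  then show ?thesis unfolding compact_tensor_def by (rule subsetD[OF closure_subset])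
qed

lemma kernel_op_in_compact_tensor:
  assumes k: "k \<in> ell2_kernels A" and A: "A \<subseteq> BH"
  shows "kernel_op k \<in> compact_tensor A"
proof (rule Lim_in_closed_set[OF closed_compact_tensor _ finite_subsets_at_top_neq_bot kernel_op_finite_approximation])
  show "hs_kernel k" using k by (simp add: ell2_kernels_iff)
  have "(\<Sum>(x, y)\<in>F. emb x o\<^sub>L k x y o\<^sub>L coord y) \<in> compact_tensor A" for F
    using k by (intro complex_module.subspace_sum[OF csubspace_compact_tensor])
      (auto simp: ell2_kernels_iff intro!: elementary_in_compact_tensor A)
  then show "\<forall>\<^sub>F F in finite_subsets_at_top UNIV. (\<Sum>(x, y)\<in>F. emb x o\<^sub>L k x y o\<^sub>L coord y) \<in> compact_tensor A"
    by simp
qed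

text \<open>
  A generator \<open>k \<otimes> b\<close> differs in norm from \<open>k' \<otimes> b\<close> by at most \<open>\<parallel>k - k'\<parallel> \<parallel>b\<parallel>\<close>, and a finite
  matrix \<open>k'\<close> gives an operator with finitely supported kernel. Conversely an operator with square
  summable kernel is the limit of the finite sums of its entries.
\<close>

lemma compact_tensor_eq_closure:
  fixes A :: "('h::chilbert_space \<Rightarrow>\<^sub>L 'h) set"
  assumes A: "cstar_algebra A"
  shows "compact_tensor A = closure (kernel_op ` ell2_kernels A :: (('x, 'h) ell2 \<Rightarrow>\<^sub>L ('x, 'h) ell2) set)"
    (is "_ = closure ?K")
proof
  have "?K \<subseteq> compact_tensor A" using kernel_op_in_compact_tensor cstar_BH[OF A] by blast
  then show "closure ?K \<subseteq> compact_tensor A" by (rule closure_minimal[OF _ closed_compact_tensor])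
  have cs: "csubspace (closure ?K)" by (intro csubspace_closure csubspace_kernel_ops csubspace_cstar A)
  have "T \<in> closure ?K"
    if k: "k \<in> compact_ops" and b: "b \<in> A"
      and T: "\<And>\<xi> \<eta>. blinfun_apply T (tensor_vec \<xi> \<eta>) = tensor_vec (blinfun_apply k \<xi>) (blinfun_apply b \<eta>)"
    for T k b
    unfolding closure_approachable
  proof (intro allI impI)
    fix \<epsilon> :: real assume \<epsilon>: "0 < \<epsilon>"
    have kB: "k \<in> BH" using k by (simp add: compact_ops_def)
    define \<epsilon>' where "\<epsilon>' = \<epsilon> / (norm b + 1)"
    have \<epsilon>': "0 < \<epsilon>'" "\<epsilon>' * norm b < \<epsilon>"
    proof -
      have pos: "0 < norm b + 1" by (simp add: add_nonneg_pos)
      show "0 < \<epsilon>'" unfolding \<epsilon>'_def by (rule divide_pos_pos[OF \<epsilon> pos])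
      then have "\<epsilon>' * norm b < \<epsilon>' * (norm b + 1)" by simp
      also have "\<dots> = \<epsilon>" using pos by (simp add: \<epsilon>'_def)
      finally show "\<epsilon>' * norm b < \<epsilon>" .
    qed
    obtain E F where EF: "finite E" "finite F" and le: "norm (k - (proj_op E o\<^sub>L k o\<^sub>L proj_op F)) \<le> \<epsilon>'"
      by (rule compact_op_finite_approximation[OF k \<epsilon>'(1)])
    let ?S = "k - (proj_op E o\<^sub>L k o\<^sub>L proj_op F)"
    have projB: "proj_op G \<in> BH" if "finite G" for G :: "'x set"
      by (auto simp: BH_def proj_op_apply Rep_fin_vec that ell2_rep intro!: ell2_eqI)
    have S: "?S \<in> BH"
      using csubspace_diff[OF csubspace_cstar[OF cstar_algebra_BH] kB] BH_compose[OF BH_compose[OF projB kB] projB] EF by blast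
    define m where "m x y = (if x \<in> E \<and> y \<in> F then blinfun_apply (entry k x y) 1 *\<^sub>C b else 0)" for x y
    have m: "hs_kernel m" by (rule hs_kernel_finite_support[of "E \<times> F"]) (use EF in \<open>auto simp: m_def\<close>)
    have entT: "entry T x y = blinfun_apply (entry k x y) 1 *\<^sub>C b" for x y
    proof (rule blinfun_eqI)
      fix h
      have "blinfun_apply T (emb_vec y h) = tensor_vec (blinfun_apply k (emb_vec y 1)) (blinfun_apply b h)"
        using T[of "emb_vec y 1" h] by (simp add: tensor_vec_emb)
      then show "blinfun_apply (entry T x y) h = blinfun_apply (blinfun_apply (entry k x y) 1 *\<^sub>C b) h"
        by (simp add: entry_apply tensor_vec.rep_eq scaleC_blinfun.rep_eq)
    qed
    have "entry (T - kernel_op m) x y = blinfun_apply (entry ?S x y) 1 *\<^sub>C b" for x y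
      by (simp add: entry_diff entT entry_kernel_op[OF m] m_def entry_proj_compress[OF EF])
    then have "norm (T - kernel_op m) \<le> norm ?S * norm b" by (rule norm_tensor_le[OF S])
    also have "\<dots> \<le> \<epsilon>' * norm b" by (rule mult_right_mono[OF le norm_ge_zero])
    also have "\<dots> < \<epsilon>" by (rule \<epsilon>'(2))
    finally have "dist (kernel_op m) T < \<epsilon>" by (simp add: dist_norm norm_minus_commute)
    moreover have "m \<in> ell2_kernels A" using m b by (auto simp: ell2_kernels_iff m_def cstar_zero[OF A] cstar_scaleC[OF A])
    ultimately show "\<exists>S\<in>?K. dist S T < \<epsilon>" by blast
  qed
  then have "{T \<in> BH. \<exists>k \<in> compact_ops. \<exists>b \<in> A. \<forall>\<xi> \<eta>. blinfun_apply T (tensor_vec \<xi> \<eta>)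
      = tensor_vec (blinfun_apply k \<xi>) (blinfun_apply b \<eta>)} \<subseteq> closure ?K" by blast
  from complex_module.span_minimal[OF this cs] show "compact_tensor A \<subseteq> closure ?K"
    unfolding compact_tensor_def by (rule closure_minimal) simp
qed

section \<open>Schur maps\<close>

lemma schur_map0_kernel_op:
  assumes "k \<in> ell2_kernels A" shows "schur_map0 A \<phi> (kernel_op k) = kernel_op (\<lambda>x y. \<phi> x y (k x y))"
proof -
  have "(THE k'. k' \<in> ell2_kernels A \<and> kernel_op k' = kernel_op k) = k"
  proof (rule the_equality)
    fix k' assume k': "k' \<in> ell2_kernels A \<and> kernel_op k' = kernel_op k"
    show "k' = k"
    proof (intro ext)
      fix x y
      show "k' x y = k x y"
        using entry_kernel_op[of k' x y] entry_kernel_op[of k x y] k' assms by (simp add: ell2_kernels_iff)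
    qed
  qed (use assms in simp)
  then show ?thesis by (simp add: schur_map0_def)
qed

lemma bounded_CB_family_bound:
  assumes A: "csubspace A" and fam: "bounded_CB_family A W F"
  obtains C where "0 \<le> C" "\<And>i a. a \<in> A \<Longrightarrow> norm (F i a) \<le> C * norm a"
proof -
  obtain C where C: "\<And>i. cb_norm A (F i) \<le> C" using fam by (auto simp: bounded_CB_family_def bdd_above_def)
  have FCB: "F i \<in> CB A W" for i using fam by (auto simp: bounded_CB_family_def)
  have "norm (F i a) \<le> C * norm a" if "a \<in> A" for i a
    using norm_le_cb_norm[OF FCB that csubspace_scaleR[OF A]] mult_right_mono[OF C[of i] norm_ge_zero[of a]]
    by (meson order_trans)
  moreover have "0 \<le> C" using cb_norm_nonneg[OF CB_D(2)[OF FCB]] C order_trans by blast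
  ultimately show thesis using that by blast
qed

lemma schur_map0_entrywise:
  fixes \<phi> :: "'x \<Rightarrow> 'x \<Rightarrow> ('h \<Rightarrow>\<^sub>L 'h) \<Rightarrow> 'h::chilbert_space \<Rightarrow>\<^sub>L 'h"
  assumes A: "cstar_algebra A" and fam: "bounded_CB_family A BH (case_prod \<phi>)"
  shows "k \<in> ell2_kernels A \<Longrightarrow> (\<lambda>x y. \<phi> x y (k x y)) \<in> ell2_kernels BH"
    and "acts_entrywise A \<phi> (kernel_op ` ell2_kernels A) (schur_map0 A \<phi>)"
proof -
  obtain C where C: "0 \<le> C" "\<And>i a. a \<in> A \<Longrightarrow> norm (case_prod \<phi> i a) \<le> C * norm a"
    by (rule bounded_CB_family_bound[OF csubspace_cstar[OF A] fam]) blast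
  have \<phi>B: "\<phi> x y a \<in> BH" if "a \<in> A" for x y a
    by (rule CB_D(3)[OF bounded_CB_family_CB[OF fam] that])
  show mem: "(\<lambda>x y. \<phi> x y (k x y)) \<in> ell2_kernels BH" if k: "k \<in> ell2_kernels A" for k
  proof -
    have kA: "k x y \<in> A" for x y using k by (simp add: ell2_kernels_iff)
    have s: "(\<lambda>p. C\<^sup>2 * (norm (k (fst p) (snd p)))\<^sup>2) summable_on UNIV"
      using k by (intro summable_on_cmult_right) (simp add: ell2_kernels_iff hs_kernel_def case_prod_unfold)
    have "(\<lambda>p. (norm (\<phi> (fst p) (snd p) (k (fst p) (snd p))))\<^sup>2) summable_on UNIV"
    proof (rule summable_on_comparison_test[OF s])
      fix p :: "'x \<times> 'x"
      have "norm (\<phi> (fst p) (snd p) (k (fst p) (snd p))) \<le> C * norm (k (fst p) (snd p))"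
        using C(2)[OF kA, of p] by (simp add: case_prod_unfold)
      then have "(norm (\<phi> (fst p) (snd p) (k (fst p) (snd p))))\<^sup>2 \<le> (C * norm (k (fst p) (snd p)))\<^sup>2"
        by (rule power_mono) simp
      then show "(norm (\<phi> (fst p) (snd p) (k (fst p) (snd p))))\<^sup>2 \<le> C\<^sup>2 * (norm (k (fst p) (snd p)))\<^sup>2"
        by (simp add: power_mult_distrib)
    qed simp
    then show ?thesis using \<phi>B kA by (simp add: ell2_kernels_iff hs_kernel_def case_prod_unfold)
  qed
  show "acts_entrywise A \<phi> (kernel_op ` ell2_kernels A) (schur_map0 A \<phi>)"
    unfolding acts_entrywise_def
  proof (intro ballI allI)
    fix T :: "('x, 'h) ell2 \<Rightarrow>\<^sub>L ('x, 'h) ell2" and x y assume "T \<in> kernel_op ` ell2_kernels A"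
    then obtain k where k: "k \<in> ell2_kernels A" "T = kernel_op k" by blast
    show "entry T x y \<in> A \<and> entry (schur_map0 A \<phi> T) x y = \<phi> x y (entry T x y)"
      using k mem[OF k(1)] by (simp add: schur_map0_kernel_op entry_kernel_op ell2_kernels_iff)
  qed
qed

lemma schur_map_entrywise:
  fixes \<phi> :: "'x \<Rightarrow> 'x \<Rightarrow> ('h \<Rightarrow>\<^sub>L 'h) \<Rightarrow> 'h::chilbert_space \<Rightarrow>\<^sub>L 'h"
  assumes A: "cstar_algebra A" and sm: "schur_multiplier A \<phi>"
  shows "schur_map A \<phi> \<in> CB (compact_tensor A) (compact_tensor BH)"
    and "acts_entrywise A \<phi> (compact_tensor A) (schur_map A \<phi>)"
proof -
  have fam: "bounded_CB_family A BH (case_prod \<phi>)"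
    and cb: "schur_map0 A \<phi> \<in> CB (kernel_op ` ell2_kernels A) (compact_tensor BH)"
    using sm by (auto simp: schur_multiplier_def)
  have cs: "csubspace (kernel_op ` ell2_kernels A :: (('x, 'h) ell2 \<Rightarrow>\<^sub>L ('x, 'h) ell2) set)"
    by (rule csubspace_kernel_ops[OF csubspace_cstar[OF A]])
  note ext = cb_extension_works[OF cb cs closed_compact_tensor compact_tensor_eq_closure[OF A], folded schur_map_def]
  show 1: "schur_map A \<phi> \<in> CB (compact_tensor A) (compact_tensor BH)" by (rule ext(1))
  have "acts_entrywise A \<phi> (kernel_op ` ell2_kernels A) (schur_map A \<phi>)"
    using schur_map0_entrywise(2)[OF A fam] ext(2) by (simp add: acts_entrywise_def)
  then show "acts_entrywise A \<phi> (compact_tensor A) (schur_map A \<phi>)"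
    using 1 unfolding compact_tensor_eq_closure[OF A]
    by (rule acts_entrywise_closure[OF A bounded_CB_family_CB[OF fam] _ cs])
qed

lemma positive_type_imp_schur_multiplier:
  fixes \<phi> :: "'x \<Rightarrow> 'x \<Rightarrow> ('h \<Rightarrow>\<^sub>L 'h) \<Rightarrow> 'h::chilbert_space \<Rightarrow>\<^sub>L 'h"
  assumes A: "cstar_algebra A" and \<phi>: "positive_type A \<phi>"
  shows "schur_multiplier A \<phi>" "completely_positive (compact_tensor A) (schur_map A \<phi>)"
proof -
  have fam: "bounded_CB_family A BH (case_prod \<phi>)" using \<phi> by (simp add: positive_type_def)
  obtain C where C: "0 \<le> C" "\<And>i a. a \<in> A \<Longrightarrow> norm (case_prod \<phi> i a) \<le> C * norm a"
    by (rule bounded_CB_family_bound[OF csubspace_cstar[OF A] fam]) blast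
  have diag: "norm (\<phi> x x b) \<le> C * norm b" if "b \<in> A" for x b using C(2)[OF that, of "(x, x)"] by simp
  have "completely_bounded (kernel_op ` ell2_kernels A) (schur_map0 A \<phi>)"
    by (rule cb_norm_le(2)[OF C(1)]) (rule acts_entrywise_norm[OF A \<phi> schur_map0_entrywise(2)[OF A fam] C(1) diag])
  moreover have "schur_map0 A \<phi> ` kernel_op ` ell2_kernels A \<subseteq> compact_tensor BH"
    using schur_map0_entrywise(1)[OF A fam] by (auto simp: schur_map0_kernel_op intro!: kernel_op_in_compact_tensor)
  moreover have "clinear_on (kernel_op ` ell2_kernels A) (schur_map0 A \<phi>)"
    by (rule acts_entrywise_clinear[OF schur_map0_entrywise(2)[OF A fam]
          csubspace_kernel_ops[OF csubspace_cstar[OF A]] CB_D(1)[OF bounded_CB_family_CB[OF fam]]])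
  ultimately show sm: "schur_multiplier A \<phi>"
    unfolding schur_multiplier_def CB_def using fam by blast
  note E = schur_map_entrywise[OF A sm]
  show "completely_positive (compact_tensor A) (schur_map A \<phi>)"
    unfolding completely_positive_def using CB_D(1)[OF E(1)] acts_entrywise_positive[OF \<phi> E(2)] by blast
qed

lemma elementary_matrix:
  fixes x :: "nat \<Rightarrow> 'x" and a :: "nat \<Rightarrow> nat \<Rightarrow> 'h::chilbert_space \<Rightarrow>\<^sub>L 'h"
  shows "mat_norm n (\<lambda>p q. emb (x p) o\<^sub>L a p q o\<^sub>L coord (x q)) \<le> mat_norm n a"
    and "mat_positive n a \<Longrightarrow> mat_positive n (\<lambda>p q. emb (x p) o\<^sub>L a p q o\<^sub>L coord (x q))"
proof -
  note * = fin_op_conjugate[OF finite_lessThan, where V = "\<lambda>p. emb (x p)" and W = "\<lambda>p. coord (x p)" and S = a,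
      OF cinner_coord_emb(1)]
  have W: "norm (blinfun_apply (coord y) k) \<le> norm k" for y :: 'x and k :: "('x, 'h) ell2"
    by (simp add: norm_Rep_ell2_le)
  show "mat_norm n (\<lambda>p q. emb (x p) o\<^sub>L a p q o\<^sub>L coord (x q)) \<le> mat_norm n a"
    unfolding mat_norm_eq by (rule *(1)[OF W])
  show "mat_positive n a \<Longrightarrow> mat_positive n (\<lambda>p q. emb (x p) o\<^sub>L a p q o\<^sub>L coord (x q))"
    unfolding mat_positive_eq by (rule *(2)[OF W])
qed

lemma cstar_subset_BH: "cstar_algebra A \<Longrightarrow> A \<subseteq> BH" by (simp add: cstar_algebra_def)

lemma elementary_matrix_mats:
  assumes A: "cstar_algebra A" and a: "a \<in> mats n A"
  shows "(\<lambda>p q. emb (x p) o\<^sub>L a p q o\<^sub>L coord (x q)) \<in> mats n (compact_tensor A)"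
  using a by (simp add: mats_def elementary_in_compact_tensor[OF _ cstar_subset_BH[OF A]])

lemma schur_completely_positive_imp_positive_type:
  fixes \<phi> :: "'x \<Rightarrow> 'x \<Rightarrow> ('h \<Rightarrow>\<^sub>L 'h) \<Rightarrow> 'h::chilbert_space \<Rightarrow>\<^sub>L 'h"
  assumes A: "cstar_algebra A" and sm: "schur_multiplier A \<phi>"
    and cp: "completely_positive (compact_tensor A) (schur_map A \<phi>)"
  shows "positive_type A \<phi>"
proof (rule positive_typeI_entrywise[OF _ schur_map_entrywise(2)[OF A sm] cp])
  show "bounded_CB_family A BH (case_prod \<phi>)" using sm by (simp add: schur_multiplier_def)
  fix m x a assume a: "a \<in> mats m A" "mat_positive m a"
  show "\<exists>T\<in>mats m (compact_tensor A). mat_positive m T \<and> (\<forall>p<m. \<forall>q<m. entry (T p q) (x p) (x q) = a p q)"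
    by (rule bexI[OF _ elementary_matrix_mats[OF A a(1), of x]]) (simp add: elementary_matrix(2) a(2) entry_elementary)
qed

lemma cb_norm_schur_ge:
  fixes \<phi> :: "'x \<Rightarrow> 'x \<Rightarrow> ('h \<Rightarrow>\<^sub>L 'h) \<Rightarrow> 'h::chilbert_space \<Rightarrow>\<^sub>L 'h"
  assumes A: "cstar_algebra A" and sm: "schur_multiplier A \<phi>"
  shows "cb_norm A (\<phi> x x) \<le> cb_norm (compact_tensor A) (schur_map A \<phi>)"
proof (rule cb_norm_le_entrywise[OF schur_map_entrywise(2)[OF A sm] CB_D(2)[OF schur_map_entrywise(1)[OF A sm]]])
  fix n a assume a: "a \<in> mats n A"
  show "\<exists>T\<in>mats n (compact_tensor A). mat_norm n T \<le> mat_norm n a \<and> (\<forall>p<n. \<forall>q<n. entry (T p q) x x = a p q)"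
    by (rule bexI[OF _ elementary_matrix_mats[OF A a, of "\<lambda>_. x"]]) (simp add: elementary_matrix(1) entry_elementary)
qed

section \<open>The reduced crossed product\<close>

lemma bij_betw_translation: "bij_betw (\<lambda>s. t + s) UNIV (UNIV :: 'g::group_add set)"
  by (rule bij_betw_byWitness[where f' = "\<lambda>s. - t + s"]) (auto simp: add.assoc[symmetric])

lemma shift_op_apply:
  fixes \<xi> :: "('g::group_add, 'h::chilbert_space) ell2"
  shows "Rep_ell2 (blinfun_apply (shift_op t) \<xi>) s = Rep_ell2 \<xi> (- t + s)"
    and "norm (blinfun_apply (shift_op t) \<xi>) = norm \<xi>"
proof -
  have summ: "(\<lambda>s. (norm (Rep_ell2 \<xi> (- t + s)))\<^sup>2) summable_on UNIV" for \<xi> :: "('g, 'h) ell2"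
    using ell2_summable[of \<xi>] summable_on_reindex_bij_betw[OF bij_betw_translation[of "- t"], of "\<lambda>s. (norm (Rep_ell2 \<xi> s))\<^sup>2"]
    by simp
  define S where "S \<xi> = Abs_ell2 (\<lambda>s. Rep_ell2 \<xi> (- t + s))" for \<xi> :: "('g, 'h) ell2"
  have rep: "Rep_ell2 (S \<xi>) s = Rep_ell2 \<xi> (- t + s)" for \<xi> s
    unfolding S_def by (subst Abs_ell2_inverse) (simp_all add: summ)
  have norm: "norm (S \<xi>) = norm \<xi>" for \<xi>
    unfolding norm_ell2_def rep
    using infsum_reindex_bij_betw[OF bij_betw_translation[of "- t"], of "\<lambda>s. (norm (Rep_ell2 \<xi> s))\<^sup>2"] by simp
  have "bounded_linear S"
    by (rule bounded_linear_intro[where K = 1]) (auto intro!: ell2_eqI simp: rep ell2_rep norm)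
  then have app: "blinfun_apply (shift_op t) \<xi> = S \<xi>" for \<xi>
    unfolding shift_op_def by (simp add: bounded_linear_Blinfun_apply S_def[abs_def])
  show "Rep_ell2 (blinfun_apply (shift_op t) \<xi>) s = Rep_ell2 \<xi> (- t + s)" by (simp add: app rep)
  show "norm (blinfun_apply (shift_op t) \<xi>) = norm \<xi>" by (simp add: app norm)
qed

lemma cinner_shift_op:
  "cinner (blinfun_apply (shift_op t) \<xi>) \<eta> = cinner \<xi> (blinfun_apply (shift_op (- t)) \<eta>)"
proof -
  have "cinner (blinfun_apply (shift_op t) \<xi>) \<eta>
      = (\<Sum>\<^sub>\<infinity>s. cinner (Rep_ell2 (blinfun_apply (shift_op t) \<xi>) (t + s)) (Rep_ell2 \<eta> (t + s)))"
    unfolding cinner_ell2_def by (rule infsum_reindex_bij_betw[OF bij_betw_translation, symmetric])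
  then show ?thesis by (simp add: cinner_ell2_def shift_op_apply add.assoc[symmetric])
qed

lemma group_action_star_hom:
  assumes A: "cstar_algebra A" and \<alpha>: "group_action A \<alpha>"
  shows "star_hom A (\<alpha> s)" and "a \<in> A \<Longrightarrow> \<alpha> s a \<in> A"
proof -
  have aut: "is_automorphism A (\<alpha> s)" using \<alpha> by (simp add: group_action_def)
  then have "\<alpha> s ` A = A" by (simp add: is_automorphism_def bij_betw_def)
  then show "a \<in> A \<Longrightarrow> \<alpha> s a \<in> A" by blast
  show "star_hom A (\<alpha> s)"
    using aut \<open>\<alpha> s ` A = A\<close> cstar_subset_BH[OF A] by (simp add: star_hom_def is_automorphism_def)
qed

lemma group_action_zero:
  assumes \<alpha>: "group_action A \<alpha>" and a: "a \<in> A" shows "\<alpha> 0 a = a"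
proof -
  have bij: "bij_betw (\<alpha> 0) A A" using \<alpha> by (simp add: group_action_def is_automorphism_def)
  have "\<alpha> (0 + 0) a = \<alpha> 0 (\<alpha> 0 a)" using \<alpha> a unfolding group_action_def by blast
  then have "\<alpha> 0 (\<alpha> 0 a) = \<alpha> 0 a" by simp
  moreover have "\<alpha> 0 a \<in> A" using bij a by (auto simp: bij_betw_def)
  ultimately show ?thesis using bij a by (auto simp: bij_betw_def dest: inj_onD)
qed

lemma group_action_add: "group_action A \<alpha> \<Longrightarrow> a \<in> A \<Longrightarrow> \<alpha> s (\<alpha> t a) = \<alpha> (s + t) a"
  by (simp add: group_action_def)

lemma group_action_inverse:
  assumes "group_action A \<alpha>" "a \<in> A" shows "\<alpha> (- s) (\<alpha> s a) = a" "\<alpha> s (\<alpha> (- s) a) = a"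
  using assms by (simp_all add: group_action_add group_action_zero)

lemma pi_op_apply:
  fixes \<alpha> :: "'g::group_add \<Rightarrow> ('h::chilbert_space \<Rightarrow>\<^sub>L 'h) \<Rightarrow> 'h \<Rightarrow>\<^sub>L 'h"
  assumes A: "cstar_algebra A" and \<alpha>: "group_action A \<alpha>" and a: "a \<in> A"
  shows "Rep_ell2 (blinfun_apply (pi_op \<alpha> a) \<xi>) s = blinfun_apply (\<alpha> (- s) a) (Rep_ell2 \<xi> s)"
proof -
  have le: "norm (blinfun_apply (\<alpha> (- s) a) h) \<le> norm a * norm h" for s h
    using star_hom_contractive[OF A group_action_star_hom(1)[OF A \<alpha>] a, of "- s"]
    by (intro order_trans[OF norm_blinfun] mult_right_mono) auto
  have sq: "(norm (blinfun_apply (\<alpha> (- s) a) (Rep_ell2 \<xi> s)))\<^sup>2 \<le> (norm a)\<^sup>2 * (norm (Rep_ell2 \<xi> s))\<^sup>2"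
    for \<xi> :: "('g, 'h) ell2" and s
    using power_mono[OF le norm_ge_zero, of s "Rep_ell2 \<xi> s" 2] by (simp add: power_mult_distrib)
  have summ: "(\<lambda>s. (norm (blinfun_apply (\<alpha> (- s) a) (Rep_ell2 \<xi> s)))\<^sup>2) summable_on UNIV" for \<xi> :: "('g, 'h) ell2"
    by (rule summable_on_comparison_test[OF summable_on_cmult_right[OF ell2_summable, of "(norm a)\<^sup>2" \<xi>]])
      (use sq in auto)
  define P where "P \<xi> = Abs_ell2 (\<lambda>s. blinfun_apply (\<alpha> (- s) a) (Rep_ell2 \<xi> s))" for \<xi> :: "('g, 'h) ell2"
  have rep: "Rep_ell2 (P \<xi>) s = blinfun_apply (\<alpha> (- s) a) (Rep_ell2 \<xi> s)" for \<xi> s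
    unfolding P_def by (subst Abs_ell2_inverse) (simp_all add: summ)
  have "norm (P \<xi>) \<le> norm \<xi> * norm a" for \<xi>
  proof (rule power2_le_imp_le)
    have "(norm (P \<xi>))\<^sup>2 \<le> (\<Sum>\<^sub>\<infinity>s. (norm a)\<^sup>2 * (norm (Rep_ell2 \<xi> s))\<^sup>2)"
      unfolding norm_ell2_sq rep
      by (rule infsum_mono[OF summ summable_on_cmult_right[OF ell2_summable]]) (rule sq)
    also have "\<dots> = (norm a)\<^sup>2 * (norm \<xi>)\<^sup>2" by (simp add: infsum_cmult_right' norm_ell2_sq)
    finally show "(norm (P \<xi>))\<^sup>2 \<le> (norm \<xi> * norm a)\<^sup>2" by (simp add: power_mult_distrib mult.commute)
  qed simp
  then have "bounded_linear P"
    by (intro bounded_linear_intro[where K = "norm a"])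
      (auto intro!: ell2_eqI simp: rep ell2_rep blinfun.add_right blinfun.scaleR_right)
  then have "blinfun_apply (pi_op \<alpha> a) \<xi> = P \<xi>"
    unfolding pi_op_def by (simp add: bounded_linear_Blinfun_apply P_def[abs_def])
  then show ?thesis by (simp add: rep)
qed

lemma star_hom_pi_op:
  assumes A: "cstar_algebra A" and \<alpha>: "group_action A \<alpha>"
  shows "star_hom A (pi_op \<alpha>)"
  unfolding star_hom_def clinear_on_def
proof (intro conjI ballI allI image_subsetI)
  note pi = pi_op_apply[OF A \<alpha>] and D = star_homD[OF group_action_star_hom(1)[OF A \<alpha>]]
  fix a b c assume a: "a \<in> A"
  have \<alpha>B: "\<alpha> s a \<in> BH" for s by (rule D(1)[OF a])
  show "pi_op \<alpha> a \<in> BH" by (auto simp: BH_def pi a ell2_rep BH_scaleC[OF \<alpha>B] intro!: ell2_eqI)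
  show "pi_op \<alpha> (c *\<^sub>C a) = c *\<^sub>C pi_op \<alpha> a"
    by (rule blinfun_eqI, rule ell2_eqI)
      (simp add: pi a cstar_scaleC[OF A] D scaleC_blinfun.rep_eq ell2_rep)
  show "pi_op \<alpha> (adj a) = adj (pi_op \<alpha> a)"
    by (rule adj_eqI[symmetric])
      (simp add: cinner_ell2_def pi a cstar_adj[OF A] D cinner_adj_right[OF \<alpha>B])
  assume b: "b \<in> A"
  show "pi_op \<alpha> (a + b) = pi_op \<alpha> a + pi_op \<alpha> b"
    by (rule blinfun_eqI, rule ell2_eqI) (simp add: pi a b cstar_add[OF A] D blinfun.add_left ell2_rep)
  show "pi_op \<alpha> (a o\<^sub>L b) = pi_op \<alpha> a o\<^sub>L pi_op \<alpha> b"
    by (rule blinfun_eqI, rule ell2_eqI) (simp add: pi a b cstar_compose[OF A] D)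
qed

lemma minus_add_eq_iff: "- u + s = t \<longleftrightarrow> s - t = (u::'g::group_add)"
proof
  assume "- u + s = t"
  then have "s = u + t" by (simp add: add.assoc[symmetric] flip: \<open>- u + s = t\<close>)
  then show "s - t = u" by (simp add: add.assoc diff_conv_add_uminus del: add_uminus_conv_diff)
next
  assume "s - t = u"
  then have "s = u + t" by (simp add: diff_eq_eq)
  then show "- u + s = t" by (simp add: add.assoc[symmetric])
qed

lemma entry_pi_shift:
  assumes A: "cstar_algebra A" and \<alpha>: "group_action A \<alpha>" and a: "a \<in> A"
  shows "entry (pi_op \<alpha> a o\<^sub>L shift_op r) s t = (if r = s - t then \<alpha> (- s) a else 0)"
  by (rule blinfun_eqI)
    (use minus_add_eq_iff[of r s t] in \<open>auto simp: entry_apply pi_op_apply[OF A \<alpha> a] shift_op_apply emb_vec.rep_eq\<close>)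

lemma entry_pi_tilde:
  assumes A: "cstar_algebra A" and \<alpha>: "group_action A \<alpha>" and f: "f \<in> ell1 A"
  shows "entry (pi_tilde \<alpha> f) s t = \<alpha> (- s) (f (s - t))"
proof -
  have fA: "f r \<in> A" for r using f by (auto simp: ell1_def)
  have le: "norm (pi_op \<alpha> (f r) o\<^sub>L shift_op r) \<le> norm (f r)" for r
  proof (rule norm_blinfun_bound)
    fix \<xi>
    have "norm (blinfun_apply (pi_op \<alpha> (f r) o\<^sub>L shift_op r) \<xi>) \<le> norm (pi_op \<alpha> (f r)) * norm \<xi>"
      using norm_blinfun[of "pi_op \<alpha> (f r)" "blinfun_apply (shift_op r) \<xi>"] by (simp add: shift_op_apply(2))
    also have "\<dots> \<le> norm (f r) * norm \<xi>"
      by (intro mult_right_mono star_hom_contractive[OF A star_hom_pi_op[OF A \<alpha>] fA]) simp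
    finally show "norm (blinfun_apply (pi_op \<alpha> (f r) o\<^sub>L shift_op r) \<xi>) \<le> norm (f r) * norm \<xi>" .
  qed simp
  have "(\<lambda>r. norm (f r)) summable_on UNIV" using f by (simp add: ell1_def)
  then have "(\<lambda>r. pi_op \<alpha> (f r) o\<^sub>L shift_op r) abs_summable_on UNIV"
    by (rule Infinite_Sum.abs_summable_on_comparison_test') (rule le)
  then have "(\<lambda>r. pi_op \<alpha> (f r) o\<^sub>L shift_op r) summable_on UNIV" by (rule abs_summable_summable)
  then have "((\<lambda>r. pi_op \<alpha> (f r) o\<^sub>L shift_op r) has_sum pi_tilde \<alpha> f) UNIV"
    unfolding pi_tilde_def by (rule has_sum_infsum)
  from has_sum_bounded_linear[OF bounded_linear_entry this, of s t]
  have "((\<lambda>r. if r = s - t then \<alpha> (- s) (f r) else 0) has_sum entry (pi_tilde \<alpha> f) s t) UNIV"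
    by (simp add: entry_pi_shift[OF A \<alpha> fA])
  moreover have "((\<lambda>r. if r = s - t then \<alpha> (- s) (f r) else 0) has_sum \<alpha> (- s) (f (s - t))) UNIV"
    by (rule has_sum_cong_neutral[THEN iffD1, OF _ _ _ has_sum_finite[of "{s - t}" "\<lambda>r. \<alpha> (- s) (f r)", simplified]]) auto
  ultimately show ?thesis by (rule has_sum_unique)
qed

lemma ell1_add: "cstar_algebra A \<Longrightarrow> f \<in> ell1 A \<Longrightarrow> g \<in> ell1 A \<Longrightarrow> (\<lambda>s. f s + g s) \<in> ell1 A"
  unfolding ell1_def
  by (auto simp: image_subset_iff intro!: cstar_add
      intro: Infinite_Sum.abs_summable_on_comparison_test'[OF summable_on_add] norm_triangle_ineq)

lemma ell1_scaleC: "cstar_algebra A \<Longrightarrow> f \<in> ell1 A \<Longrightarrow> (\<lambda>s. c *\<^sub>C f s) \<in> ell1 A"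
  unfolding ell1_def
  by (auto simp: image_subset_iff norm_scaleC intro!: cstar_scaleC summable_on_cmult_right)

lemma ell1_D: "f \<in> ell1 A \<Longrightarrow> f s \<in> A" by (auto simp: ell1_def)

lemma csubspace_pi_tilde:
  assumes A: "cstar_algebra A" and \<alpha>: "group_action A \<alpha>"
  shows "csubspace (pi_tilde \<alpha> ` ell1 A)"
proof (rule complex_module.subspaceI)
  note ent = entry_pi_tilde[OF A \<alpha>] and D = star_homD[OF group_action_star_hom(1)[OF A \<alpha>]]
  have z: "(\<lambda>_. 0) \<in> ell1 A" by (auto simp: ell1_def cstar_zero[OF A])
  have "pi_tilde \<alpha> (\<lambda>_. 0) = 0"
    using D(3)[OF cstar_zero[OF A], where c = 0] by (intro entry_eqI) (simp add: ent[OF z] entry_zero)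
  then show "0 \<in> pi_tilde \<alpha> ` ell1 A" using z by (metis image_eqI)
next
  note ent = entry_pi_tilde[OF A \<alpha>] and D = star_homD[OF group_action_star_hom(1)[OF A \<alpha>]]
  fix S T assume "S \<in> pi_tilde \<alpha> ` ell1 A" "T \<in> pi_tilde \<alpha> ` ell1 A"
  then obtain f g where fg: "f \<in> ell1 A" "S = pi_tilde \<alpha> f" "g \<in> ell1 A" "T = pi_tilde \<alpha> g" by blast
  have "S + T = pi_tilde \<alpha> (\<lambda>s. f s + g s)"
    by (rule entry_eqI) (simp add: fg entry_add ent ell1_add[OF A] D ell1_D[OF fg(1)] ell1_D[OF fg(3)])
  then show "S + T \<in> pi_tilde \<alpha> ` ell1 A" using ell1_add[OF A fg(1,3)] by blast
next
  note ent = entry_pi_tilde[OF A \<alpha>] and D = star_homD[OF group_action_star_hom(1)[OF A \<alpha>]]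
  fix c T assume "T \<in> pi_tilde \<alpha> ` ell1 A"
  then obtain f where f: "f \<in> ell1 A" "T = pi_tilde \<alpha> f" by blast
  have "c *\<^sub>C T = pi_tilde \<alpha> (\<lambda>s. c *\<^sub>C f s)"
    by (rule entry_eqI) (simp add: f entry_scaleC ent ell1_scaleC[OF A] D ell1_D[OF f(1)])
  then show "c *\<^sub>C T \<in> pi_tilde \<alpha> ` ell1 A" using ell1_scaleC[OF A f(1)] by blast
qed

lemma hs_map0_pi_tilde:
  assumes A: "cstar_algebra A" and \<alpha>: "group_action A \<alpha>" and f: "f \<in> ell1 A"
  shows "hs_map0 A \<alpha> F (pi_tilde \<alpha> f) = pi_tilde \<alpha> (\<lambda>t. F t (f t))"
proof -
  have "(THE g. g \<in> ell1 A \<and> pi_tilde \<alpha> g = pi_tilde \<alpha> f) = f"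
  proof (rule the_equality)
    fix g assume g: "g \<in> ell1 A \<and> pi_tilde \<alpha> g = pi_tilde \<alpha> f"
    show "g = f"
    proof
      fix s
      have "\<alpha> (- s) (g s) = \<alpha> (- s) (f s)"
        using entry_pi_tilde[OF A \<alpha>, of g s 0] entry_pi_tilde[OF A \<alpha> f, of s 0] g by simp
      then have "\<alpha> s (\<alpha> (- s) (g s)) = \<alpha> s (\<alpha> (- s) (f s))" by simp
      then show "g s = f s" using g f by (simp add: group_action_inverse[OF \<alpha>] ell1_D)
    qed
  qed (use f in simp)
  then show ?thesis by (simp add: hs_map0_def)
qed

lemma ell1_multiply:
  assumes A: "cstar_algebra A" and F: "bounded_CB_family A A F" and f: "f \<in> ell1 A"
  shows "(\<lambda>t. F t (f t)) \<in> ell1 A"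
proof -
  obtain C where C: "0 \<le> C" "\<And>i a. a \<in> A \<Longrightarrow> norm (F i a) \<le> C * norm a"
    by (rule bounded_CB_family_bound[OF csubspace_cstar[OF A] F]) blast
  have "F t (f t) \<in> A" for t
  proof -
    have "F t \<in> CB A A" using F by (auto simp: bounded_CB_family_def)
    then show ?thesis by (rule CB_D(3)) (rule ell1_D[OF f])
  qed
  moreover have "(\<lambda>t. norm (F t (f t))) summable_on UNIV"
    by (rule Infinite_Sum.abs_summable_on_comparison_test'[of "\<lambda>t. C * norm (f t)"])
      (use f C(2) ell1_D[OF f] in \<open>auto simp: ell1_def intro!: summable_on_cmult_right\<close>)
  ultimately show ?thesis by (auto simp: ell1_def)
qed

text \<open>
  The entries of \<open>pi_tilde \<alpha> f\<close> are \<open>\<alpha>\<^bsub>-s\<^esub>(f(s - t))\<close>, so that multiplying \<open>f\<close> by \<open>F\<close> is applying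
  \<open>N_map \<alpha> F\<close> to the entries.
\<close>

lemma hs_map0_entrywise:
  assumes A: "cstar_algebra A" and \<alpha>: "group_action A \<alpha>" and F: "bounded_CB_family A A F"
  shows "acts_entrywise A (N_map \<alpha> F) (pi_tilde \<alpha> ` ell1 A) (hs_map0 A \<alpha> F)"
  unfolding acts_entrywise_def
proof (intro ballI allI)
  fix T s t assume "T \<in> pi_tilde \<alpha> ` ell1 A"
  then obtain f where f: "f \<in> ell1 A" "T = pi_tilde \<alpha> f" by blast
  show "entry T s t \<in> A \<and> entry (hs_map0 A \<alpha> F T) s t = N_map \<alpha> F s t (entry T s t)"
    using group_action_star_hom(2)[OF A \<alpha> ell1_D[OF f(1)]]
    by (simp add: f hs_map0_pi_tilde[OF A \<alpha>] entry_pi_tilde[OF A \<alpha>] ell1_multiply[OF A F] N_map_def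
        group_action_inverse[OF \<alpha> ell1_D[OF f(1)]])
qed

text \<open>Conjugation by the completely contractive maps \<open>\<alpha> s\<close> does not increase completely bounded norms.\<close>

lemma N_map_bounded:
  assumes A: "cstar_algebra A" and \<alpha>: "group_action A \<alpha>" and F: "bounded_CB_family A A F"
  shows "bounded_CB_family A BH (case_prod (N_map \<alpha> F))"
proof -
  obtain C where C: "\<And>t. cb_norm A (F t) \<le> C" using F by (auto simp: bounded_CB_family_def bdd_above_def)
  have FCB: "F t \<in> CB A A" for t using F by (auto simp: bounded_CB_family_def)
  have C0: "0 \<le> C" using cb_norm_nonneg[OF CB_D(2)[OF FCB]] C order_trans by blast
  note \<alpha>A = group_action_star_hom(2)[OF A \<alpha>] and \<alpha>hom = group_action_star_hom(1)[OF A \<alpha>]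
  note D = star_homD[OF \<alpha>hom]
  have bound: "mat_norm n (\<lambda>i j. N_map \<alpha> F s t (a i j)) \<le> C * mat_norm n a" if a: "a \<in> mats n A" for n s t a
  proof -
    have 1: "(\<lambda>i j. \<alpha> s (a i j)) \<in> mats n A" using a \<alpha>A by (simp add: mats_def)
    have 2: "(\<lambda>i j. F (s - t) (\<alpha> s (a i j))) \<in> mats n A" using 1 CB_D(3)[OF FCB] by (simp add: mats_def)
    have "mat_norm n (\<lambda>i j. N_map \<alpha> F s t (a i j)) \<le> mat_norm n (\<lambda>i j. F (s - t) (\<alpha> s (a i j)))"
      unfolding N_map_def by (rule mat_norm_star_hom_le[OF A \<alpha>hom 2])
    also have "\<dots> \<le> cb_norm A (F (s - t)) * mat_norm n (\<lambda>i j. \<alpha> s (a i j))"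
      by (rule mat_norm_le_cb_norm[OF CB_D(2)[OF FCB] 1])
        (simp add: csubspace_scaleR[OF csubspace_cstar[OF A]] clinear_on_scaleR[OF CB_D(1)[OF FCB]])
    also have "\<dots> \<le> C * mat_norm n a"
      by (intro mult_mono C mat_norm_star_hom_le[OF A \<alpha>hom a] C0 mat_norm_nonneg)
    finally show ?thesis .
  qed
  have "N_map \<alpha> F s t \<in> CB A BH" for s t
    unfolding CB_def
  proof (intro CollectI conjI image_subsetI)
    have cl: "clinear_on A (F r)" for r by (rule CB_D(1)[OF FCB])
    show "clinear_on A (N_map \<alpha> F s t)"
      using cl unfolding clinear_on_def N_map_def
      by (simp add: D \<alpha>A CB_D(3)[OF FCB])
    show "N_map \<alpha> F s t a \<in> BH" if "a \<in> A" for a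
      unfolding N_map_def by (intro D(1) CB_D(3)[OF FCB] \<alpha>A that)
    show "completely_bounded A (N_map \<alpha> F s t)" by (rule cb_norm_le(2)[OF C0 bound])
  qed
  moreover have "cb_norm A (N_map \<alpha> F s t) \<le> C" for s t by (rule cb_norm_le(1)[OF C0 bound])
  ultimately show ?thesis
    unfolding bounded_CB_family_def by (auto intro!: bdd_aboveI2[where M = C])
qed

lemma N_map_CB:
  "cstar_algebra A \<Longrightarrow> group_action A \<alpha> \<Longrightarrow> bounded_CB_family A A F \<Longrightarrow> N_map \<alpha> F s t \<in> CB A BH"
  by (rule bounded_CB_family_CB[OF N_map_bounded])

lemma norm_N_map_diag_le:
  assumes A: "cstar_algebra A" and \<alpha>: "group_action A \<alpha>" and F: "F 0 \<in> CB A A" and a: "a \<in> A"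
  shows "norm (N_map \<alpha> F s s a) \<le> cb_norm A (F 0) * norm a"
proof -
  note \<alpha>A = group_action_star_hom(2)[OF A \<alpha>] and con = star_hom_contractive[OF A group_action_star_hom(1)[OF A \<alpha>]]
  have "norm (N_map \<alpha> F s s a) \<le> norm (F 0 (\<alpha> s a))"
    unfolding N_map_def by (simp add: con CB_D(3)[OF F] \<alpha>A a)
  also have "\<dots> \<le> cb_norm A (F 0) * norm (\<alpha> s a)"
    by (rule norm_le_cb_norm[OF F \<alpha>A[OF a] csubspace_scaleR[OF csubspace_cstar[OF A]]])
  also have "\<dots> \<le> cb_norm A (F 0) * norm a"
    by (intro mult_left_mono con a cb_norm_nonneg CB_D(2)[OF F])
  finally show ?thesis .
qed

lemma hs_map_entrywise:
  assumes A: "cstar_algebra A" and \<alpha>: "group_action A \<alpha>" and F: "herz_schur_multiplier A \<alpha> F"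
  shows "hs_map A \<alpha> F \<in> CB (crossed_product A \<alpha>) (crossed_product A \<alpha>)"
    and "acts_entrywise A (N_map \<alpha> F) (crossed_product A \<alpha>) (hs_map A \<alpha> F)"
proof -
  have fam: "bounded_CB_family A A F" and cb: "hs_map0 A \<alpha> F \<in> CB (pi_tilde \<alpha> ` ell1 A) (crossed_product A \<alpha>)"
    using F by (auto simp: herz_schur_multiplier_def)
  note cs = csubspace_pi_tilde[OF A \<alpha>]
  have cp: "crossed_product A \<alpha> = closure (pi_tilde \<alpha> ` ell1 A)" by (simp add: crossed_product_def)
  have closed: "closed (crossed_product A \<alpha>)" by (simp add: cp)
  note ext = cb_extension_works[OF cb cs closed cp, folded hs_map_def]
  show 1: "hs_map A \<alpha> F \<in> CB (crossed_product A \<alpha>) (crossed_product A \<alpha>)" by (rule ext(1))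
  have "acts_entrywise A (N_map \<alpha> F) (pi_tilde \<alpha> ` ell1 A) (hs_map A \<alpha> F)"
    using hs_map0_entrywise[OF A \<alpha> fam] ext(2) by (simp add: acts_entrywise_def)
  then show "acts_entrywise A (N_map \<alpha> F) (crossed_product A \<alpha>) (hs_map A \<alpha> F)"
    unfolding cp by (rule acts_entrywise_closure[OF A N_map_CB[OF A \<alpha> fam] _ cs 1[unfolded cp]])
qed

text \<open>
  The operators \<open>\<lambda>\<^bsub>x p\<^esub> \<pi>(a\<^bsub>p q\<^esub>) \<lambda>\<^bsub>- x q\<^esub>\<close> lie in the crossed product and have \<open>a\<^bsub>p q\<^esub>\<close> as their
  entry at \<open>(x p, x q)\<close>. As \<open>\<pi>\<close> is a homomorphism, they form a positive matrix if \<open>a\<close> is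
  positive.
\<close>

lemma crossed_product_lift:
  fixes a :: "nat \<Rightarrow> nat \<Rightarrow> 'h::chilbert_space \<Rightarrow>\<^sub>L 'h" and x :: "nat \<Rightarrow> 'g::group_add"
  assumes A: "cstar_algebra A" and \<alpha>: "group_action A \<alpha>" and a: "a \<in> mats n A"
  defines "T \<equiv> \<lambda>p q. shift_op (x p) o\<^sub>L pi_op \<alpha> (a p q) o\<^sub>L shift_op (- x q)"
  shows "T \<in> mats n (crossed_product A \<alpha>)" and "p < n \<Longrightarrow> q < n \<Longrightarrow> entry (T p q) (x p) (x q) = a p q"
    and "mat_norm n T \<le> mat_norm n a" and "mat_positive n a \<Longrightarrow> mat_positive n T"
proof -
  have aA: "a p q \<in> A" if "p < n" "q < n" for p q using a that by (simp add: mats_def)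
  have ent: "entry (T p q) s t = (if s - t = x p - x q then \<alpha> (- s + x p) (a p q) else 0)" if pq: "p < n" "q < n" for p q s t
  proof -
    have "x q + (- x p + s) = t \<longleftrightarrow> s - t = x p - x q"
      using minus_add_eq_iff[of "x p - x q" s t] by (simp add: add.assoc[symmetric])
    then show ?thesis
      by (intro blinfun_eqI)
        (auto simp: T_def entry_apply shift_op_apply pi_op_apply[OF A \<alpha> aA[OF pq]] emb_vec.rep_eq minus_add)
  qed
  show "entry (T p q) (x p) (x q) = a p q" if "p < n" "q < n" for p q
    using that by (simp add: ent group_action_zero[OF \<alpha>] aA)
  show "T \<in> mats n (crossed_product A \<alpha>)"
    unfolding mats_def
  proof (intro CollectI allI impI)
    fix p q assume pq: "p < n" "q < n"
    define f where "f r = (if r = x p - x q then \<alpha> (x p) (a p q) else 0)" for r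
    have f: "f \<in> ell1 A"
    proof -
      have "((\<lambda>r. norm (f r)) summable_on UNIV) = ((\<lambda>r. norm (f r)) summable_on {x p - x q})"
        by (rule summable_on_cong_neutral) (auto simp: f_def)
      then show ?thesis
        by (auto simp: ell1_def f_def cstar_zero[OF A] group_action_star_hom(2)[OF A \<alpha>] aA pq)
    qed
    have "T p q = pi_tilde \<alpha> f"
    proof (rule entry_eqI)
      fix s t
      have "\<alpha> (- s) 0 = 0"
        using clinear_on_zero[OF _ cstar_zero[OF A], of "\<alpha> (- s)"] group_action_star_hom(1)[OF A \<alpha>, of "- s"]
        by (simp add: star_hom_def)
      then show "entry (T p q) s t = entry (pi_tilde \<alpha> f) s t"
        by (simp add: ent[OF pq] entry_pi_tilde[OF A \<alpha> f] f_def group_action_add[OF \<alpha> aA[OF pq]])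
    qed
    then show "T p q \<in> crossed_product A \<alpha>"
      unfolding crossed_product_def using f by (auto intro: subsetD[OF closure_subset])
  qed
  note conj = fin_op_conjugate[OF finite_lessThan, where V = "\<lambda>p. shift_op (x p)" and W = "\<lambda>p. shift_op (- x p)"
      and S = "\<lambda>p q. pi_op \<alpha> (a p q)", OF cinner_shift_op eq_refl[OF shift_op_apply(2)]]
  show "mat_norm n T \<le> mat_norm n a"
    using conj(1)[of n] mat_norm_star_hom_le[OF A star_hom_pi_op[OF A \<alpha>] a]
    unfolding T_def mat_norm_eq by linarith
  show "mat_positive n a \<Longrightarrow> mat_positive n T"
    using conj(2)[of n] mat_positive_star_hom[OF A star_hom_pi_op[OF A \<alpha>] a]
    unfolding T_def mat_positive_eq by blast
qed

section \<open>Completely positive multipliers\<close>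

lemma positive_type_imp_cp_herz_schur:
  fixes \<alpha> :: "'g::group_add \<Rightarrow> ('h::chilbert_space \<Rightarrow>\<^sub>L 'h) \<Rightarrow> 'h \<Rightarrow>\<^sub>L 'h"
  assumes A: "cstar_algebra A" and \<alpha>: "group_action A \<alpha>" and F: "bounded_CB_family A A F"
    and pt: "positive_type A (N_map \<alpha> F)"
  shows "cp_herz_schur_multiplier A \<alpha> F"
proof -
  have F0: "F 0 \<in> CB A A" using F by (auto simp: bounded_CB_family_def)
  let ?D = "pi_tilde \<alpha> ` ell1 A"
  note act = hs_map0_entrywise[OF A \<alpha> F] and cs = csubspace_pi_tilde[OF A \<alpha>]
  have "clinear_on ?D (hs_map0 A \<alpha> F)"
    by (rule acts_entrywise_clinear[OF act cs CB_D(1)[OF N_map_CB[OF A \<alpha> F]]])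
  moreover have "hs_map0 A \<alpha> F ` ?D \<subseteq> crossed_product A \<alpha>"
  proof (clarify)
    fix f :: "'g \<Rightarrow> 'h \<Rightarrow>\<^sub>L 'h" assume f: "f \<in> ell1 A"
    have "pi_tilde \<alpha> (\<lambda>t. F t (f t)) \<in> ?D" by (rule imageI) (rule ell1_multiply[OF A F f])
    then show "hs_map0 A \<alpha> F (pi_tilde \<alpha> f) \<in> crossed_product A \<alpha>"
      unfolding hs_map0_pi_tilde[OF A \<alpha> f] crossed_product_def by (rule subsetD[OF closure_subset])
  qed
  moreover have "completely_bounded ?D (hs_map0 A \<alpha> F)"
    by (rule cb_norm_le(2)[OF cb_norm_nonneg[OF CB_D(2)[OF F0]]])
      (rule acts_entrywise_norm[OF A pt act cb_norm_nonneg[OF CB_D(2)[OF F0]] norm_N_map_diag_le[where F = F, OF A \<alpha> F0]])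
  ultimately have hs: "herz_schur_multiplier A \<alpha> F" using F by (simp add: herz_schur_multiplier_def CB_def)
  note E = hs_map_entrywise[OF A \<alpha> hs]
  have "completely_positive (crossed_product A \<alpha>) (hs_map A \<alpha> F)"
    unfolding completely_positive_def using CB_D(1)[OF E(1)] acts_entrywise_positive[OF pt E(2)] by blast
  with hs show ?thesis by (simp add: cp_herz_schur_multiplier_def)
qed

lemma cp_herz_schur_imp_positive_type:
  assumes A: "cstar_algebra A" and \<alpha>: "group_action A \<alpha>" and cp: "cp_herz_schur_multiplier A \<alpha> F"
  shows "positive_type A (N_map \<alpha> F)"
proof -
  have hs: "herz_schur_multiplier A \<alpha> F" and pos: "completely_positive (crossed_product A \<alpha>) (hs_map A \<alpha> F)"
    using cp by (simp_all add: cp_herz_schur_multiplier_def)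
  have F: "bounded_CB_family A A F" using hs by (simp add: herz_schur_multiplier_def)
  show ?thesis
  proof (rule positive_typeI_entrywise[OF N_map_bounded[OF A \<alpha> F] hs_map_entrywise(2)[OF A \<alpha> hs] pos])
    fix m x a assume a: "a \<in> mats m A" "mat_positive m a"
    show "\<exists>T\<in>mats m (crossed_product A \<alpha>). mat_positive m T \<and> (\<forall>p<m. \<forall>q<m. entry (T p q) (x p) (x q) = a p q)"
      by (rule bexI[OF _ crossed_product_lift(1)[where x = x, OF A \<alpha> a(1)]])
        (simp add: crossed_product_lift(2,4)[OF A \<alpha> a(1)] a(2))
  qed
qed

lemma cb_norm_cong: "(\<And>a. a \<in> V \<Longrightarrow> \<phi> a = \<psi> a) \<Longrightarrow> cb_norm V \<phi> = cb_norm V \<psi>"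
proof -
  assume eq: "\<And>a. a \<in> V \<Longrightarrow> \<phi> a = \<psi> a"
  have "mat_norm n (\<lambda>i j. \<phi> (T i j)) = mat_norm n (\<lambda>i j. \<psi> (T i j))" if "T \<in> mats n V" for n T
    by (rule mat_norm_cong) (use eq that in \<open>simp add: mats_def\<close>)
  then have "{mat_norm n (\<lambda>i j. \<phi> (T i j)) | n T. T \<in> mats n V \<and> mat_norm n T \<le> 1}
      = {mat_norm n (\<lambda>i j. \<psi> (T i j)) | n T. T \<in> mats n V \<and> mat_norm n T \<le> 1}"
    by (intro Collect_cong) metis
  then show ?thesis by (simp only: cb_norm_def)
qed

lemma N_map_at_zero:
  assumes A: "cstar_algebra A" and \<alpha>: "group_action A \<alpha>" and F: "F 0 \<in> CB A A"
  shows "cb_norm A (N_map \<alpha> F 0 0) = cb_norm A (F 0)"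
  by (rule cb_norm_cong) (simp add: N_map_def group_action_zero[OF \<alpha>] CB_D(3)[OF F])

text \<open>
  On the diagonal \<open>N_map \<alpha> F\<close> is \<open>F 0\<close> conjugated by \<open>\<alpha> s\<close>, whence the one bound for both maps.
\<close>

lemma cb_norm_entrywise_le:
  assumes A: "cstar_algebra A" and \<alpha>: "group_action A \<alpha>" and F: "F 0 \<in> CB A A"
    and pt: "positive_type A (N_map \<alpha> F)" and act: "acts_entrywise A (N_map \<alpha> F) V \<psi>"
  shows "cb_norm V \<psi> \<le> cb_norm A (F 0)"
  by (rule cb_norm_le(1)[OF cb_norm_nonneg[OF CB_D(2)[OF F]]])
    (rule acts_entrywise_norm[OF A pt act cb_norm_nonneg[OF CB_D(2)[OF F]] norm_N_map_diag_le[where F = F, OF A \<alpha> F]])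

theorem theorem2p8:
  fixes A :: "('h::chilbert_space \<Rightarrow>\<^sub>L 'h) set"
    and \<alpha> :: "'g::group_add \<Rightarrow> ('h \<Rightarrow>\<^sub>L 'h) \<Rightarrow> 'h \<Rightarrow>\<^sub>L 'h"
    and F :: "'g \<Rightarrow> ('h \<Rightarrow>\<^sub>L 'h) \<Rightarrow> 'h \<Rightarrow>\<^sub>L 'h"
  assumes "cstar_algebra A" and "nondegenerate A"
    and "group_action A \<alpha>"
    and "bounded_CB_family A A F"
  shows "(cp_herz_schur_multiplier A \<alpha> F \<longleftrightarrow> positive_type A (N_map \<alpha> F)) \<and>
    (positive_type A (N_map \<alpha> F) \<longleftrightarrow>
      schur_multiplier A (N_map \<alpha> F) \<and>
      completely_positive (compact_tensor A) (schur_map A (N_map \<alpha> F))) \<and>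
    (cp_herz_schur_multiplier A \<alpha> F \<longrightarrow>
      cb_norm (crossed_product A \<alpha>) (hs_map A \<alpha> F)
        = cb_norm (compact_tensor A) (schur_map A (N_map \<alpha> F)) \<and>
      cb_norm (compact_tensor A) (schur_map A (N_map \<alpha> F)) = cb_norm A (F 0))"
proof (intro conjI impI)
  note A = assms(1) and \<alpha> = assms(3) and F = assms(4)
  have F0: "F 0 \<in> CB A A" using F by (auto simp: bounded_CB_family_def)
  show i_ii: "cp_herz_schur_multiplier A \<alpha> F \<longleftrightarrow> positive_type A (N_map \<alpha> F)"
    using positive_type_imp_cp_herz_schur[OF A \<alpha> F] cp_herz_schur_imp_positive_type[OF A \<alpha>] by blast
  show "positive_type A (N_map \<alpha> F) \<longleftrightarrow>
      schur_multiplier A (N_map \<alpha> F) \<and> completely_positive (compact_tensor A) (schur_map A (N_map \<alpha> F))"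
    using positive_type_imp_schur_multiplier[OF A] schur_completely_positive_imp_positive_type[OF A] by blast
  assume cp: "cp_herz_schur_multiplier A \<alpha> F"
  then have pt: "positive_type A (N_map \<alpha> F)" and hs: "herz_schur_multiplier A \<alpha> F"
    using i_ii by (simp_all add: cp_herz_schur_multiplier_def)
  have sm: "schur_multiplier A (N_map \<alpha> F)" by (rule positive_type_imp_schur_multiplier(1)[OF A pt])
  show schur: "cb_norm (compact_tensor A) (schur_map A (N_map \<alpha> F)) = cb_norm A (F 0)"
  proof (rule antisym)
    show "cb_norm (compact_tensor A) (schur_map A (N_map \<alpha> F)) \<le> cb_norm A (F 0)"
      by (rule cb_norm_entrywise_le[where F = F, OF A \<alpha> F0 pt schur_map_entrywise(2)[OF A sm]])
    show "cb_norm A (F 0) \<le> cb_norm (compact_tensor A) (schur_map A (N_map \<alpha> F))"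
      using cb_norm_schur_ge[OF A sm, of 0] by (simp only: N_map_at_zero[where \<alpha> = \<alpha> and F = F, OF A \<alpha> F0])
  qed
  have "cb_norm (crossed_product A \<alpha>) (hs_map A \<alpha> F) = cb_norm A (F 0)"
  proof (rule antisym)
    show "cb_norm (crossed_product A \<alpha>) (hs_map A \<alpha> F) \<le> cb_norm A (F 0)"
      by (rule cb_norm_entrywise_le[where F = F, OF A \<alpha> F0 pt hs_map_entrywise(2)[OF A \<alpha> hs]])
    have "cb_norm A (N_map \<alpha> F 0 0) \<le> cb_norm (crossed_product A \<alpha>) (hs_map A \<alpha> F)"
    proof (rule cb_norm_le_entrywise[OF hs_map_entrywise(2)[OF A \<alpha> hs] CB_D(2)[OF hs_map_entrywise(1)[OF A \<alpha> hs]]])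
      fix n a assume a: "a \<in> mats n A"
      show "\<exists>T\<in>mats n (crossed_product A \<alpha>). mat_norm n T \<le> mat_norm n a \<and> (\<forall>p<n. \<forall>q<n. entry (T p q) 0 0 = a p q)"
        by (rule bexI[OF _ crossed_product_lift(1)[where x = "\<lambda>_. 0", OF A \<alpha> a]])
          (use crossed_product_lift(2,3)[where x = "\<lambda>_. 0", OF A \<alpha> a] in blast)
    qed
    then show "cb_norm A (F 0) \<le> cb_norm (crossed_product A \<alpha>) (hs_map A \<alpha> F)"
      by (simp only: N_map_at_zero[where \<alpha> = \<alpha> and F = F, OF A \<alpha> F0])
  qed
  then show "cb_norm (crossed_product A \<alpha>) (hs_map A \<alpha> F) = cb_norm (compact_tensor A) (schur_map A (N_map \<alpha> F))"
    by (simp only: schur)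
qed

end
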